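(* Let $R$ be a Noetherian normal domain, let $B=R[X_1,\dots,X_n]$ be a polynomial ring in $n$ variables over $R$, and let $A$ be an $R$-subalgebra of $B$. Then the following are equivalent: (I) $A$ is a retract of $B$ and $A=B^{\phi}$ for some exponential map $\phi\in\operatorname{Exp}_A(B)$ with $\phi\neq \mathrm{Id}$; (II) $B\cong \operatorname{Sym}_A(IA)$ as $A$-algebras for some invertible ideal $I$ of $R$.
   Context: A subring $A$ of a ring $B$ is a retract of $B$ if there is an idempotent ring endomorphism $\pi:B\to B$ with $\pi(B)=A$. For a ring $B$ and an indeterminate $U$, an exponential map on $B$ (over a ring $C\subseteq B$) is a $C$-algebra homomorphism $\phi_U: B\to B[U]$ such that (i) composing with evaluation at $U=0$ gives the identity on $B$, and (ii) $\phi_V\phi_U=\phi_{V+U}$, where $\phi_V:B\to B[V]$ is extended to $B[U]\to B[V,U]$ by $\phi_V(U)=U$. $\operatorname{Exp}_C(B)$ is the set of such maps; $\phi\neq\mathrm{Id}$ means $\phi$ is not the map $b\mapsto b$. The ring of invariants is $B^{\phi}=\{b\in B:\phi(b)=b\}$. $\operatorname{Sym}_A(M)$ denotes the symmetric algebra of an $A$-module $M$. *)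

theory Defs
  imports "HOL-Library.Poly_Mapping" "HOL-Computational_Algebra.Polynomial"
          "HOL-Computational_Algebra.Fraction_Field"
begin

text \<open>Finite linear combinations with coefficients from P of elements of S.
  fin_comb P S is the ideal of the ring P generated by S (for S a subset of P),
  and fin_comb X Y is also the product X Y of two submodules.\<close>
definition fin_comb :: "'a::comm_ring_1 set \<Rightarrow> 'a set \<Rightarrow> 'a set" where
  "fin_comb P S = {\<Sum>k<N. p k * s k | (N::nat) p s. \<forall>k<N. p k \<in> P \<and> s k \<in> S}"

definition is_ideal :: "'a::comm_ring_1 set \<Rightarrow> bool" where
  "is_ideal I \<longleftrightarrow> 0 \<in> I \<and> (\<forall>x\<in>I. \<forall>y\<in>I. x + y \<in> I) \<and> (\<forall>r x. x \<in> I \<longrightarrow> r * x \<in> I)"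

definition noetherian_ring :: "'a::comm_ring_1 itself \<Rightarrow> bool" where
  "noetherian_ring _ \<longleftrightarrow>
     (\<forall>I::'a set. is_ideal I \<longrightarrow> (\<exists>F. finite F \<and> I = fin_comb UNIV F))"

definition normal_domain :: "'a::idom itself \<Rightarrow> bool" where
  "normal_domain _ \<longleftrightarrow>
     (\<forall>x::'a fract. (\<exists>p::'a poly. lead_coeff p = 1 \<and> poly (map_poly (\<lambda>r. Fract r 1) p) x = 0)
        \<longrightarrow> x \<in> range (\<lambda>r. Fract r 1))"

definition invertible_ideal :: "'a::idom set \<Rightarrow> bool" where
  "invertible_ideal I \<longleftrightarrow> is_ideal I \<and>
     (\<exists>J::'a fract set. 0 \<in> J \<and> (\<forall>x\<in>J. \<forall>y\<in>J. x + y \<in> J)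
        \<and> (\<forall>r. \<forall>x\<in>J. Fract r 1 * x \<in> J)
        \<and> fin_comb ((\<lambda>r. Fract r 1) ` I) J = range (\<lambda>r. Fract r 1))"

definition ring_hom_fun :: "('a::comm_ring_1 \<Rightarrow> 'b::comm_ring_1) \<Rightarrow> bool" where
  "ring_hom_fun f \<longleftrightarrow> (\<forall>x y. f (x + y) = f x + f y \<and> f (x * y) = f x * f y) \<and> f 1 = 1"

definition retract :: "'a::comm_ring_1 set \<Rightarrow> bool" where
  "retract A \<longleftrightarrow> (\<exists>\<pi>::'a \<Rightarrow> 'a. ring_hom_fun \<pi> \<and> \<pi> \<circ> \<pi> = \<pi> \<and> range \<pi> = A)"

text \<open>Exponential maps B \<rightarrow> B[U] over a subring C. B[U] is 'b poly; B[V,U] is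
  ('b poly) poly with outer variable U and inner variable V.
  phi_V extended to B[U] acts coefficientwise (map_poly phi), and
  phi_{V+U}(b) substitutes U := V + U, where V + U = [:[:0,1:], 1:].\<close>
definition exp_map :: "'b::comm_ring_1 set \<Rightarrow> ('b \<Rightarrow> 'b poly) \<Rightarrow> bool" where
  "exp_map C \<phi> \<longleftrightarrow> ring_hom_fun \<phi> \<and> (\<forall>c\<in>C. \<phi> c = [:c:])
     \<and> (\<forall>b. poly (\<phi> b) 0 = b)
     \<and> (\<forall>b. map_poly \<phi> (\<phi> b) =
             pcompose (map_poly (\<lambda>c. [:c:]) (\<phi> b)) [:[:0, 1:], 1:])"

definition invariants :: "('b::comm_ring_1 \<Rightarrow> 'b poly) \<Rightarrow> 'b set" where
  "invariants \<phi> = {b. \<phi> b = [:b:]}"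

text \<open>Sym_A(M) = A[T_m : m \<in> M] / (T_{m+m'} - T_m - T_{m'}, T_{am} - a T_m).
  Polynomials in variables indexed by elements of the ambient type 'b.\<close>
definition sym_var :: "'b \<Rightarrow> ('b \<Rightarrow>\<^sub>0 nat) \<Rightarrow>\<^sub>0 'b::comm_ring_1" where
  "sym_var m = Poly_Mapping.single (Poly_Mapping.single m 1) 1"

definition sym_pre :: "'b::comm_ring_1 set \<Rightarrow> 'b set \<Rightarrow> (('b \<Rightarrow>\<^sub>0 nat) \<Rightarrow>\<^sub>0 'b) set" where
  "sym_pre A M = {p. \<forall>\<mu>. Poly_Mapping.lookup p \<mu> \<in> A \<and> (Poly_Mapping.lookup p \<mu> \<noteq> 0 \<longrightarrow> Poly_Mapping.keys \<mu> \<subseteq> M)}"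

definition sym_rel :: "'b::comm_ring_1 set \<Rightarrow> 'b set \<Rightarrow> (('b \<Rightarrow>\<^sub>0 nat) \<Rightarrow>\<^sub>0 'b) set" where
  "sym_rel A M =
     {sym_var (m + m') - sym_var m - sym_var m' | m m'. m \<in> M \<and> m' \<in> M}
   \<union> {sym_var (a * m) - Poly_Mapping.single 0 a * sym_var m | a m. a \<in> A \<and> m \<in> M}"

text \<open>The whole ring (UNIV of 'b) is isomorphic as an A-algebra to Sym_A(M):
  there is an A-algebra homomorphism from A[T_m] onto it whose kernel is exactly
  the ideal generated by the defining relations.\<close>
definition iso_sym_alg :: "'b::comm_ring_1 set \<Rightarrow> 'b set \<Rightarrow> bool" where
  "iso_sym_alg A M \<longleftrightarrow>
     (\<exists>\<psi> :: (('b \<Rightarrow>\<^sub>0 nat) \<Rightarrow>\<^sub>0 'b) \<Rightarrow> 'b.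
        (\<forall>p\<in>sym_pre A M. \<forall>q\<in>sym_pre A M. \<psi> (p + q) = \<psi> p + \<psi> q \<and> \<psi> (p * q) = \<psi> p * \<psi> q)
      \<and> (\<forall>a\<in>A. \<psi> (Poly_Mapping.single 0 a) = a)
      \<and> \<psi> ` sym_pre A M = UNIV
      \<and> {p \<in> sym_pre A M. \<psi> p = 0} = fin_comb (sym_pre A M) (sym_rel A M))"

definition rconst :: "'r \<Rightarrow> ('v \<Rightarrow>\<^sub>0 nat) \<Rightarrow>\<^sub>0 'r::comm_ring_1" where
  "rconst r = Poly_Mapping.single 0 r"

definition R_subalgebra :: "(('v \<Rightarrow>\<^sub>0 nat) \<Rightarrow>\<^sub>0 'r::comm_ring_1) set \<Rightarrow> bool" where
  "R_subalgebra A \<longleftrightarrow> range rconst \<subseteq> A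
     \<and> (\<forall>x\<in>A. \<forall>y\<in>A. x + y \<in> A \<and> x * y \<in> A \<and> - x \<in> A)"

end

theory Submission
  imports Defs
begin

text \<open>Suppose A is a retract with kernel P and the ring of invariants of a nontrivial exponential map.
  If \<open>x \<in> P\<close> has least positive degree under the exponential map and c is the leading coefficient
  of its image, then \<open>P = x B[1/c] \<inter> B\<close>. Hence, over the fraction field of R, the prime P is
  generated by one element f, and by Gauss's lemma \<open>P = f J B\<close> for the R-module
  \<open>J = (R : content f)\<close>. As P contains all \<open>X\<^sup>\<mu> - \<pi>(X\<^sup>\<mu>)\<close> and \<open>\<pi>(f) = 0\<close>, the element f lies in
  \<open>(content f) P = (content f) J f B\<close>; so J is invertible, and \<open>B = \<Oplus>\<^sub>k J\<^sup>k A f\<^sup>k\<close> is the symmetric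
  algebra of JA over A. Conversely, \<open>T\<^sub>m \<mapsto> 0\<close> is a retraction of \<open>Sym(IA)\<close> to A and
  \<open>T\<^sub>m \<mapsto> T\<^sub>m + m U\<close> an exponential map; if \<open>0 \<noteq> s \<in> I\<close>, every element multiplied by a power
  of s is a polynomial in \<open>T\<^sub>s\<close> over A, so the invariants are A.\<close>

text \<open>Neither the fraction field of R nor unique factorization over it is set up for B.
  Working over the fraction field means divisibility up to a multiplicative set of nonzero scalars,
  and factoriality is replaced by complete integral closedness, which is all that the proof of
  Gauss's lemma uses. This closedness is needed twice: for R with the scalars {1}, where it comes
  from the Noetherian and normal hypotheses, and for B with the nonzero constants of R as scalars.
  The obstacle in the second case is that division needs a leading coefficient that is a scalar. The
  substitution \<open>X\<^sub>v \<mapsto> X\<^sub>v + T\<^sup>w\<close> known from Noether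
  normalization, with weights w that separate the monomials of a given element, makes this element
  monic in a new variable T up to a scalar. The retraction has two further uses: it moves an element
  of least positive degree into P, and it makes the remainders of division by x vanish on P.\<close>

lemma ring_hom_funD:
  assumes "ring_hom_fun f"
  shows "f (x + y) = f x + f y" "f (x * y) = f x * f y" "f 1 = 1" "f 0 = 0"
    "f (- x) = - f x" "f (x - y) = f x - f y" "f (x ^ n) = f x ^ n"
    "f (sum g S) = (\<Sum>i\<in>S. f (g i))" "f (prod g S) = (\<Prod>i\<in>S. f (g i))"
proof -
  have add: "f (x + y) = f x + f y" and mult: "f (x * y) = f x * f y" and one: "f 1 = 1" for x y
    using assms by (simp_all add: ring_hom_fun_def)
  have zero: "f 0 = 0" using add[of 0 0] by simp
  have uminus: "f (- x) = - f x" for x using add[of x "- x"] zero by (simp add: eq_neg_iff_add_eq_0 add.commute)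
  show "f (x + y) = f x + f y" "f (x * y) = f x * f y" "f 1 = 1" "f 0 = 0" "f (- x) = - f x"
    by (fact add mult one zero uminus)+
  show "f (x - y) = f x - f y" using add[of x "- y"] uminus by simp
  show "f (x ^ n) = f x ^ n" by (induction n) (simp_all add: one mult)
  show "f (sum g S) = (\<Sum>i\<in>S. f (g i))"
    by (induction S rule: infinite_finite_induct) (simp_all add: zero add)
  show "f (prod g S) = (\<Prod>i\<in>S. f (g i))"
    by (induction S rule: infinite_finite_induct) (simp_all add: one mult)
qed

lemma ring_hom_funI:
  assumes "\<And>x y. f (x + y) = f x + f y" "\<And>x y. f (x * y) = f x * f y" "f 1 = 1"
  shows "ring_hom_fun f"
  using assms by (simp add: ring_hom_fun_def)

lemma ring_hom_fun_id: "ring_hom_fun (\<lambda>x. x)"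
  by (rule ring_hom_funI) simp_all

lemma ring_hom_fun_comp:
  "ring_hom_fun f \<Longrightarrow> ring_hom_fun g \<Longrightarrow> ring_hom_fun (\<lambda>x. f (g x))"
  by (simp add: ring_hom_fun_def)

lemma ring_hom_fun_const_poly: "ring_hom_fun (\<lambda>x. [:x:])"
  by (rule ring_hom_funI) (simp_all add: one_pCons)

lemma ring_hom_fun_poly: "ring_hom_fun (\<lambda>p. poly p a)"
  by (rule ring_hom_funI) simp_all

lemma ring_hom_fun_pcompose: "ring_hom_fun (\<lambda>p. pcompose p q)"
  by (rule ring_hom_funI) (simp_all add: pcompose_add pcompose_mult pcompose_1)

section \<open>Homomorphisms acting on the coefficients of polynomials\<close>

lemma map_poly_hom_add:
  assumes "ring_hom_fun f"
  shows "map_poly f (p + q) = map_poly f p + map_poly f q"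
  by (rule poly_eqI) (simp add: coeff_map_poly ring_hom_funD[OF assms])

lemma map_poly_hom_pCons:
  assumes "ring_hom_fun f"
  shows "map_poly f (pCons a p) = pCons (f a) (map_poly f p)"
  by (rule poly_eqI) (simp add: coeff_map_poly coeff_pCons ring_hom_funD[OF assms] split: nat.split)

lemma map_poly_hom_smult:
  assumes "ring_hom_fun f"
  shows "map_poly f (smult a p) = smult (f a) (map_poly f p)"
  by (rule poly_eqI) (simp add: coeff_map_poly ring_hom_funD[OF assms])

lemma ring_hom_fun_map_poly:
  assumes "ring_hom_fun f"
  shows "ring_hom_fun (map_poly f)"
proof (rule ring_hom_funI)
  show "map_poly f (p * q) = map_poly f p * map_poly f q" for p q
    by (induction p) (simp_all add: map_poly_hom_add[OF assms] map_poly_hom_pCons[OF assms]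
        map_poly_hom_smult[OF assms] ring_hom_funD[OF assms])
qed (simp_all add: map_poly_hom_add[OF assms] ring_hom_funD[OF assms])

lemma map_poly_hom_pcompose:
  assumes "ring_hom_fun f"
  shows "map_poly f (pcompose p q) = pcompose (map_poly f p) (map_poly f q)"
proof (induction p)
  case (pCons a p)
  then show ?case
    by (simp add: pcompose_pCons map_poly_hom_pCons[OF assms]
        ring_hom_funD[OF ring_hom_fun_map_poly[OF assms]])
qed simp

lemma poly_map_poly_hom:
  assumes "ring_hom_fun f"
  shows "f (poly p a) = poly (map_poly f p) (f a)"
  by (induction p) (simp_all add: map_poly_hom_pCons[OF assms] ring_hom_funD[OF assms])

lemma pseudo_division:
  fixes f g :: "'a::comm_ring_1 poly"
  assumes "g \<noteq> 0"
  obtains k q r where "smult (lead_coeff g ^ k) f = g * q + r" "r = 0 \<or> degree r < degree g"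
proof -
  obtain q r where "pseudo_divmod f g = (q, r)" by fastforce
  from pseudo_divmod[OF assms this] show ?thesis using that by blast
qed

section \<open>Finite linear combinations\<close>

lemma fin_comb_0: "0 \<in> fin_comb P S"
  unfolding fin_comb_def by (intro CollectI exI[of _ "0::nat"]) simp

lemma fin_combE:
  assumes "x \<in> fin_comb P S"
  obtains m :: nat and p s where "x = (\<Sum>k<m. p k * s k)" "\<forall>k<m. p k \<in> P \<and> s k \<in> S"
  using assms unfolding fin_comb_def mem_Collect_eq by (elim exE conjE) (rule that)

lemma fin_comb_add:
  assumes "x \<in> fin_comb P S" "y \<in> fin_comb P S"
  shows "x + y \<in> fin_comb P S"
proof -
  obtain m :: nat and p s where x: "x = (\<Sum>k<m. p k * s k)" "\<forall>k<m. p k \<in> P \<and> s k \<in> S"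
    using assms(1) by (rule fin_combE)
  obtain n :: nat and q t where y: "y = (\<Sum>k<n. q k * t k)" "\<forall>k<n. q k \<in> P \<and> t k \<in> S"
    using assms(2) by (rule fin_combE)
  define p' s' where "p' = (\<lambda>k. if k < m then p k else q (k - m))"
    and "s' = (\<lambda>k. if k < m then s k else t (k - m))"
  have "(\<Sum>k<m + n. p' k * s' k) = (\<Sum>k<m. p' k * s' k) + (\<Sum>k<n. p' (m + k) * s' (m + k))"
    by (induction n) (simp_all add: add.assoc)
  also have "\<dots> = x + y" by (simp add: x y p'_def s'_def)
  finally have "x + y = (\<Sum>k<m + n. p' k * s' k)" ..
  moreover have "\<forall>k<m + n. p' k \<in> P \<and> s' k \<in> S" using x(2) y(2) by (auto simp: p'_def s'_def)
  ultimately show ?thesis unfolding fin_comb_def by blast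
qed

lemma fin_comb_mem: "p \<in> P \<Longrightarrow> s \<in> S \<Longrightarrow> p * s \<in> fin_comb P S"
  unfolding fin_comb_def
  by (intro CollectI exI[of _ "1::nat"] exI[of _ "\<lambda>_. p"] exI[of _ "\<lambda>_. s"]) simp

lemma fin_comb_sum:
  "(\<And>i. i \<in> F \<Longrightarrow> x i \<in> fin_comb P S) \<Longrightarrow> sum x F \<in> fin_comb P S"
  by (induction F rule: infinite_finite_induct) (auto intro: fin_comb_0 fin_comb_add)

lemma fin_comb_induct [consumes 1, case_names zero step]:
  assumes "x \<in> fin_comb P S" "Q 0"
    and step: "\<And>p s x. p \<in> P \<Longrightarrow> s \<in> S \<Longrightarrow> Q x \<Longrightarrow> Q (p * s + x)"
  shows "Q x"
proof -
  obtain m :: nat and p s where x: "x = (\<Sum>k<m. p k * s k)" "\<forall>k<m. p k \<in> P \<and> s k \<in> S"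
    using assms(1) by (rule fin_combE)
  have "Q (\<Sum>k<m. p k * s k)" if "\<forall>k<m. p k \<in> P \<and> s k \<in> S" for m
    using that by (induction m) (auto simp: assms(2) add.commute[of "sum _ _"] intro!: step)
  with x show ?thesis by simp
qed

lemma fin_comb_mult:
  assumes "x \<in> fin_comb P S" "\<And>p. p \<in> P \<Longrightarrow> r * p \<in> P"
  shows "r * x \<in> fin_comb P S"
  using assms(1)
  by (induction rule: fin_comb_induct)
    (auto simp: distrib_left mult.assoc[symmetric] intro!: fin_comb_0 fin_comb_add fin_comb_mem assms(2))

subsection \<open>Divisibility up to scalars and Gauss's lemma\<close>

text \<open>A multiplicative set of denominators. Three instances occur: {1}, the nonzero constants
  of a polynomial ring, and the constant polynomials \<open>[:k:]\<close> in \<open>B[T]\<close>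
  with k in a given such set.\<close>

definition scalar_set :: "'a::comm_ring_1 set \<Rightarrow> bool" where
  "scalar_set K \<longleftrightarrow> 1 \<in> K \<and> 0 \<notin> K \<and> (\<forall>x\<in>K. \<forall>y\<in>K. x * y \<in> K)"

text \<open>Divisibility in the localization at K, with the denominator cleared so that no
  localization has to be formed.\<close>

definition dvd_upto :: "'a::comm_ring_1 set \<Rightarrow> 'a \<Rightarrow> 'a \<Rightarrow> bool" where
  "dvd_upto K s x \<longleftrightarrow> (\<exists>k\<in>K. s dvd k * x)"

text \<open>Complete integral closedness of the localization at the scalars K, where \<open>x / s\<close>
  ranges over the fraction field.\<close>
definition compl_int_closed :: "'a::comm_ring_1 set \<Rightarrow> bool" where
  "compl_int_closed K \<longleftrightarrow>
     (\<forall>s x d. s \<noteq> 0 \<longrightarrow> d \<noteq> 0 \<longrightarrow> (\<forall>n. dvd_upto K (s ^ n) (d * x ^ n)) \<longrightarrow> dvd_upto K s x)"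

lemma dvd_uptoE:
  assumes "dvd_upto K s x"
  obtains k z where "k \<in> K" "k * x = s * z"
  using assms unfolding dvd_upto_def dvd_def by blast

lemma scalar_set_power: "scalar_set K \<Longrightarrow> x \<in> K \<Longrightarrow> x ^ n \<in> K"
  by (induction n) (auto simp: scalar_set_def)

lemma scalar_set_prod: "scalar_set K \<Longrightarrow> (\<And>i. i \<in> S \<Longrightarrow> g i \<in> K) \<Longrightarrow> prod g S \<in> K"
  by (induction S rule: infinite_finite_induct) (auto simp: scalar_set_def)

lemma dvd_upto_0: "scalar_set K \<Longrightarrow> dvd_upto K s 0"
  by (auto simp: dvd_upto_def scalar_set_def)

lemma dvd_imp_dvd_upto: "scalar_set K \<Longrightarrow> s dvd x \<Longrightarrow> dvd_upto K s x"
  by (auto simp: dvd_upto_def scalar_set_def intro!: bexI[of _ 1])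

lemma dvd_upto_mult:
  assumes "scalar_set K" "dvd_upto K s x" "dvd_upto K t y"
  shows "dvd_upto K (s * t) (x * y)"
proof -
  from assms obtain k l where "k \<in> K" "l \<in> K" "s dvd k * x" "t dvd l * y"
    by (auto simp: dvd_upto_def)
  then have "s * t dvd (k * l) * (x * y)"
    using mult_dvd_mono[of s "k * x" t "l * y"] by (simp add: mult_ac)
  with assms(1) \<open>k \<in> K\<close> \<open>l \<in> K\<close> show ?thesis by (auto simp: dvd_upto_def scalar_set_def)
qed

lemma dvd_upto_mult_right: "dvd_upto K s x \<Longrightarrow> dvd_upto K s (x * y)"
  unfolding dvd_upto_def by (metis dvd_mult2 mult.assoc)

lemma dvd_upto_diff:
  assumes "scalar_set K" "dvd_upto K s x" "dvd_upto K s y"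
  shows "dvd_upto K s (x - y)"
proof -
  from assms obtain k l where "k \<in> K" "l \<in> K" "s dvd k * x" "s dvd l * y"
    by (auto simp: dvd_upto_def)
  then have "s dvd l * (k * x) - k * (l * y)" using dvd_diff[OF dvd_mult dvd_mult] by simp
  then have "s dvd (k * l) * (x - y)" by (simp add: algebra_simps)
  with assms(1) \<open>k \<in> K\<close> \<open>l \<in> K\<close> show ?thesis by (auto simp: dvd_upto_def scalar_set_def)
qed

text \<open>The number of coefficients serves as induction measure instead of the degree: removing
  the leading term lowers it even for a nonzero constant, where the degree stays 0.\<close>

lemma length_coeffs_diff_lead:
  fixes p :: "'a::ring_1 poly"
  assumes "p \<noteq> 0"
  shows "length (coeffs (p - monom (lead_coeff p) (degree p))) < length (coeffs p)"
proof (cases "p - monom (lead_coeff p) (degree p) = 0")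
  case False
  let ?q = "p - monom (lead_coeff p) (degree p)"
  have "degree ?q \<le> degree p" by (intro degree_diff_le) (simp_all add: degree_monom_le)
  moreover have "coeff ?q (degree p) = 0" by simp
  ultimately have "degree ?q < degree p"
    using False by (metis eq_zero_or_degree_less)
  then show ?thesis using False assms by (simp add: length_coeffs_degree)
qed (simp add: assms length_coeffs_degree)

lemma length_coeffs_smult_le: "length (coeffs (smult (a::'a::comm_ring_1) p)) \<le> length (coeffs p)"
proof (cases "smult a p = 0")
  case False
  then have "p \<noteq> 0" by auto
  with False show ?thesis by (simp add: length_coeffs_degree degree_smult_le)
qed simp

text \<open>Induction on the number of coefficients: once the
  product \<open>ab\<close> of the leading coefficients is divisible by \<open>s\<close>, each \<open>x = a b'\<close> with \<open>b'\<close> another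
  coefficient of \<open>g\<close> satisfies \<open>s\<^sup>n | x\<^sup>n f\<close> for all \<open>n\<close>.\<close>
lemma gauss_content:
  fixes f g :: "'a::idom poly"
  assumes K: "scalar_set K" and cic: "compl_int_closed K"
    and "s \<noteq> 0" "\<And>k. dvd_upto K s (coeff (f * g) k)"
  shows "dvd_upto K s (coeff f i * coeff g j)"
  using assms(3,4)
proof (induction "length (coeffs f) + length (coeffs g)" arbitrary: f g s i j rule: less_induct)
  case less
  show ?case
  proof (cases "f = 0 \<or> g = 0")
    case True
    then show ?thesis by (auto intro: dvd_upto_0[OF K])
  next
    case False
    then have f: "f \<noteq> 0" and g: "g \<noteq> 0" by auto
    define a b where "a = lead_coeff f" and "b = lead_coeff g"
    define f' g' where "f' = f - monom a (degree f)" and "g' = g - monom b (degree g)"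
    have len: "length (coeffs f') < length (coeffs f)" "length (coeffs g') < length (coeffs g)"
      using length_coeffs_diff_lead f g by (simp_all add: f'_def g'_def a_def b_def)
    have a0: "a \<noteq> 0" using f by (simp add: a_def)
    have ab: "dvd_upto K s (a * b)"
      using less.prems(2)[of "degree f + degree g"]
      by (simp add: coeff_mult_degree_sum a_def b_def)
    have ag': "dvd_upto K s (a * coeff g' j)" for j
    proof -
      let ?x = "a * coeff g' j"
      have "dvd_upto K (s ^ n) (?x ^ n * coeff f i)" for n i
      proof (induction n arbitrary: i)
        case 0
        show ?case by (rule dvd_imp_dvd_upto[OF K]) simp
      next
        case (Suc n)
        have xa: "dvd_upto K (s ^ n) (?x ^ n * a)" using Suc.IH[of "degree f"] by (simp add: a_def)
        \<comment> \<open>Since \<open>g' = g - b T\<^sup>e\<close> with e the degree of g, the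
          product is \<open>x\<^sup>n a\<close> times \<open>f g\<close> minus \<open>a b\<close>
          times \<open>x\<^sup>n f T\<^sup>e\<close>. One factor s comes from \<open>f g\<close> or
          from \<open>a b\<close>, the factors \<open>s\<^sup>n\<close> from the inner induction.
          The outer induction, which leaves s arbitrary, is then used for
          \<open>s ^ Suc n\<close>.\<close>
        have "dvd_upto K (s ^ Suc n) (coeff (f * smult (?x ^ n * a) g') k)" for k
        proof -
          have "f * smult (?x ^ n * a) g' = smult (?x ^ n * a) (f * g)
              - smult (a * b * ?x ^ n) (f * monom 1 (degree g))"
            by (simp add: g'_def algebra_simps smult_diff_right smult_monom flip: mult_smult_right)
          moreover have "dvd_upto K (s ^ Suc n) (coeff (smult (?x ^ n * a) (f * g)) k)"
            using dvd_upto_mult[OF K xa less.prems(2)[of k]] by (simp add: mult_ac)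
          moreover have "dvd_upto K (s ^ Suc n) (coeff (smult (a * b * ?x ^ n) (f * monom 1 (degree g))) k)"
            using dvd_upto_mult[OF K ab Suc.IH[of "k - degree g"]]
            by (auto simp: mult.assoc mult.commute[of f] coeff_monom_mult
                intro: dvd_upto_0[OF K])
          ultimately show ?thesis by (simp add: dvd_upto_diff[OF K])
        qed
        from less.hyps[OF _ _ this, of i j] len length_coeffs_smult_le[of "?x ^ n * a" g'] less.prems(1)
        show ?case by (simp add: mult_ac)
      qed
      \<comment> \<open>The leading coefficient a of f serves as the common denominator d in
        \<open>compl_int_closed\<close>.\<close>
      from this[of _ "degree f"] have "dvd_upto K (s ^ n) (a * ?x ^ n)" for n
        by (simp add: a_def mult.commute)
      with cic less.prems(1) a0 show ?thesis unfolding compl_int_closed_def by blast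
    qed
    have ag: "dvd_upto K s (a * coeff g j)" for j
      using ag'[of j] ab by (cases "j = degree g") (simp_all add: g'_def b_def)
    have "dvd_upto K s (coeff (f' * g) k)" for k
    proof -
      have "f' = f - smult a (monom 1 (degree f))" by (simp add: f'_def smult_monom)
      then have "f' * g = f * g - smult a (monom 1 (degree f) * g)"
        by (simp add: left_diff_distrib)
      moreover have "dvd_upto K s (coeff (smult a (monom 1 (degree f) * g)) k)"
        using ag by (auto simp: coeff_monom_mult intro: dvd_upto_0[OF K])
      ultimately show ?thesis by (simp add: dvd_upto_diff[OF K less.prems(2)])
    qed
    from less.hyps[OF _ less.prems(1) this] len
    have f'g: "dvd_upto K s (coeff f' i * coeff g j)" by simp
    show ?thesis using f'g ag[of j] by (cases "i = degree f") (simp_all add: f'_def a_def)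
  qed
qed

subsection \<open>Noetherian normal domains are completely integrally closed\<close>

text \<open>The ideals generated by the first N terms form an ascending chain with finitely
  generated union; one of them contains all the generators, and hence also the next term of the
  sequence.\<close>

lemma noetherian_seq:
  fixes e :: "nat \<Rightarrow> 'a::comm_ring_1"
  assumes "noetherian_ring TYPE('a)"
  obtains N r where "e N = (\<Sum>i<N. r i * e i)"
proof -
  define S where "S N = {\<Sum>i<N. r i * e i | r. True}" for N
  have mono: "S M \<subseteq> S N" if "M \<le> N" for M N
  proof
    fix x assume "x \<in> S M"
    then obtain r where "x = (\<Sum>i<M. r i * e i)" by (auto simp: S_def)
    also have "\<dots> = (\<Sum>i<N. (if i < M then r i else 0) * e i)"
      using that by (intro sum.mono_neutral_cong_left) auto
    finally show "x \<in> S N" by (auto simp: S_def)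
  qed
  have add: "x + y \<in> S N" if "x \<in> S N" "y \<in> S N" for x y N
  proof -
    from that obtain r r' where "x = (\<Sum>i<N. r i * e i)" "y = (\<Sum>i<N. r' i * e i)"
      by (auto simp: S_def)
    then have "x + y = (\<Sum>i<N. (r i + r' i) * e i)" by (simp add: algebra_simps sum.distrib)
    then show ?thesis unfolding S_def by (auto intro: exI[of _ "\<lambda>i. r i + r' i"])
  qed
  have mult: "c * x \<in> S N" if "x \<in> S N" for c x N
  proof -
    from that obtain r where "x = (\<Sum>i<N. r i * e i)" by (auto simp: S_def)
    then have "c * x = (\<Sum>i<N. (c * r i) * e i)" by (simp add: sum_distrib_left mult.assoc)
    then show ?thesis unfolding S_def by (auto intro: exI[of _ "\<lambda>i. c * r i"])
  qed
  have zero: "0 \<in> S N" for N unfolding S_def by (auto intro!: exI[of _ "\<lambda>_. 0"])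
  have "is_ideal (\<Union>N. S N)"
    unfolding is_ideal_def
  proof (intro conjI ballI allI impI)
    fix x y assume "x \<in> (\<Union>N. S N)" "y \<in> (\<Union>N. S N)"
    then obtain M N where "x \<in> S M" "y \<in> S N" by auto
    then have "x + y \<in> S (max M N)" using mono[of M "max M N"] mono[of N "max M N"] by (intro add) auto
    then show "x + y \<in> (\<Union>N. S N)" by auto
  next
    show "0 \<in> (\<Union>N. S N)" using zero by blast
  next
    fix r x assume "x \<in> (\<Union>N. S N)"
    then obtain N where "x \<in> S N" by blast
    then show "r * x \<in> (\<Union>N. S N)" using mult by blast
  qed
  then obtain F where F: "finite F" "(\<Union>N. S N) = fin_comb UNIV F"
    using assms by (auto simp: noetherian_ring_def)
  have "F \<subseteq> fin_comb UNIV F"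
  proof
    fix x assume "x \<in> F"
    then show "x \<in> fin_comb UNIV F" using fin_comb_mem[of 1 UNIV x F] by simp
  qed
  then have "\<forall>x\<in>F. \<exists>N. x \<in> S N" using F(2) by auto
  then obtain n where n: "\<And>x. x \<in> F \<Longrightarrow> x \<in> S (n x)" by metis
  \<comment> \<open>The inserted 0 covers an empty set of generators.\<close>
  define N where "N = Max (insert 0 (n ` F))"
  have FN: "x \<in> S N" if "x \<in> F" for x
  proof -
    have "n x \<le> N" unfolding N_def using that F(1) by (intro Max_ge) auto
    then show ?thesis using n[OF that] mono by auto
  qed
  have "fin_comb UNIV F \<subseteq> S N"
  proof
    fix x assume "x \<in> fin_comb UNIV F"
    then show "x \<in> S N" by (induction rule: fin_comb_induct) (simp_all add: zero add mult FN)
  qed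
  moreover have "e N \<in> S (Suc N)"
  proof -
    have "e N = (\<Sum>i<Suc N. (if i = N then 1 else 0) * e i)" by simp
    then show ?thesis unfolding S_def by (intro CollectI exI[of _ "\<lambda>i. if i = N then 1 else 0"]) simp
  qed
  ultimately have "e N \<in> S N" using F(2) by auto
  then show ?thesis using that by (auto simp: S_def)
qed

lemma ring_hom_fun_Fract: "ring_hom_fun (\<lambda>r. Fract r 1)"
  by (rule ring_hom_funI) (simp_all add: One_fract_def)

text \<open>If \<open>d x\<^sup>n = s\<^sup>n e\<^sub>n\<close> for all n, a relation expressing
  \<open>e\<^sub>N\<close> by its predecessors becomes, divided by d, a monic equation of degree N
  for the fraction \<open>x / s\<close>.\<close>

lemma noetherian_normal_compl_int_closed:
  assumes noeth: "noetherian_ring TYPE('a::idom)" and normal: "normal_domain TYPE('a)"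
  shows "compl_int_closed {1::'a}"
  unfolding compl_int_closed_def dvd_upto_def
proof (intro allI impI)
  fix s x d :: 'a
  assume s: "s \<noteq> 0" and d: "d \<noteq> 0" and "\<forall>n. \<exists>k\<in>{1}. s ^ n dvd k * (d * x ^ n)"
  then have "\<forall>n. \<exists>e. d * x ^ n = s ^ n * e" by (simp add: dvd_def)
  then obtain e where e: "\<And>n. d * x ^ n = s ^ n * e n" by metis
  from noetherian_seq[OF noeth, of e] obtain N r where N: "e N = (\<Sum>i<N. r i * e i)" by blast
  let ?h = "\<lambda>r. Fract r (1::'a)"
  note h = ring_hom_funD[OF ring_hom_fun_Fract]
  let ?u = "Fract x s"
  have u: "?h s * ?u = ?h x" using s by (simp add: eq_fract mult.commute)
  have e': "?h (e n) = ?h d * ?u ^ n" for n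
  proof -
    have s0: "?h s \<noteq> 0" using s by (simp add: Zero_fract_def eq_fract)
    have "?h s ^ n * ?h (e n) = ?h d * (?h s * ?u) ^ n"
      unfolding u h(7)[symmetric] h(2)[symmetric] e ..
    moreover have "?h d * (?h s * ?u) ^ n = ?h s ^ n * (?h d * ?u ^ n)"
      by (simp only: power_mult_distrib mult.left_commute)
    ultimately have "?h s ^ n * ?h (e n) = ?h s ^ n * (?h d * ?u ^ n)" by (rule trans)
    then show ?thesis using mult_left_cancel[OF power_not_zero[OF s0, of n]] by iprover
  qed
  have "?h d * ?u ^ N = (\<Sum>i<N. ?h (r i) * (?h d * ?u ^ i))"
    using arg_cong[OF N, of ?h] by (simp only: e' h)
  also have "\<dots> = ?h d * (\<Sum>i<N. ?h (r i) * ?u ^ i)"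
    by (simp only: sum_distrib_left mult.left_commute)
  finally have eq: "?u ^ N = (\<Sum>i<N. ?h (r i) * ?u ^ i)"
    using d by (simp add: Zero_fract_def eq_fract)
  define p where "p = monom 1 N - (\<Sum>i<N. monom (r i) i)"
  have coeff_sum: "coeff (\<Sum>i<N. monom (r i) i) k = (if k < N then r k else 0)" for k
    by (simp add: coeff_sum)
  have "degree p = N"
  proof (rule antisym)
    show "degree p \<le> N" by (rule degree_le) (auto simp: p_def coeff_sum)
    show "N \<le> degree p" by (rule le_degree) (simp add: p_def coeff_sum)
  qed
  then have "lead_coeff p = 1" by (simp add: p_def coeff_sum)
  moreover have "poly (map_poly ?h p) ?u = 0"
  proof -
    have "map_poly ?h p = monom 1 N - (\<Sum>i<N. monom (?h (r i)) i)"
      by (simp add: p_def ring_hom_funD[OF ring_hom_fun_map_poly[OF ring_hom_fun_Fract]]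
          map_poly_monom h del: One_fract_def)
    then show ?thesis using eq by (simp add: poly_sum poly_monom)
  qed
  ultimately obtain t where "?u = ?h t" using normal by (auto simp: normal_domain_def)
  then have "x = s * t" using s by (simp add: eq_fract mult.commute)
  then show "\<exists>k\<in>{1}. s dvd k * x" by simp
qed

subsection \<open>Height-one primes\<close>

text \<open>The extension of \<open>\<sigma> : B \<rightarrow> B[T]\<close> to \<open>B[T]\<close> fixing T is
  \<open>\<lambda>p. poly (map_poly \<sigma> p) [:0, 1:]\<close>; a shift pair consists of automorphisms of \<open>B[T]\<close> over
  \<open>K[T]\<close> that are inverse to each other, the model being \<open>X\<^sub>v \<mapsto> X\<^sub>v \<plusminus> T\<^sup>w\<close>.\<close>
definition shift_pair :: "'b::comm_ring_1 set \<Rightarrow> ('b \<Rightarrow> 'b poly) \<Rightarrow> ('b \<Rightarrow> 'b poly) \<Rightarrow> bool" where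
  "shift_pair K \<sigma> \<tau> \<longleftrightarrow> ring_hom_fun \<sigma> \<and> ring_hom_fun \<tau>
     \<and> (\<forall>b. poly (\<sigma> b) 0 = b) \<and> (\<forall>k\<in>K. \<sigma> k = [:k:])
     \<and> (\<forall>b. poly (map_poly \<tau> (\<sigma> b)) [:0, 1:] = [:b:])
     \<and> (\<forall>b. poly (map_poly \<sigma> (\<tau> b)) [:0, 1:] = [:b:])"

text \<open>The shift may depend on x. Pseudo-division by \<open>\<sigma> x\<close> then costs only
  a factor in K.\<close>

definition has_shifts :: "'b::comm_ring_1 set \<Rightarrow> bool" where
  "has_shifts K \<longleftrightarrow> (\<forall>x. x \<noteq> 0 \<longrightarrow> (\<exists>\<sigma> \<tau>. shift_pair K \<sigma> \<tau> \<and> lead_coeff (\<sigma> x) \<in> K))"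

lemma shift_extension_inverse:
  assumes "ring_hom_fun \<sigma>" "ring_hom_fun \<tau>" "\<And>b. poly (map_poly \<sigma> (\<tau> b)) [:0, 1:] = [:b:]"
  shows "poly (map_poly \<sigma> (poly (map_poly \<tau> p) [:0, 1:])) [:0, 1:] = p"
proof (induction p)
  case (pCons a p)
  have 1: "map_poly \<sigma> [:0, 1:] = [:0, 1:]"
    by (simp add: map_poly_hom_pCons[OF assms(1)] ring_hom_funD[OF assms(1)])
  show ?case
    using pCons.IH
    by (simp add: map_poly_hom_pCons[OF assms(2)] ring_hom_funD[OF ring_hom_fun_map_poly[OF assms(1)]]
        map_poly_hom_pCons[OF assms(1)] ring_hom_funD(4)[OF assms(1)] assms(3) 1)
qed simp

lemma dvd_smult_small:
  fixes g r :: "'b::idom poly"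
  assumes "g dvd smult a r" "a \<noteq> 0" "r = 0 \<or> degree r < degree g"
  shows "r = 0"
proof (rule ccontr)
  assume "r \<noteq> 0"
  then have "smult a r \<noteq> 0" using assms(2) by simp
  from dvd_imp_degree_le[OF assms(1) this] assms \<open>r \<noteq> 0\<close> show False by simp
qed

text \<open>Divide \<open>\<sigma> x\<close>, up to a scalar, by \<open>\<sigma> s\<close>, whose
  leading coefficient is a scalar. If the remainder r is nonzero, \<open>\<sigma> s ^ m\<close>
  divides a scalar multiple of \<open>\<sigma> d * r ^ m\<close> for every m, and comparing degrees
  in T bounds m by the degree of \<open>\<sigma> d\<close>. So r = 0, and T = 0 gives the
  claim.\<close>

lemma has_shifts_compl_int_closed:
  fixes K :: "'b::idom set"
  assumes K: "scalar_set K" and shifts: "has_shifts K"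
  shows "compl_int_closed K"
  unfolding compl_int_closed_def
proof (intro allI impI)
  fix s x d :: 'b
  assume s: "s \<noteq> 0" and d: "d \<noteq> 0" and sn: "\<forall>n. dvd_upto K (s ^ n) (d * x ^ n)"
  from shifts s obtain \<sigma> \<tau> where \<sigma>\<tau>: "shift_pair K \<sigma> \<tau>" and lc: "lead_coeff (\<sigma> s) \<in> K"
    unfolding has_shifts_def by blast
  have hom: "ring_hom_fun \<sigma>" and ev0: "\<And>b. poly (\<sigma> b) 0 = b" and \<sigma>K: "\<And>k. k \<in> K \<Longrightarrow> \<sigma> k = [:k:]"
    using \<sigma>\<tau> by (auto simp: shift_pair_def)
  note h = ring_hom_funD[OF hom]
  have \<sigma>0: "\<sigma> b \<noteq> 0" if "b \<noteq> 0" for b using ev0[of b] that by auto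
  obtain k q r where qr: "smult (lead_coeff (\<sigma> s) ^ k) (\<sigma> x) = \<sigma> s * q + r"
    "r = 0 \<or> degree r < degree (\<sigma> s)"
    using pseudo_division[OF \<sigma>0[OF s]] by blast
  define l where "l = lead_coeff (\<sigma> s) ^ k"
  have l: "l \<in> K" unfolding l_def by (rule scalar_set_power[OF K lc])
  let ?L = "(\<lambda>a. [:a:]) ` K"
  have L: "scalar_set ?L" using K by (auto simp: scalar_set_def one_pCons)
  have "r = 0"
  proof (rule ccontr)
    assume r0: "r \<noteq> 0"
    define A where "A = smult l (\<sigma> x)"
    have r: "r = A - \<sigma> s * q" using qr(1) by (simp add: A_def l_def)
    \<comment> \<open>Carrying powers of A along with those of r lets the induction on m run: a new
      factor r is \<open>A - \<sigma> s * q\<close>, and the missing factor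
      \<open>\<sigma> s\<close> comes from the case \<open>Suc n\<close> for the first term and
      stands in the second.\<close>
    have main: "dvd_upto ?L (\<sigma> s ^ (n + m)) (\<sigma> d * A ^ n * r ^ m)" for n m
    proof (induction m arbitrary: n)
      case 0
      from sn obtain k where k: "k \<in> K" "s ^ n dvd k * (d * x ^ n)" by (auto simp: dvd_upto_def)
      then obtain y where "k * (d * x ^ n) = s ^ n * y" by (auto simp: dvd_def)
      then have "[:k:] * (\<sigma> d * \<sigma> x ^ n) = \<sigma> s ^ n * \<sigma> y" using k(1) by (metis \<sigma>K h(2) h(7))
      then have "\<sigma> s ^ n dvd [:k:] * (\<sigma> d * \<sigma> x ^ n)" by simp
      with k(1) have "dvd_upto ?L (\<sigma> s ^ n) (\<sigma> d * \<sigma> x ^ n)" by (auto simp: dvd_upto_def)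
      from dvd_upto_mult_right[OF this, of "[:l ^ n:]"]
      show ?case by (simp add: A_def smult_power mult.commute)
    next
      case (Suc m)
      have "dvd_upto ?L (\<sigma> s ^ (n + m) * \<sigma> s) (\<sigma> d * A ^ n * r ^ m * (\<sigma> s * q))"
        by (rule dvd_upto_mult[OF L Suc.IH dvd_imp_dvd_upto[OF L]]) simp
      moreover have "dvd_upto ?L (\<sigma> s ^ (n + m) * \<sigma> s) (\<sigma> d * A ^ Suc n * r ^ m)"
        using Suc.IH[of "Suc n"] by (simp add: mult.commute)
      ultimately have "dvd_upto ?L (\<sigma> s ^ (n + m) * \<sigma> s)
          (\<sigma> d * A ^ Suc n * r ^ m - \<sigma> d * A ^ n * r ^ m * (\<sigma> s * q))"
        by (intro dvd_upto_diff[OF L])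
      also have "\<sigma> d * A ^ Suc n * r ^ m - \<sigma> d * A ^ n * r ^ m * (\<sigma> s * q)
          = \<sigma> d * A ^ n * r ^ m * (A - \<sigma> s * q)"
        by (simp add: algebra_simps)
      also have "\<dots> = \<sigma> d * A ^ n * r ^ Suc m" unfolding r[symmetric] by (simp add: mult_ac)
      finally show ?case by (simp add: mult.commute)
    qed
    define m where "m = Suc (degree (\<sigma> d))"
    from main[of 0 m] obtain k where k: "k \<in> K" "\<sigma> s ^ m dvd [:k:] * (\<sigma> d * r ^ m)"
      by (auto simp: dvd_upto_def)
    have "k \<noteq> 0" using k(1) K by (auto simp: scalar_set_def)
    have "degree (\<sigma> s ^ m) \<le> degree ([:k:] * (\<sigma> d * r ^ m))"
      using k(2) \<open>k \<noteq> 0\<close> r0 \<sigma>0[OF d] by (intro dvd_imp_degree_le) auto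
    also have "\<dots> = degree (\<sigma> d) + m * degree r"
      using \<open>k \<noteq> 0\<close> r0 \<sigma>0[OF d] by (simp add: degree_mult_eq degree_power_eq)
    finally have "m * degree (\<sigma> s) \<le> degree (\<sigma> d) + m * degree r"
      using \<sigma>0[OF s] by (simp add: degree_power_eq)
    moreover have "m * Suc (degree r) \<le> m * degree (\<sigma> s)" using qr(2) r0 by (intro mult_le_mono) auto
    ultimately show False by (simp add: m_def)
  qed
  then have "l * x = s * poly q 0" using arg_cong[OF qr(1), of "\<lambda>p. poly p 0"] ev0 by (simp add: l_def)
  then have "s dvd l * x" by simp
  then show "dvd_upto K s x" using l by (auto simp: dvd_upto_def)
qed

text \<open>The hypotheses on x and c say that P is the contraction of \<open>x B[1/c]\<close>, a proper ideal even
  after inverting K. Take h of minimal degree in T in the ideal of \<open>B[T]\<close> generated by \<open>\<sigma>(P)\<close>. As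
  \<open>\<sigma>(x)\<close> is monic up to K, Gauss's lemma makes h a multiple of some D monic up to K that divides
  \<open>\<sigma>(P)\<close> up to K; applying the inverse of \<open>\<sigma>\<close> shows \<open>D = \<sigma>(e)\<close>, and e generates P up to K.\<close>
lemma prime_generator_upto:
  fixes K P :: "'b::idom set"
  assumes K: "scalar_set K" and shifts: "has_shifts K"
    and P: "is_ideal P" and prime: "\<And>a b. a * b \<in> P \<Longrightarrow> a \<in> P \<or> b \<in> P"
    and x: "x \<in> P" "x \<noteq> 0" and c: "c \<noteq> 0"
    and height: "\<And>p. p \<in> P \<Longrightarrow> \<exists>k. x dvd c ^ k * p"
    and proper: "\<And>k. \<not> dvd_upto K x (c ^ k)"
  shows "\<exists>f\<in>P. f \<noteq> 0 \<and> (\<forall>p\<in>P. dvd_upto K f p)"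
proof -
  have cic: "compl_int_closed K" by (rule has_shifts_compl_int_closed[OF K shifts])
  have K0: "k \<noteq> 0" if "k \<in> K" for k using K that by (auto simp: scalar_set_def)
  from shifts x(2) obtain \<sigma> \<tau> where \<sigma>\<tau>: "shift_pair K \<sigma> \<tau>" and u: "lead_coeff (\<sigma> x) \<in> K"
    unfolding has_shifts_def by blast
  have hom: "ring_hom_fun \<sigma>" and hom': "ring_hom_fun \<tau>" and ev0: "\<And>b. poly (\<sigma> b) 0 = b"
    and \<sigma>K: "\<And>k. k \<in> K \<Longrightarrow> \<sigma> k = [:k:]"
    and \<tau>\<sigma>: "\<And>b. poly (map_poly \<tau> (\<sigma> b)) [:0, 1:] = [:b:]"
    and \<sigma>\<tau>: "\<And>b. poly (map_poly \<sigma> (\<tau> b)) [:0, 1:] = [:b:]"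
    using \<sigma>\<tau> by (auto simp: shift_pair_def)
  note h = ring_hom_funD[OF hom]
  have \<sigma>0: "\<sigma> b \<noteq> 0" if "b \<noteq> 0" for b using ev0[of b] that by auto
  define H where "H = fin_comb UNIV (\<sigma> ` P)"
  have H_mult: "r * g \<in> H" if "g \<in> H" for r g
    using that unfolding H_def by (rule fin_comb_mult) simp
  have H_add: "g + g' \<in> H" if "g \<in> H" "g' \<in> H" for g g'
    using that unfolding H_def by (rule fin_comb_add)
  have H_diff: "g - g' \<in> H" if "g \<in> H" "g' \<in> H" for g g'
    using H_add[OF that(1) H_mult[OF that(2), of "- 1"]] by simp
  have H_\<sigma>: "\<sigma> p \<in> H" if "p \<in> P" for p
    unfolding H_def using fin_comb_mem[of 1 UNIV "\<sigma> p"] that by simp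
  have cH: "\<exists>k. \<sigma> x dvd \<sigma> c ^ k * g" if "g \<in> H" for g
    using that unfolding H_def
  proof (induction rule: fin_comb_induct)
    case zero
    then show ?case by simp
  next
    case (step a y g)
    then obtain k p where k: "\<sigma> x dvd \<sigma> c ^ k * g" and p: "p \<in> P" "y = \<sigma> p" by auto
    from height[OF p(1)] obtain l z where "c ^ l * p = x * z" by (auto simp: dvd_def)
    then have "\<sigma> c ^ l * y = \<sigma> x * \<sigma> z" using p by (metis h(2) h(7))
    then have "\<sigma> x dvd \<sigma> c ^ l * y" by simp
    then have "\<sigma> x dvd (\<sigma> c ^ k * a) * (\<sigma> c ^ l * y) + \<sigma> c ^ l * (\<sigma> c ^ k * g)"
      by (rule dvd_add[OF dvd_mult dvd_mult[OF k]])
    then have "\<sigma> x dvd \<sigma> c ^ (k + l) * (a * y + g)" by (simp add: algebra_simps power_add)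
    then show ?case by blast
  qed
  obtain g where g: "g \<in> H" "g \<noteq> 0" and g_min: "\<And>g'. g' \<in> H \<Longrightarrow> g' \<noteq> 0 \<Longrightarrow> degree g \<le> degree g'"
    using ex_has_least_nat[of "\<lambda>g. g \<in> H \<and> g \<noteq> 0" "\<sigma> x" degree] H_\<sigma>[OF x(1)] \<sigma>0[OF x(2)] by blast
  define l where "l = lead_coeff g"
  have l0: "l \<noteq> 0" using g by (simp add: l_def)
  have g_div: "\<exists>k q. smult (l ^ k) y = g * q" if y: "y \<in> H" for y
  proof -
    obtain k q r where qr: "smult (l ^ k) y = g * q + r" "r = 0 \<or> degree r < degree g"
      using pseudo_division[OF g(2)] unfolding l_def by blast
    have "r = [:l ^ k:] * y - q * g" using qr(1) by (simp add: mult.commute)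
    then have "r \<in> H" using H_diff[OF H_mult[OF y] H_mult[OF g(1)]] by blast
    with qr(2) g_min have "r = 0" by (meson leD)
    with qr(1) show ?thesis by auto
  qed
  \<comment> \<open>A nonzero constant s in H would satisfy
    \<open>\<sigma> x dvd \<sigma> c ^ k * [:s:]\<close>. The remainder of
    \<open>\<sigma> (c ^ k)\<close> modulo \<open>\<sigma> x\<close> then vanishes, since s times it
    is divisible by \<open>\<sigma> x\<close> and too small; at T = 0 this says that x divides
    \<open>c ^ k\<close> up to K.\<close>
  have deg_g: "degree g \<noteq> 0"
  proof
    assume "degree g = 0"
    then obtain s where s: "g = [:s:]" by (rule degree_eq_zeroE)
    with g have s0: "s \<noteq> 0" by auto
    from cH[OF g(1)] obtain k z where k: "\<sigma> c ^ k * [:s:] = \<sigma> x * z" by (auto simp: s dvd_def)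
    obtain j q r where qr: "smult (lead_coeff (\<sigma> x) ^ j) (\<sigma> (c ^ k)) = \<sigma> x * q + r"
      "r = 0 \<or> degree r < degree (\<sigma> x)"
      using pseudo_division[OF \<sigma>0[OF x(2)]] by blast
    have "smult s r = [:lead_coeff (\<sigma> x) ^ j:] * (\<sigma> c ^ k * [:s:]) - \<sigma> x * smult s q"
      using arg_cong[OF qr(1), of "smult s"] by (simp add: h smult_add_right mult.commute)
    also have "\<dots> = \<sigma> x * ([:lead_coeff (\<sigma> x) ^ j:] * z - smult s q)"
      unfolding k by (simp add: algebra_simps)
    finally have "\<sigma> x dvd smult s r" by simp
    then have "r = 0" using s0 qr(2) by (rule dvd_smult_small)
    then have "lead_coeff (\<sigma> x) ^ j * c ^ k = x * poly q 0"
      using arg_cong[OF qr(1), of "\<lambda>p. poly p 0"] by (simp add: ev0)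
    then have "x dvd lead_coeff (\<sigma> x) ^ j * c ^ k" by simp
    then have "dvd_upto K x (c ^ k)" using scalar_set_power[OF K u, of j] by (auto simp: dvd_upto_def)
    with proper show False by blast
  qed
  from g_div[OF H_\<sigma>[OF x(1)]] obtain k q where "smult (l ^ k) (\<sigma> x) = g * q" by blast
  then have q: "g * smult l q = smult (l ^ Suc k) (\<sigma> x)"
    by (metis mult_smult_right power_Suc smult_smult)
  have "lead_coeff (smult l q) * l = lead_coeff (g * smult l q)"
    by (simp only: lead_coeff_mult l_def mult.commute)
  also have "\<dots> = l ^ Suc k * lead_coeff (\<sigma> x)" by (simp only: q lead_coeff_smult)
  finally have lead_q: "lead_coeff (smult l q) * l = l ^ Suc k * lead_coeff (\<sigma> x)" .
  \<comment> \<open>Gauss's lemma, applied to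
    \<open>g * smult l q = smult (l ^ Suc k) (\<sigma> x)\<close>, is used only with the leading
    coefficient of the second factor. That coefficient times l is \<open>l ^ Suc k\<close> times a
    scalar, and cancelling leaves l dividing a scalar multiple of \<open>coeff g i\<close>.\<close>
  have "dvd_upto K l (coeff g i)" for i
  proof -
    have "dvd_upto K (l ^ Suc k) (coeff (g * smult l q) n)" for n
      unfolding q by (rule dvd_imp_dvd_upto[OF K]) simp
    from gauss_content[OF K cic _ this, of i "degree (smult l q)"] l0
    obtain t where t: "t \<in> K" "l ^ Suc k dvd t * (coeff g i * lead_coeff (smult l q))"
      by (auto simp: dvd_upto_def)
    then have "l ^ Suc k * l dvd t * (coeff g i * lead_coeff (smult l q)) * l" by (intro mult_dvd_mono) auto
    also have "\<dots> = t * (coeff g i * (l ^ Suc k * lead_coeff (\<sigma> x)))"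
      using lead_q by (simp only: mult.assoc)
    also have "\<dots> = l ^ Suc k * (t * lead_coeff (\<sigma> x) * coeff g i)" by (simp add: mult_ac)
    finally have "l dvd t * lead_coeff (\<sigma> x) * coeff g i" using l0 by (simp add: dvd_mult_cancel_left)
    moreover have "t * lead_coeff (\<sigma> x) \<in> K" using K t(1) u by (auto simp: scalar_set_def)
    ultimately show ?thesis by (auto simp: dvd_upto_def)
  qed
  then obtain t where t: "\<And>i. t i \<in> K" "\<And>i. l dvd t i * coeff g i" unfolding dvd_upto_def by metis
  \<comment> \<open>One scalar m serves all coefficients, so \<open>D = (m / l) g\<close> has
    coefficients in B and leading coefficient m.\<close>
  define m where "m = (\<Prod>i\<le>degree g. t i)"
  have m: "m \<in> K" unfolding m_def by (rule scalar_set_prod[OF K t(1)])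
  have "l dvd m * coeff g i" for i
  proof (cases "i \<le> degree g")
    case True
    then have "t i dvd m" unfolding m_def by (intro dvd_prodI) auto
    then have "t i * coeff g i dvd m * coeff g i" by (rule mult_dvd_mono) simp
    with t(2)[of i] show ?thesis by (rule dvd_trans)
  qed (simp add: coeff_eq_0)
  then have "[:l:] dvd smult m g" by (simp add: const_poly_dvd_iff)
  then obtain D where D: "smult m g = smult l D" by (auto simp: dvd_def)
  have degD: "degree D = degree g" using arg_cong[OF D, of degree] l0 K0[OF m] by simp
  have "m * lead_coeff g = l * lead_coeff D" using arg_cong[OF D, of lead_coeff] by (simp only: lead_coeff_smult)
  then have leadD: "lead_coeff D = m" using l0 by (simp add: l_def mult.commute)
  then have D0: "D \<noteq> 0" using K0[OF m] by auto
  \<comment> \<open>The leading coefficient m of D is in K, so division by D costs a scalar only. A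
    nonzero constant multiple of the remainder is a multiple of D, because g divides
    \<open>\<sigma> p\<close> up to a power of l and agrees with D up to constants.\<close>
  have D_dvd: "\<exists>k\<in>K. D dvd smult k (\<sigma> p)" if p: "p \<in> P" for p
  proof -
    obtain j q r where qr: "smult (m ^ j) (\<sigma> p) = D * q + r" "r = 0 \<or> degree r < degree D"
      using pseudo_division[OF D0] unfolding leadD by blast
    from g_div[OF H_\<sigma>[OF p]] obtain k q' where q': "smult (l ^ k) (\<sigma> p) = g * q'" by blast
    have "smult (m * l ^ k) r = [:m ^ j:] * smult m (smult (l ^ k) (\<sigma> p)) - D * smult (m * l ^ k) q"
      using arg_cong[OF qr(1), of "smult (m * l ^ k)"] by (simp add: smult_add_right mult_ac)
    also have "smult m (smult (l ^ k) (\<sigma> p)) = D * smult l q'"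
      unfolding q' mult_smult_left[symmetric] D by simp
    also have "[:m ^ j:] * (D * smult l q') - D * smult (m * l ^ k) q
        = D * ([:m ^ j:] * smult l q' - smult (m * l ^ k) q)"
      by (simp add: algebra_simps)
    finally have "D dvd smult (m * l ^ k) r" by simp
    moreover have "m * l ^ k \<noteq> 0" using l0 K0[OF m] by simp
    ultimately have "r = 0" using qr(2) by (rule dvd_smult_small)
    with qr(1) have "D dvd smult (m ^ j) (\<sigma> p)" by simp
    with scalar_set_power[OF K m] show ?thesis by blast
  qed
  define \<tau>' where "\<tau>' p = poly (map_poly \<tau> p) [:0, 1:]" for p
  have \<tau>'_hom: "ring_hom_fun \<tau>'"
    unfolding \<tau>'_def by (intro ring_hom_fun_comp[OF ring_hom_fun_poly] ring_hom_fun_map_poly hom')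
  have \<tau>'_dvd: "\<exists>k\<in>K. \<tau>' D dvd [:k * p:]" if p: "p \<in> P" for p
  proof -
    from D_dvd[OF p] obtain k z where k: "k \<in> K" "smult k (\<sigma> p) = D * z" by (auto simp: dvd_def)
    have "smult k (\<sigma> p) = \<sigma> (k * p)" using \<sigma>K[OF k(1)] by (simp add: h)
    then have "[:k * p:] = \<tau>' D * \<tau>' z"
      using k(2) \<tau>\<sigma>[of "k * p"] by (metis \<tau>'_def ring_hom_funD(2)[OF \<tau>'_hom])
    then have "\<tau>' D dvd [:k * p:]" by (rule dvdI)
    with k(1) show ?thesis by blast
  qed
  \<comment> \<open>A divisor of a nonzero constant polynomial over a domain is constant, so the
    inverse shift of D does not involve T.\<close>
  from \<tau>'_dvd[OF x(1)] obtain k where "k \<in> K" "\<tau>' D dvd [:k * x:]" by blast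
  then have "degree (\<tau>' D) = 0" using dvd_imp_degree_le[of "\<tau>' D" "[:k * x:]"] K0 x(2) by auto
  then obtain e where e: "\<tau>' D = [:e:]" by (rule degree_eq_zeroE)
  have De: "D = \<sigma> e"
    using shift_extension_inverse[OF hom hom' \<sigma>\<tau>, of D] e
    by (simp add: \<tau>'_def map_poly_hom_pCons[OF hom])
  have e_dvd: "dvd_upto K e p" if p: "p \<in> P" for p
    using \<tau>'_dvd[OF p] unfolding e dvd_upto_def const_poly_dvd_const_poly_iff .
  have e0: "e \<noteq> 0" using D0 De h(4) by auto
  \<comment> \<open>For p in P with \<open>\<sigma> p\<close> of least degree, a scalar multiple of
    p is \<open>e * z\<close>. If e were not in P, primality would put z there, and minimality would
    force \<open>\<sigma> e\<close>, which is D, to have degree 0.\<close>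
  have "e \<in> P"
  proof -
    obtain p where p: "p \<in> P" "p \<noteq> 0"
      and p_min: "\<And>p'. p' \<in> P \<Longrightarrow> p' \<noteq> 0 \<Longrightarrow> degree (\<sigma> p) \<le> degree (\<sigma> p')"
      using ex_has_least_nat[of "\<lambda>p. p \<in> P \<and> p \<noteq> 0" x "\<lambda>p. degree (\<sigma> p)"] x by blast
    from e_dvd[OF p(1)] obtain k z where k: "k \<in> K" "k * p = e * z" by (rule dvd_uptoE)
    have "k * p \<in> P" using P p(1) by (auto simp: is_ideal_def)
    then have "e * z \<in> P" by (simp only: k(2))
    from prime[OF this] consider "e \<in> P" | "z \<in> P" by blast
    then show ?thesis
    proof cases
      case 2
      have z0: "z \<noteq> 0" using k K0 p(2) by auto
      have "\<sigma> e * \<sigma> z = \<sigma> (k * p)" by (simp add: k(2) h)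
      also have "\<dots> = smult k (\<sigma> p)" using \<sigma>K[OF k(1)] by (simp add: h)
      finally have "\<sigma> e * \<sigma> z = smult k (\<sigma> p)" .
      then have "degree (\<sigma> e) + degree (\<sigma> z) = degree (\<sigma> p)"
        using arg_cong[of _ _ degree] K0[OF k(1)] \<sigma>0[OF e0] \<sigma>0[OF z0]
        by (metis degree_mult_eq degree_smult_eq)
      with p_min[OF 2 z0] have "degree (\<sigma> e) = 0" by simp
      with De degD deg_g show ?thesis by simp
    qed
  qed
  with e0 e_dvd show ?thesis by blast
qed

subsection \<open>Exponential maps\<close>

text \<open>The outer variable U is set to 0 in \<open>p(V + U)\<close>; what remains is a
  polynomial in V.\<close>

lemma poly_shift_0:
  fixes p :: "'b::comm_ring_1 poly"
  shows "poly (pcompose (map_poly (\<lambda>c. [:c:]) p) [:[:0, 1:], 1:]) 0 = p"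
  by (simp add: poly_pcompose flip: pcompose_altdef)

lemma exp_mapD:
  assumes "exp_map C \<phi>"
  shows "ring_hom_fun \<phi>" "poly (\<phi> b) 0 = b" "c \<in> C \<Longrightarrow> \<phi> c = [:c:]"
    "map_poly \<phi> (\<phi> b) = pcompose (map_poly (\<lambda>c. [:c:]) (\<phi> b)) [:[:0, 1:], 1:]"
  using assms by (auto simp: exp_map_def)

lemma invariants_iff_degree:
  assumes "exp_map C \<phi>"
  shows "b \<in> invariants \<phi> \<longleftrightarrow> degree (\<phi> b) = 0"
proof
  assume "degree (\<phi> b) = 0"
  then obtain a where "\<phi> b = [:a:]" by (rule degree_eq_zeroE)
  with exp_mapD(2)[OF assms, of b] show "b \<in> invariants \<phi>" by (auto simp: invariants_def)
qed (auto simp: invariants_def)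

lemma degree_shift:
  fixes p :: "'b::idom poly"
  shows "degree (pcompose (map_poly (\<lambda>c. [:c:]) p) [:[:0, 1:], 1:]) = degree p"
    and "lead_coeff (pcompose (map_poly (\<lambda>c. [:c:]) p) [:[:0, 1:], 1:]) = [:lead_coeff p:]"
proof -
  have "degree (map_poly (\<lambda>c. [:c:]) p) = degree p"
    by (rule degree_map_poly) simp
  moreover have "lead_coeff (pcompose (map_poly (\<lambda>c. [:c:]) p) [:[:0, 1:], 1::'b poly:])
      = lead_coeff (map_poly (\<lambda>c. [:c:]) p) * lead_coeff [:[:0, 1:], 1::'b poly:] ^ degree (map_poly (\<lambda>c. [:c:]) p)"
    by (rule lead_coeff_comp) simp
  ultimately show "degree (pcompose (map_poly (\<lambda>c. [:c:]) p) [:[:0, 1:], 1:]) = degree p"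
    and "lead_coeff (pcompose (map_poly (\<lambda>c. [:c:]) p) [:[:0, 1:], 1:]) = [:lead_coeff p:]"
    by (simp_all add: degree_pcompose coeff_map_poly)
qed

text \<open>Compare the coefficients of the highest power of U in \<open>\<phi>\<^sub>V
  \<phi>\<^sub>U(b) = \<phi>\<^sub>V\<^sub>+\<^sub>U(b)\<close>: the one on the right is free of
  V.\<close>

lemma lead_coeff_invariant:
  fixes \<phi> :: "'b::idom \<Rightarrow> 'b poly"
  assumes \<phi>: "exp_map C \<phi>"
  shows "lead_coeff (\<phi> b) \<in> invariants \<phi>"
proof -
  note hom = exp_mapD(1)[OF \<phi>]
  have "coeff (map_poly \<phi> (\<phi> b)) (degree (\<phi> b)) = \<phi> (lead_coeff (\<phi> b))"
    by (simp add: coeff_map_poly ring_hom_funD[OF hom])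
  moreover have "coeff (map_poly \<phi> (\<phi> b)) (degree (\<phi> b)) = [:lead_coeff (\<phi> b):]"
    unfolding exp_mapD(4)[OF \<phi>] using degree_shift[of "\<phi> b"] by simp
  ultimately show ?thesis by (simp add: invariants_def)
qed

lemma exp_map_nonzero: "exp_map C \<phi> \<Longrightarrow> \<phi> b = 0 \<longleftrightarrow> b = 0"
  using exp_mapD(2)[of C \<phi> b] ring_hom_funD(4)[OF exp_mapD(1)[of C \<phi>]] by auto

lemma degree_exp_map_mult:
  fixes \<phi> :: "'b::idom \<Rightarrow> 'b poly"
  assumes "exp_map C \<phi>" "a \<noteq> 0" "b \<noteq> 0"
  shows "degree (\<phi> (a * b)) = degree (\<phi> a) + degree (\<phi> b)"
  using assms exp_map_nonzero[OF assms(1)]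
  by (simp add: ring_hom_funD[OF exp_mapD(1)[OF assms(1)]] degree_mult_eq)

text \<open>Pseudo-division of \<open>\<phi>\<^sub>V(b)\<close> by \<open>\<phi>\<^sub>V(x)\<close> gives a remainder r(V). Comparing the images of this
  equation under \<open>V \<mapsto> V + U\<close> and under \<open>\<phi>\<^sub>V\<close> applied to coefficients, uniqueness of division yields
  \<open>\<phi>\<^sub>V(r(0)) = r(V)\<close>, so that \<open>r(0)\<close> has smaller degree than x.\<close>
lemma exp_map_division:
  fixes \<phi> :: "'b::idom \<Rightarrow> 'b poly"
  assumes \<phi>: "exp_map C \<phi>" and x: "x \<notin> invariants \<phi>"
    and min: "\<And>y. y \<notin> invariants \<phi> \<Longrightarrow> degree (\<phi> x) \<le> degree (\<phi> y)"
  shows "\<exists>k q r. lead_coeff (\<phi> x) ^ k * b = x * q + r \<and> r \<in> invariants \<phi>"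
proof -
  note hom = exp_mapD(1)[OF \<phi>]
  have inv_deg: "y \<in> invariants \<phi> \<longleftrightarrow> degree (\<phi> y) = 0" for y by (rule invariants_iff_degree[OF \<phi>])
  have deg: "degree (\<phi> x) > 0" using x inv_deg by simp
  then have x0: "\<phi> x \<noteq> 0" by auto
  obtain k q r where qr: "smult (lead_coeff (\<phi> x) ^ k) (\<phi> b) = \<phi> x * q + r"
    "r = 0 \<or> degree r < degree (\<phi> x)"
    using pseudo_division[OF x0] by blast
  define c where "c = lead_coeff (\<phi> x) ^ k"
  have c: "\<phi> c = [:c:]"
    using lead_coeff_invariant[OF \<phi>, of x]
    by (simp add: c_def invariants_def ring_hom_funD[OF hom] poly_const_pow)
  \<comment> \<open>The substitution \<open>U := V + U\<close>; in these terms the exponential law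
    reads \<open>?M (\<phi> y) = S (\<phi> y)\<close>.\<close>
  define S where "S p = pcompose (map_poly (\<lambda>c. [:c:]) p) [:[:0, 1:], 1::'b poly:]" for p :: "'b poly"
  have S_hom: "ring_hom_fun S"
    unfolding S_def
    by (intro ring_hom_fun_comp[OF ring_hom_fun_pcompose] ring_hom_fun_map_poly ring_hom_fun_const_poly)
  have S_c: "S [:c:] = [:[:c:]:]" for c
    by (simp add: S_def map_poly_hom_pCons[OF ring_hom_fun_const_poly])
  let ?M = "map_poly \<phi>"
  note M = ring_hom_funD[OF ring_hom_fun_map_poly[OF hom]]
  note S = ring_hom_funD[OF S_hom]
  have SM: "?M (\<phi> y) = S (\<phi> y)" for y unfolding S_def by (rule exp_mapD(4)[OF \<phi>])
  have qr': "[:c:] * \<phi> b = \<phi> x * q + r" using qr(1) by (simp add: c_def)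
  have "S (\<phi> x) * S q + S r = S (\<phi> x) * ?M q + ?M r"
  proof -
    have "S (\<phi> x) * S q + S r = [:[:c:]:] * S (\<phi> b)"
      by (simp only: S_c[symmetric] S(2)[symmetric] qr' S(1))
    also have "\<dots> = ?M ([:c:] * \<phi> b)"
      unfolding SM[symmetric] M(2) by (simp add: map_poly_hom_pCons[OF hom] c)
    also have "\<dots> = S (\<phi> x) * ?M q + ?M r" unfolding qr' M(1) M(2) SM ..
    finally show ?thesis .
  qed
  then have eq: "S (\<phi> x) * (S q - ?M q) = ?M r - S r" by (simp add: algebra_simps)
  have "?M r - S r = 0"
  proof (rule ccontr)
    assume n0: "?M r - S r \<noteq> 0"
    have "degree (S (\<phi> x)) \<le> degree (?M r - S r)"
      by (rule dvd_imp_degree_le[OF dvdI[OF eq[symmetric]] n0])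
    moreover have "degree (?M r) \<le> degree r" by (rule map_poly_degree_leq)
    moreover have "degree (S r) = degree r" unfolding S_def by (rule degree_shift)
    moreover have "degree (S (\<phi> x)) = degree (\<phi> x)" unfolding S_def by (rule degree_shift)
    moreover have "r \<noteq> 0" using n0 by (auto simp: S)
    ultimately show False using qr(2) degree_diff_le[of "?M r" "degree r" "S r"] by auto
  qed
  \<comment> \<open>Setting U = 0 leaves \<open>\<phi> (poly r 0)\<close> on the left and r itself,
    as a polynomial in V, on the right.\<close>
  then have "poly (?M r) 0 = poly (S r) 0" by simp
  then have "\<phi> (poly r 0) = r"
    using poly_map_poly_hom[OF hom, of r 0]
    by (simp add: S_def poly_shift_0 ring_hom_funD[OF hom])
  then have "poly r 0 \<in> invariants \<phi>" using min[of "poly r 0"] qr(2) inv_deg[of "poly r 0"] deg by force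
  moreover have "c * b = x * poly q 0 + poly r 0"
    using arg_cong[OF qr', of "\<lambda>p. poly p 0"] exp_mapD(2)[OF \<phi>] by simp
  ultimately show ?thesis unfolding c_def by blast
qed

text \<open>The prime is the kernel of \<pi>. Subtracting \<open>\<pi> y\<close> from an element y
  of least positive degree does not change its degree, as \<open>\<pi> y\<close> is invariant, and
  puts it into the kernel. The remainder of a kernel element under division by x is invariant and is
  sent to 0 by \<pi>, hence it vanishes.\<close>

lemma retract_kernel_generator:
  fixes \<phi> :: "'b::idom \<Rightarrow> 'b poly"
  assumes K: "scalar_set K" "has_shifts K" "K \<subseteq> invariants \<phi>"
    and \<phi>: "exp_map C \<phi>" "\<phi> \<noteq> (\<lambda>b. [:b:])"
    and \<pi>: "ring_hom_fun \<pi>" "\<pi> \<circ> \<pi> = \<pi>" "range \<pi> = invariants \<phi>"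
  shows "\<exists>f. \<pi> f = 0 \<and> f \<noteq> 0 \<and> (\<forall>p. \<pi> p = 0 \<longrightarrow> dvd_upto K f p)"
proof -
  let ?A = "invariants \<phi>"
  note hom = ring_hom_funD[OF exp_mapD(1)[OF \<phi>(1)]]
  note \<pi>h = ring_hom_funD[OF \<pi>(1)]
  have \<pi>A: "\<pi> a = a" if "a \<in> ?A" for a using that \<pi>(2,3) by (metis comp_apply imageE)
  have \<pi>_in: "\<pi> b \<in> ?A" for b using \<pi>(3) by blast
  have inv_deg: "y \<in> ?A \<longleftrightarrow> degree (\<phi> y) = 0" for y by (rule invariants_iff_degree[OF \<phi>(1)])
  have "\<exists>y. y \<notin> ?A" using \<phi>(2) by (auto simp: invariants_def)
  then obtain y where y: "y \<notin> ?A" and y_min: "\<And>z. z \<notin> ?A \<Longrightarrow> degree (\<phi> y) \<le> degree (\<phi> z)"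
    using ex_has_least_nat[of "\<lambda>y. y \<notin> ?A" _ "\<lambda>y. degree (\<phi> y)"] by blast
  define x where "x = y - \<pi> y"
  have "\<phi> x = \<phi> y + [:- \<pi> y:]" using \<pi>_in[of y] by (simp add: x_def hom invariants_def)
  also have "degree \<dots> = degree (\<phi> y)"
    using y inv_deg[of y] by (intro degree_add_eq_left) simp
  finally have deg_x: "degree (\<phi> x) = degree (\<phi> y)" .
  have x: "x \<notin> ?A" using y deg_x inv_deg by simp
  have x_ker: "\<pi> x = 0" using \<pi>A[OF \<pi>_in] by (simp add: x_def \<pi>h)
  have x0: "x \<noteq> 0" using x by (auto simp: invariants_def hom)
  define c where "c = lead_coeff (\<phi> x)"
  have c0: "c \<noteq> 0" using x0 exp_map_nonzero[OF \<phi>(1)] by (simp add: c_def)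
  have c: "c ^ k \<in> ?A" for k
    using lead_coeff_invariant[OF \<phi>(1), of x] by (simp add: c_def invariants_def hom poly_const_pow)
  let ?P = "{p. \<pi> p = 0}"
  have "\<exists>f\<in>?P. f \<noteq> 0 \<and> (\<forall>p\<in>?P. dvd_upto K f p)"
  proof (rule prime_generator_upto[OF K(1,2)])
    show "is_ideal ?P" by (simp add: is_ideal_def \<pi>h)
    show "a \<in> ?P \<or> b \<in> ?P" if "a * b \<in> ?P" for a b using that by (simp add: \<pi>h)
    show "x \<in> ?P" "x \<noteq> 0" "c \<noteq> 0" using x_ker x0 c0 by auto
    show "\<exists>k. x dvd c ^ k * p" if p: "p \<in> ?P" for p
    proof -
      obtain k q r where kqr: "c ^ k * p = x * q + r" "r \<in> ?A"
        using exp_map_division[OF \<phi>(1) x, of p] y_min deg_x unfolding c_def by auto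
      have "\<pi> r = 0" using arg_cong[OF kqr(1), of \<pi>] p x_ker by (simp add: \<pi>h)
      then have "r = 0" using \<pi>A[OF kqr(2)] by simp
      with kqr(1) have "x dvd c ^ k * p" by simp
      then show ?thesis ..
    qed
    \<comment> \<open>Degrees under \<phi> are additive, so every factor of a nonzero invariant is
      invariant; x is not.\<close>
    show "\<not> dvd_upto K x (c ^ k)" for k
    proof
      assume "dvd_upto K x (c ^ k)"
      then obtain m z where m: "m \<in> K" "m * c ^ k = x * z" by (rule dvd_uptoE)
      have "m \<noteq> 0" using m(1) K(1) by (auto simp: scalar_set_def)
      have z0: "z \<noteq> 0" using m(2) c0 \<open>m \<noteq> 0\<close> by auto
      have "m * c ^ k \<in> ?A" using m(1) K(3) c[of k] by (auto simp: invariants_def hom)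
      then have "degree (\<phi> (x * z)) = 0" using m(2) inv_deg by simp
      then have "degree (\<phi> x) = 0" using degree_exp_map_mult[OF \<phi>(1) x0 z0] by simp
      with x inv_deg show False by simp
    qed
  qed
  then show ?thesis by auto
qed

subsection \<open>Evaluation of polynomials\<close>

abbreviation pm_const :: "'a \<Rightarrow> ('m \<Rightarrow>\<^sub>0 nat) \<Rightarrow>\<^sub>0 'a::comm_ring_1" where
  "pm_const a \<equiv> Poly_Mapping.single 0 a"

definition pm_monom :: "('m \<Rightarrow> 'c) \<Rightarrow> ('m \<Rightarrow>\<^sub>0 nat) \<Rightarrow> 'c::comm_ring_1" where
  "pm_monom y \<mu> = (\<Prod>m\<in>Poly_Mapping.keys \<mu>. y m ^ Poly_Mapping.lookup \<mu> m)"

text \<open>Coefficients and values may live in different rings: the Kronecker substitution, the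
  shifts and the maps out of \<open>A[T\<^sub>m]\<close> are all instances.\<close>

definition pm_eval :: "('a \<Rightarrow> 'c) \<Rightarrow> ('m \<Rightarrow> 'c) \<Rightarrow> (('m \<Rightarrow>\<^sub>0 nat) \<Rightarrow>\<^sub>0 'a::comm_ring_1) \<Rightarrow> 'c::comm_ring_1" where
  "pm_eval h y p = (\<Sum>\<mu>\<in>Poly_Mapping.keys p. h (Poly_Mapping.lookup p \<mu>) * pm_monom y \<mu>)"

text \<open>The type of \<open>sym_var\<close> identifies the index type with the coefficient type;
  this is the same monomial without that restriction.\<close>

definition pm_var :: "'m \<Rightarrow> ('m \<Rightarrow>\<^sub>0 nat) \<Rightarrow>\<^sub>0 'a::comm_ring_1" where
  "pm_var m = Poly_Mapping.single (Poly_Mapping.single m 1) 1"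

lemma sym_var_eq_pm_var: "sym_var = pm_var"
  by (simp add: fun_eq_iff sym_var_def pm_var_def)

lemma pm_sum_single:
  "(\<Sum>\<mu>\<in>Poly_Mapping.keys p. Poly_Mapping.single \<mu> (Poly_Mapping.lookup p \<mu>)) = p"
proof (rule poly_mapping_eqI)
  fix \<nu>
  have "Poly_Mapping.lookup (\<Sum>\<mu>\<in>Poly_Mapping.keys p. Poly_Mapping.single \<mu> (Poly_Mapping.lookup p \<mu>)) \<nu>
      = (\<Sum>\<mu>\<in>Poly_Mapping.keys p. if \<mu> = \<nu> then Poly_Mapping.lookup p \<mu> else 0)"
    by (simp add: lookup_sum lookup_single when_def)
  also have "\<dots> = Poly_Mapping.lookup p \<nu>" by (simp add: in_keys_iff)
  finally show "Poly_Mapping.lookup (\<Sum>\<mu>\<in>Poly_Mapping.keys p. Poly_Mapping.single \<mu> (Poly_Mapping.lookup p \<mu>)) \<nu>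
      = Poly_Mapping.lookup p \<nu>" .
qed

lemma pm_single_induct [case_names zero add]:
  assumes "P 0" and add: "\<And>\<mu> a q. P q \<Longrightarrow> P (Poly_Mapping.single \<mu> a + q)"
  shows "P (p :: 'm \<Rightarrow>\<^sub>0 'a::comm_ring_1)"
proof -
  have "P (\<Sum>\<mu>\<in>F. Poly_Mapping.single \<mu> (Poly_Mapping.lookup p \<mu>))" if "finite F" for F
    using that by (induction F rule: finite_induct) (simp_all add: assms)
  from this[of "Poly_Mapping.keys p"] show ?thesis by (simp add: pm_sum_single)
qed

lemma pm_monom_superset:
  assumes "finite F" "Poly_Mapping.keys \<mu> \<subseteq> F"
  shows "pm_monom y \<mu> = (\<Prod>m\<in>F. y m ^ Poly_Mapping.lookup \<mu> m)"
  unfolding pm_monom_def using assms by (intro prod.mono_neutral_left) (auto simp: in_keys_iff)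

lemma pm_monom_0: "pm_monom y 0 = 1"
  by (simp add: pm_monom_def)

lemma pm_monom_add: "pm_monom y (\<mu> + \<nu>) = pm_monom y \<mu> * pm_monom y \<nu>"
proof -
  let ?F = "Poly_Mapping.keys \<mu> \<union> Poly_Mapping.keys \<nu>"
  have "pm_monom y (\<mu> + \<nu>) = (\<Prod>m\<in>?F. y m ^ Poly_Mapping.lookup (\<mu> + \<nu>) m)"
    by (rule pm_monom_superset) (use Poly_Mapping.keys_add[of \<mu> \<nu>] in auto)
  also have "\<dots> = (\<Prod>m\<in>?F. y m ^ Poly_Mapping.lookup \<mu> m) * (\<Prod>m\<in>?F. y m ^ Poly_Mapping.lookup \<nu> m)"
    by (simp add: lookup_add power_add prod.distrib)
  also have "\<dots> = pm_monom y \<mu> * pm_monom y \<nu>" by (simp flip: pm_monom_superset)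
  finally show ?thesis .
qed

lemma pm_monom_single: "pm_monom y (Poly_Mapping.single m k) = y m ^ k"
  by (simp add: pm_monom_def)

lemma pm_monom_hom:
  assumes "ring_hom_fun g"
  shows "g (pm_monom y \<mu>) = pm_monom (\<lambda>m. g (y m)) \<mu>"
  by (simp add: pm_monom_def ring_hom_funD[OF assms])

lemma pm_single_eq: "Poly_Mapping.single \<mu> a = pm_const a * pm_monom pm_var \<mu>"
proof -
  have pow: "pm_var m ^ k = Poly_Mapping.single (Poly_Mapping.single m k) (1::'b)" for m :: 'a and k
    by (induction k) (simp_all add: pm_var_def mult_single flip: single_add)
  have "(\<Prod>m\<in>F. Poly_Mapping.single (Poly_Mapping.single m (f m)) (1::'b))
      = Poly_Mapping.single (\<Sum>m\<in>F. Poly_Mapping.single m (f m)) 1" if "finite F" for F and f :: "'a \<Rightarrow> nat"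
    using that by (induction F rule: finite_induct) (simp_all add: mult_single)
  from this[OF finite_keys, of "Poly_Mapping.lookup \<mu>" \<mu>]
  have "pm_monom pm_var \<mu> = Poly_Mapping.single \<mu> (1::'b)"
    unfolding pm_monom_def pow pm_sum_single .
  then show ?thesis by (simp add: mult_single)
qed

lemma pm_eval_superset:
  assumes "ring_hom_fun h" "finite F" "Poly_Mapping.keys p \<subseteq> F"
  shows "pm_eval h y p = (\<Sum>\<mu>\<in>F. h (Poly_Mapping.lookup p \<mu>) * pm_monom y \<mu>)"
  unfolding pm_eval_def using assms
  by (intro sum.mono_neutral_left) (auto simp: in_keys_iff ring_hom_funD)

lemma pm_eval_0: "pm_eval h y 0 = 0"
  by (simp add: pm_eval_def)

lemma pm_eval_single:
  assumes "ring_hom_fun h"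
  shows "pm_eval h y (Poly_Mapping.single \<mu> a) = h a * pm_monom y \<mu>"
  using pm_eval_superset[OF assms, of "{\<mu>}" "Poly_Mapping.single \<mu> a" y] by simp

lemma pm_eval_add:
  assumes "ring_hom_fun h"
  shows "pm_eval h y (p + q) = pm_eval h y p + pm_eval h y q"
proof -
  let ?F = "Poly_Mapping.keys p \<union> Poly_Mapping.keys q"
  have "pm_eval h y (p + q) = (\<Sum>\<mu>\<in>?F. h (Poly_Mapping.lookup (p + q) \<mu>) * pm_monom y \<mu>)"
    by (rule pm_eval_superset[OF assms]) (use Poly_Mapping.keys_add[of p q] in auto)
  also have "\<dots> = (\<Sum>\<mu>\<in>?F. h (Poly_Mapping.lookup p \<mu>) * pm_monom y \<mu>)
      + (\<Sum>\<mu>\<in>?F. h (Poly_Mapping.lookup q \<mu>) * pm_monom y \<mu>)"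
    by (simp add: lookup_add ring_hom_funD[OF assms] algebra_simps sum.distrib)
  also have "\<dots> = pm_eval h y p + pm_eval h y q"
    by (simp flip: pm_eval_superset[OF assms])
  finally show ?thesis .
qed

lemma ring_hom_fun_pm_eval:
  assumes h: "ring_hom_fun h"
  shows "ring_hom_fun (pm_eval h y)"
proof (rule ring_hom_funI)
  show "pm_eval h y (p + q) = pm_eval h y p + pm_eval h y q" for p q
    by (rule pm_eval_add[OF h])
  show "pm_eval h y 1 = 1"
    using pm_eval_single[OF h, of y 0 1] by (simp add: pm_monom_0 ring_hom_funD[OF h])
  show "pm_eval h y (p * q) = pm_eval h y p * pm_eval h y q" for p q
  proof (induction p rule: pm_single_induct)
    case (add \<mu> a p)
    have "pm_eval h y (Poly_Mapping.single \<mu> a * q) = h a * pm_monom y \<mu> * pm_eval h y q"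
    proof (induction q rule: pm_single_induct)
      case (add \<nu> b q)
      then show ?case
        by (simp add: distrib_left pm_eval_add[OF h] mult_single pm_eval_single[OF h] pm_monom_add
            ring_hom_funD[OF h] mult_ac)
    qed (simp add: pm_eval_0)
    then show ?case by (simp add: add distrib_right pm_eval_add[OF h] pm_eval_single[OF h])
  qed (simp add: pm_eval_0)
qed

lemma pm_eval_const: "ring_hom_fun h \<Longrightarrow> pm_eval h y (pm_const a) = h a"
  by (simp add: pm_eval_single pm_monom_0)

lemma pm_eval_var: "ring_hom_fun h \<Longrightarrow> pm_eval h y (pm_var m) = y m"
  by (simp add: pm_var_def pm_eval_single pm_monom_single ring_hom_funD)

lemma ring_hom_fun_pm_const: "ring_hom_fun pm_const"
  by (rule ring_hom_funI) (simp_all add: single_add mult_single)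

lemma hom_eq_pm_eval:
  assumes "ring_hom_fun g"
  shows "g p = pm_eval (\<lambda>a. g (pm_const a)) (\<lambda>m. g (pm_var m)) p"
proof (induction p rule: pm_single_induct)
  case zero
  then show ?case by (simp add: pm_eval_0 ring_hom_funD[OF assms])
next
  case (add \<mu> a q)
  have h: "ring_hom_fun (\<lambda>a. g (pm_const a))"
    by (rule ring_hom_fun_comp[OF assms ring_hom_fun_pm_const])
  have "g (Poly_Mapping.single \<mu> a) = g (pm_const a) * pm_monom (\<lambda>m. g (pm_var m)) \<mu>"
    by (simp only: pm_single_eq[of \<mu> a] ring_hom_funD(2)[OF assms] pm_monom_hom[OF assms])
  with add show ?case by (simp add: ring_hom_funD(1)[OF assms] pm_eval_add[OF h] pm_eval_single[OF h])
qed

lemma pm_hom_eqI: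
  assumes "ring_hom_fun g" "ring_hom_fun g'" "\<And>a. g (pm_const a) = g' (pm_const a)"
    "\<And>m. g (pm_var m) = g' (pm_var m)"
  shows "g p = g' p"
  using hom_eq_pm_eval[OF assms(1), of p] hom_eq_pm_eval[OF assms(2), of p] assms(3,4) by simp

lemma lookup_const_mult: "Poly_Mapping.lookup (pm_const a * p) \<mu> = a * Poly_Mapping.lookup p \<mu>"
proof (induction p rule: pm_single_induct)
  case (add \<nu> b q)
  then show ?case
    by (auto simp: distrib_left lookup_add mult_single lookup_single when_def)
qed simp

subsection \<open>Kronecker substitution\<close>

definition weight :: "('v::finite \<Rightarrow> nat) \<Rightarrow> ('v \<Rightarrow>\<^sub>0 nat) \<Rightarrow> nat" where
  "weight w \<mu> = (\<Sum>v\<in>UNIV. w v * Poly_Mapping.lookup \<mu> v)"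

text \<open>The variables are added one at a time, and the claim for a set V separates only the
  exponents in V. The new variable gets a weight N above all partial weights occurring in M; its
  exponent and the partial weight are then quotient and remainder modulo N.\<close>

lemma exists_separating_weight:
  fixes M :: "('v::finite \<Rightarrow>\<^sub>0 nat) set"
  assumes "finite M"
  obtains w :: "'v \<Rightarrow> nat" where "\<And>v. w v > 0" "inj_on (weight w) M"
proof -
  have "\<exists>w::'v \<Rightarrow> nat. (\<forall>v. w v > 0) \<and> (\<forall>\<mu>\<in>M. \<forall>\<nu>\<in>M.
      (\<Sum>v\<in>V. w v * Poly_Mapping.lookup \<mu> v) = (\<Sum>v\<in>V. w v * Poly_Mapping.lookup \<nu> v)
      \<longrightarrow> (\<forall>v\<in>V. Poly_Mapping.lookup \<mu> v = Poly_Mapping.lookup \<nu> v))" for V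
  proof (induction V rule: infinite_finite_induct)
    case (insert u V)
    then obtain w :: "'v \<Rightarrow> nat" where w: "\<And>v. w v > 0"
      "\<And>\<mu> \<nu>. \<mu> \<in> M \<Longrightarrow> \<nu> \<in> M \<Longrightarrow>
        (\<Sum>v\<in>V. w v * Poly_Mapping.lookup \<mu> v) = (\<Sum>v\<in>V. w v * Poly_Mapping.lookup \<nu> v)
        \<Longrightarrow> \<forall>v\<in>V. Poly_Mapping.lookup \<mu> v = Poly_Mapping.lookup \<nu> v"
      by blast
    define s where "s \<mu> = (\<Sum>v\<in>V. w v * Poly_Mapping.lookup \<mu> v)" for \<mu>
    define N where "N = Suc (Max (insert 0 (s ` M)))"
    have N: "s \<mu> < N" if "\<mu> \<in> M" for \<mu>
      unfolding N_def using that assms by (simp add: less_Suc_eq_le)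
    define w' where "w' = w(u := N)"
    have s': "(\<Sum>v\<in>insert u V. w' v * Poly_Mapping.lookup \<mu> v) = N * Poly_Mapping.lookup \<mu> u + s \<mu>" for \<mu>
    proof -
      have "(\<Sum>v\<in>V. w' v * Poly_Mapping.lookup \<mu> v) = s \<mu>"
        unfolding s_def using insert.hyps(2) by (intro sum.cong) (auto simp: w'_def)
      then show ?thesis using insert.hyps by (simp add: w'_def)
    qed
    show ?case
    proof (intro exI[of _ w'] conjI allI ballI impI)
      show "w' v > 0" for v using w(1) by (simp add: w'_def N_def)
      fix \<mu> \<nu> v
      assume \<mu>: "\<mu> \<in> M" and \<nu>: "\<nu> \<in> M"
        and eq: "(\<Sum>v\<in>insert u V. w' v * Poly_Mapping.lookup \<mu> v)
          = (\<Sum>v\<in>insert u V. w' v * Poly_Mapping.lookup \<nu> v)" and v: "v \<in> insert u V"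
      have e: "N * Poly_Mapping.lookup \<mu> u + s \<mu> = N * Poly_Mapping.lookup \<nu> u + s \<nu>"
        using eq unfolding s' .
      have u: "Poly_Mapping.lookup \<mu> u = Poly_Mapping.lookup \<nu> u"
        using arg_cong[OF e, of "\<lambda>n. n div N"] N[OF \<mu>] N[OF \<nu>] by simp
      with e have "s \<mu> = s \<nu>" by simp
      with w(2)[OF \<mu> \<nu>] u v show "Poly_Mapping.lookup \<mu> v = Poly_Mapping.lookup \<nu> v"
        by (auto simp: s_def)
    qed
  qed (auto intro!: exI[of _ "\<lambda>_. 1"])
  from this[of UNIV] obtain w :: "'v \<Rightarrow> nat" where w: "\<forall>v. w v > 0"
    "\<forall>\<mu>\<in>M. \<forall>\<nu>\<in>M. weight w \<mu> = weight w \<nu>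
      \<longrightarrow> (\<forall>v\<in>UNIV. Poly_Mapping.lookup \<mu> v = Poly_Mapping.lookup \<nu> v)"
    unfolding weight_def[symmetric] by (elim exE conjE)
  show ?thesis
  proof (rule that[of w])
    show "inj_on (weight w) M" using w(2) by (intro inj_onI poly_mapping_eqI) blast
  qed (use w(1) in simp)
qed

definition kronecker :: "('v::finite \<Rightarrow> nat) \<Rightarrow> (('v \<Rightarrow>\<^sub>0 nat) \<Rightarrow>\<^sub>0 'r::comm_ring_1) \<Rightarrow> 'r poly" where
  "kronecker w = pm_eval (\<lambda>a. [:a:]) (\<lambda>v. monom 1 (w v))"

lemma ring_hom_fun_kronecker: "ring_hom_fun (kronecker w)"
  unfolding kronecker_def by (intro ring_hom_fun_pm_eval ring_hom_fun_const_poly)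

lemma kronecker_altdef:
  fixes p :: "('v::finite \<Rightarrow>\<^sub>0 nat) \<Rightarrow>\<^sub>0 'r::comm_ring_1"
  shows "kronecker w p = (\<Sum>\<mu>\<in>Poly_Mapping.keys p. monom (Poly_Mapping.lookup p \<mu>) (weight w \<mu>))"
proof -
  have "pm_monom (\<lambda>v. monom (1::'r) (w v)) \<mu> = monom 1 (weight w \<mu>)" for \<mu> :: "'v \<Rightarrow>\<^sub>0 nat"
  proof -
    have "(\<Prod>v\<in>F. monom (1::'r) (w v) ^ Poly_Mapping.lookup \<mu> v)
        = monom 1 (\<Sum>v\<in>F. w v * Poly_Mapping.lookup \<mu> v)" for F
      by (induction F rule: infinite_finite_induct) (simp_all add: monom_power mult_monom)
    then show ?thesis unfolding weight_def pm_monom_superset[OF finite subset_UNIV] .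
  qed
  then show ?thesis by (simp add: kronecker_def pm_eval_def smult_monom)
qed

lemma coeff_kronecker:
  assumes "inj_on (weight w) (Poly_Mapping.keys p)" "\<mu> \<in> Poly_Mapping.keys p"
  shows "coeff (kronecker w p) (weight w \<mu>) = Poly_Mapping.lookup p \<mu>"
proof -
  have "coeff (kronecker w p) (weight w \<mu>)
      = (\<Sum>\<nu>\<in>Poly_Mapping.keys p. if \<nu> = \<mu> then Poly_Mapping.lookup p \<nu> else 0)"
    unfolding kronecker_altdef coeff_sum
    using assms by (intro sum.cong refl) (simp add: inj_on_eq_iff)
  also have "\<dots> = Poly_Mapping.lookup p \<mu>" using assms(2) by simp
  finally show ?thesis .
qed

lemma kronecker_nonzero:
  assumes "inj_on (weight w) (Poly_Mapping.keys p)" "p \<noteq> 0"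
  shows "kronecker w p \<noteq> 0"
proof -
  obtain \<mu> where "\<mu> \<in> Poly_Mapping.keys p" using assms(2) by fastforce
  with coeff_kronecker[OF assms(1) this] show ?thesis by (auto simp: in_keys_iff)
qed

text \<open>Under a weight that separates the monomials of both factors neither image in
  \<open>'r poly\<close> vanishes, and that ring is a domain.\<close>

lemma pm_no_zero_divisors:
  fixes p q :: "('v::finite \<Rightarrow>\<^sub>0 nat) \<Rightarrow>\<^sub>0 'r::idom"
  assumes "p * q = 0"
  shows "p = 0 \<or> q = 0"
proof (rule ccontr)
  assume nz: "\<not> (p = 0 \<or> q = 0)"
  obtain w where w: "inj_on (weight w) (Poly_Mapping.keys p \<union> Poly_Mapping.keys q)"
    using exists_separating_weight[of "Poly_Mapping.keys p \<union> Poly_Mapping.keys q"] by auto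
  have "kronecker w p \<noteq> 0" "kronecker w q \<noteq> 0"
    using nz by (simp_all add: kronecker_nonzero inj_on_subset[OF w])
  moreover have "kronecker w p * kronecker w q = 0"
    using assms ring_hom_funD(2,4)[OF ring_hom_fun_kronecker[of w]] by metis
  ultimately show False by simp
qed

text \<open>A weight injective on the union of the two supports makes the coefficients of f and g
  coefficients of their one-variable images, to which \<open>gauss_content\<close> applies.\<close>

lemma pm_gauss:
  fixes f g p :: "('v::finite \<Rightarrow>\<^sub>0 nat) \<Rightarrow>\<^sub>0 'r::idom"
  assumes cic: "compl_int_closed {1::'r}" and s: "s \<noteq> 0" and eq: "f * g = pm_const s * p"
  shows "s dvd Poly_Mapping.lookup f \<mu> * Poly_Mapping.lookup g \<nu>"
proof (cases "\<mu> \<in> Poly_Mapping.keys f \<and> \<nu> \<in> Poly_Mapping.keys g")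
  case True
  obtain w where w: "inj_on (weight w) (Poly_Mapping.keys f \<union> Poly_Mapping.keys g)"
    using exists_separating_weight[of "Poly_Mapping.keys f \<union> Poly_Mapping.keys g"] by auto
  note h = ring_hom_funD[OF ring_hom_fun_kronecker[of w]]
  have "kronecker w f * kronecker w g = kronecker w (pm_const s) * kronecker w p"
    using arg_cong[OF eq, of "kronecker w"] by (simp add: h)
  also have "kronecker w (pm_const s) = [:s:]"
    by (simp add: kronecker_def pm_eval_const ring_hom_fun_const_poly)
  finally have eq': "kronecker w f * kronecker w g = smult s (kronecker w p)" by simp
  have sc: "scalar_set {1::'r}" by (simp add: scalar_set_def)
  have "dvd_upto {1} s (coeff (kronecker w f * kronecker w g) k)" for k
    unfolding eq' by (rule dvd_imp_dvd_upto[OF sc]) simp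
  from gauss_content[OF sc cic s this, of "weight w \<mu>" "weight w \<nu>"]
  show ?thesis using True w by (simp add: dvd_upto_def coeff_kronecker inj_on_Un)
qed (auto simp: in_keys_iff)

subsection \<open>Polynomial rings as integral domains with shifts\<close>

text \<open>The library makes \<open>('v \<Rightarrow>\<^sub>0 nat) \<Rightarrow>\<^sub>0 'r\<close> an instance of \<open>idom\<close> only for linearly ordered
  variables; this copy is one for finitely many unordered variables.\<close>
typedef (overloaded) ('v, 'r) mpol = "UNIV :: (('v \<Rightarrow>\<^sub>0 nat) \<Rightarrow>\<^sub>0 'r::idom) set"
  morphisms to_pm of_pm by simp

setup_lifting type_definition_mpol

instantiation mpol :: (finite, idom) idom
begin
lift_definition zero_mpol :: "('a, 'b) mpol" is 0 .
lift_definition one_mpol :: "('a, 'b) mpol" is 1 .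
lift_definition plus_mpol :: "('a, 'b) mpol \<Rightarrow> ('a, 'b) mpol \<Rightarrow> ('a, 'b) mpol" is "(+)" .
lift_definition minus_mpol :: "('a, 'b) mpol \<Rightarrow> ('a, 'b) mpol \<Rightarrow> ('a, 'b) mpol" is "(-)" .
lift_definition uminus_mpol :: "('a, 'b) mpol \<Rightarrow> ('a, 'b) mpol" is uminus .
lift_definition times_mpol :: "('a, 'b) mpol \<Rightarrow> ('a, 'b) mpol \<Rightarrow> ('a, 'b) mpol" is "(*)" .
instance
  by intro_classes (transfer, auto simp: algebra_simps dest: pm_no_zero_divisors)+
end

lemma to_pm_of_pm [simp]: "to_pm (of_pm p) = p"
  by (rule of_pm_inverse) simp

lemma of_pm_to_pm [simp]: "of_pm (to_pm b) = b"
  by (rule to_pm_inverse)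

lemma of_pm_eq_iff [simp]: "of_pm p = of_pm q \<longleftrightarrow> p = q"
  by (metis to_pm_of_pm)

lemma ring_hom_fun_of_pm: "ring_hom_fun (of_pm :: (('v::finite \<Rightarrow>\<^sub>0 nat) \<Rightarrow>\<^sub>0 'r::idom) \<Rightarrow> _)"
  by (rule ring_hom_funI) (simp_all add: plus_mpol.abs_eq times_mpol.abs_eq one_mpol_def)

lemma ring_hom_fun_to_pm: "ring_hom_fun (to_pm :: ('v::finite, 'r::idom) mpol \<Rightarrow> _)"
  by (rule ring_hom_funI) (simp_all add: plus_mpol.rep_eq times_mpol.rep_eq one_mpol.rep_eq)

text \<open>Localizing at this set yields the polynomial ring over the fraction field of R.\<close>

definition mpol_scalars :: "('v, 'r::idom) mpol set" where
  "mpol_scalars = (\<lambda>r. of_pm (pm_const r)) ` (UNIV - {0})"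

lemma scalar_set_mpol_scalars: "scalar_set (mpol_scalars :: ('v::finite, 'r::idom) mpol set)"
proof -
  note h = ring_hom_funD[OF ring_hom_fun_comp[OF ring_hom_fun_of_pm ring_hom_fun_pm_const]]
  have "of_pm (pm_const r) \<noteq> (0 :: ('v, 'r) mpol)" if "r \<noteq> 0" for r
  proof
    assume "of_pm (pm_const r) = (0 :: ('v, 'r) mpol)"
    then have "pm_const r = (0 :: ('v \<Rightarrow>\<^sub>0 nat) \<Rightarrow>\<^sub>0 'r)"
      using ring_hom_funD(4)[OF ring_hom_fun_of_pm] by (metis of_pm_eq_iff)
    then show False using that by (metis lookup_single_eq lookup_zero)
  qed
  then have "0 \<notin> (mpol_scalars :: ('v, 'r) mpol set)" unfolding mpol_scalars_def by fastforce
  moreover have "1 \<in> (mpol_scalars :: ('v, 'r) mpol set)"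
    unfolding mpol_scalars_def by (rule image_eqI[of _ _ 1]) (simp_all only: h(3), simp)
  moreover have "x * y \<in> mpol_scalars"
    if xy: "x \<in> mpol_scalars" "y \<in> mpol_scalars" for x y :: "('v, 'r) mpol"
  proof -
    from xy obtain r s where "x = of_pm (pm_const r)" "y = of_pm (pm_const s)" "r \<noteq> 0" "s \<noteq> 0"
      by (auto simp: mpol_scalars_def)
    then show ?thesis unfolding mpol_scalars_def by (intro image_eqI[of _ _ "r * s"]) (simp_all only: h(2), simp)
  qed
  ultimately show ?thesis unfolding scalar_set_def by blast
qed

text \<open>The degrees being distinct, only one summand reaches the top degree, and nothing cancels
  there.\<close>

lemma lead_coeff_sum_monic:
  fixes q :: "'i \<Rightarrow> 'b::idom poly"
  assumes F: "finite F" "F \<noteq> {}" and inj: "inj_on (\<lambda>i. degree (q i)) F"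
    and monic: "\<And>i. i \<in> F \<Longrightarrow> lead_coeff (q i) = 1" and c: "\<And>i. i \<in> F \<Longrightarrow> c i \<noteq> 0"
  shows "\<exists>i\<in>F. lead_coeff (\<Sum>i\<in>F. [:c i:] * q i) = c i"
proof -
  let ?N = "Max ((\<lambda>i. degree (q i)) ` F)"
  have "?N \<in> (\<lambda>i. degree (q i)) ` F" by (rule Max_in) (use F in auto)
  then obtain i where i: "i \<in> F" "degree (q i) = ?N" by (metis imageE)
  have le: "degree (q j) \<le> ?N" if "j \<in> F" for j using that F by simp
  have "coeff (\<Sum>j\<in>F. [:c j:] * q j) ?N = (\<Sum>j\<in>F. if j = i then c j else 0)"
    unfolding coeff_sum
  proof (rule sum.cong[OF refl])
    fix j assume j: "j \<in> F"
    show "coeff ([:c j:] * q j) ?N = (if j = i then c j else 0)"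
    proof (cases "j = i")
      case True
      then show ?thesis using monic[OF i(1)] i(2) by simp
    next
      case False
      then have "degree (q j) \<noteq> degree (q i)" using inj i(1) j by (auto simp: inj_on_def)
      with le[OF j] i(2) have "degree (q j) < ?N" by simp
      then show ?thesis using False by (simp add: coeff_eq_0)
    qed
  qed
  also have "\<dots> = c i" using F(1) i(1) by simp
  finally have coeff: "coeff (\<Sum>j\<in>F. [:c j:] * q j) ?N = c i" .
  have "degree (\<Sum>j\<in>F. [:c j:] * q j) \<le> ?N"
    using le c by (intro degree_sum_le F(1)) simp
  moreover have "?N \<le> degree (\<Sum>j\<in>F. [:c j:] * q j)"
    using coeff c[OF i(1)] by (intro le_degree) simp
  ultimately have "degree (\<Sum>j\<in>F. [:c j:] * q j) = ?N" by (rule antisym)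
  with coeff i(1) show ?thesis by auto
qed

text \<open>The substitution \<open>X\<^sub>v \<mapsto> X\<^sub>v + s T\<^sup>w\<close> with w the
  weight of v; s = 1 and s = -1 give mutually inverse shifts.\<close>

definition mpol_shift :: "('v \<Rightarrow> nat) \<Rightarrow> 'r \<Rightarrow> ('v::finite, 'r::idom) mpol \<Rightarrow> ('v, 'r) mpol poly" where
  "mpol_shift w s b = pm_eval (\<lambda>r. [:of_pm (pm_const r):])
     (\<lambda>v. [:of_pm (pm_var v):] + monom (of_pm (pm_const s)) (w v)) (to_pm b)"

lemma ring_hom_fun_mpol_const:
  "ring_hom_fun (\<lambda>r. [:of_pm (pm_const r) :: ('v::finite, 'r::idom) mpol:])"
  by (intro ring_hom_fun_comp[OF ring_hom_fun_const_poly] ring_hom_fun_comp[OF ring_hom_fun_of_pm]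
      ring_hom_fun_pm_const)

lemma ring_hom_fun_mpol_shift: "ring_hom_fun (mpol_shift w s)"
  unfolding mpol_shift_def
  by (intro ring_hom_fun_comp[OF ring_hom_fun_pm_eval] ring_hom_fun_to_pm ring_hom_fun_mpol_const)

lemma mpol_shift_const: "mpol_shift w s (of_pm (pm_const r)) = [:of_pm (pm_const r):]"
  by (simp add: mpol_shift_def pm_eval_const[OF ring_hom_fun_mpol_const])

lemma mpol_shift_var: "mpol_shift w s (of_pm (pm_var v)) = [:of_pm (pm_var v):] + monom (of_pm (pm_const s)) (w v)"
  by (simp add: mpol_shift_def pm_eval_var[OF ring_hom_fun_mpol_const])

lemma mpol_hom_eqI:
  fixes b :: "('v::finite, 'r::idom) mpol"
  assumes "ring_hom_fun g" "ring_hom_fun g'"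
    "\<And>r. g (of_pm (pm_const r)) = g' (of_pm (pm_const r))"
    "\<And>v. g (of_pm (pm_var v)) = g' (of_pm (pm_var v))"
  shows "g b = g' b"
  using pm_hom_eqI[OF ring_hom_fun_comp[OF assms(1) ring_hom_fun_of_pm]
      ring_hom_fun_comp[OF assms(2) ring_hom_fun_of_pm] assms(3,4), of "to_pm b"] by simp

lemma mpol_shift_inverse:
  "poly (map_poly (mpol_shift w (- s)) (mpol_shift w s b)) [:0, 1:] = [:b:]"
proof (rule mpol_hom_eqI[where b = b])
  show "ring_hom_fun (\<lambda>b. poly (map_poly (mpol_shift w (- s)) (mpol_shift w s b)) [:0, 1:])"
    by (intro ring_hom_fun_comp[OF ring_hom_fun_poly] ring_hom_fun_comp[OF ring_hom_fun_map_poly]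
        ring_hom_fun_mpol_shift)
  note h = ring_hom_fun_mpol_shift[of w "- s"]
  show "poly (map_poly (mpol_shift w (- s)) (mpol_shift w s (of_pm (pm_const r)))) [:0, 1:]
      = [:of_pm (pm_const r):]" for r
    by (simp add: mpol_shift_const map_poly_hom_pCons[OF h])
  show "poly (map_poly (mpol_shift w (- s)) (mpol_shift w s (of_pm (pm_var v)))) [:0, 1:]
      = [:of_pm (pm_var v):]" for v
    by (simp add: mpol_shift_const mpol_shift_var map_poly_hom_pCons[OF h] map_poly_hom_add[OF h]
        map_poly_monom ring_hom_funD(4)[OF h] poly_monom single_uminus
        ring_hom_funD(5)[OF ring_hom_fun_of_pm]) (simp add: monom_altdef)
qed (rule ring_hom_fun_const_poly)

lemma poly_mpol_shift_0:
  assumes "\<And>v. w v > 0"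
  shows "poly (mpol_shift w s b) 0 = b"
proof (rule mpol_hom_eqI[where b = b])
  show "ring_hom_fun (\<lambda>b. poly (mpol_shift w s b) 0)"
    by (intro ring_hom_fun_comp[OF ring_hom_fun_poly] ring_hom_fun_mpol_shift)
  show "poly (mpol_shift w s (of_pm (pm_var v))) 0 = of_pm (pm_var v)" for v
    using assms[of v] by (simp add: mpol_shift_var poly_monom)
qed (simp_all add: mpol_shift_const ring_hom_fun_id)

text \<open>A monomial \<open>X\<^sup>\<mu>\<close> turns into a monic polynomial in T of degree
  \<open>weight w \<mu>\<close>. Separated weights therefore make the leading coefficient in T one
  of the coefficients of b.\<close>

lemma lead_coeff_mpol_shift:
  fixes b :: "('v::finite, 'r::idom) mpol"
  assumes w: "\<And>v. w v > 0" and inj: "inj_on (weight w) (Poly_Mapping.keys (to_pm b))" and b: "b \<noteq> 0"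
  shows "lead_coeff (mpol_shift w 1 b) \<in> mpol_scalars"
proof -
  let ?y = "\<lambda>v. [:of_pm (pm_var v):] + monom (1 :: ('v, 'r) mpol) (w v)"
  have y: "degree (?y v) = w v" "lead_coeff (?y v) = 1" for v
  proof -
    have "degree (?y v) = degree (monom (1 :: ('v, 'r) mpol) (w v))"
      using w[of v] by (intro degree_add_eq_right) (simp add: degree_monom_eq)
    then show "degree (?y v) = w v" by (simp add: degree_monom_eq)
    then show "lead_coeff (?y v) = 1" using w[of v] by (simp add: coeff_pCons split: nat.split)
  qed
  have y0: "?y v \<noteq> 0" for v using y(2)[of v] by (metis coeff_0 zero_neq_one)
  have deg: "degree (pm_monom ?y \<mu>) = weight w \<mu>" for \<mu>
    unfolding pm_monom_superset[OF finite subset_UNIV] weight_def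
    using y0 by (subst degree_prod_eq_sum_degree) (auto simp: degree_power_eq y(1) mult.commute)
  have lead: "lead_coeff (pm_monom ?y \<mu>) = 1" for \<mu>
    unfolding pm_monom_superset[OF finite subset_UNIV]
    by (simp only: lead_coeff_prod lead_coeff_power y(2)) simp
  have one: "of_pm (pm_const 1) = (1 :: ('v, 'r) mpol)"
    by (simp add: ring_hom_funD(3)[OF ring_hom_fun_of_pm])
  have "to_pm b \<noteq> 0" using b by (metis of_pm_to_pm ring_hom_funD(4)[OF ring_hom_fun_of_pm])
  then have ne: "Poly_Mapping.keys (to_pm b) \<noteq> {}" by simp
  have nz: "of_pm (pm_const (Poly_Mapping.lookup (to_pm b) \<mu>)) \<in> mpol_scalars"
    if "\<mu> \<in> Poly_Mapping.keys (to_pm b)" for \<mu>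
    using that by (auto simp: mpol_scalars_def in_keys_iff)
  have "\<exists>\<mu>\<in>Poly_Mapping.keys (to_pm b). lead_coeff (mpol_shift w 1 b)
      = of_pm (pm_const (Poly_Mapping.lookup (to_pm b) \<mu>))"
    unfolding mpol_shift_def pm_eval_def one
  proof (rule lead_coeff_sum_monic)
    show "inj_on (\<lambda>\<mu>. degree (pm_monom ?y \<mu>)) (Poly_Mapping.keys (to_pm b))"
      unfolding deg by (rule inj)
    show "of_pm (pm_const (Poly_Mapping.lookup (to_pm b) \<mu>)) \<noteq> (0 :: ('v, 'r) mpol)"
      if "\<mu> \<in> Poly_Mapping.keys (to_pm b)" for \<mu>
      using nz[OF that] scalar_set_mpol_scalars[where ?'v = 'v and ?'r = 'r]
      by (auto simp: scalar_set_def)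
  qed (use ne lead in auto)
  with nz show ?thesis by metis
qed

lemma has_shifts_mpol: "has_shifts (mpol_scalars :: ('v::finite, 'r::idom) mpol set)"
  unfolding has_shifts_def
proof (intro allI impI)
  fix x :: "('v, 'r) mpol" assume x: "x \<noteq> 0"
  obtain w :: "'v \<Rightarrow> nat" where w: "\<And>v. w v > 0" "inj_on (weight w) (Poly_Mapping.keys (to_pm x))"
    using exists_separating_weight[OF finite_keys] by blast
  have "shift_pair mpol_scalars (mpol_shift w 1) (mpol_shift w (- 1) :: ('v, 'r) mpol \<Rightarrow> _)"
    unfolding shift_pair_def
    using mpol_shift_inverse[of w 1] mpol_shift_inverse[of w "- 1"]
    by (auto simp: ring_hom_fun_mpol_shift poly_mpol_shift_0[OF w(1)] mpol_scalars_def mpol_shift_const)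
  with lead_coeff_mpol_shift[OF w x]
  show "\<exists>\<sigma> \<tau>. shift_pair mpol_scalars \<sigma> \<tau> \<and> lead_coeff (\<sigma> x) \<in> mpol_scalars" by blast
qed

section \<open>Exponential maps transported along a ring isomorphism\<close>

lemma exp_map_transfer:
  fixes \<phi> :: "'a::comm_ring_1 \<Rightarrow> 'a poly" and \<beta> :: "'a \<Rightarrow> 'b::comm_ring_1"
  assumes \<phi>: "exp_map C \<phi>" and \<beta>: "ring_hom_fun \<beta>" and \<gamma>: "ring_hom_fun \<gamma>"
    and \<beta>\<gamma>: "\<And>b. \<beta> (\<gamma> b) = b" and \<gamma>\<beta>: "\<And>a. \<gamma> (\<beta> a) = a"
  shows "exp_map {} (\<lambda>b. map_poly \<beta> (\<phi> (\<gamma> b)))"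
  unfolding exp_map_def
proof (intro conjI allI)
  note hom = exp_mapD(1)[OF \<phi>]
  note B = ring_hom_fun_map_poly[OF \<beta>]
  let ?\<phi> = "\<lambda>b. map_poly \<beta> (\<phi> (\<gamma> b))"
  show "ring_hom_fun ?\<phi>" by (intro ring_hom_fun_comp[OF B] ring_hom_fun_comp[OF hom] \<gamma>)
  show "poly (?\<phi> b) 0 = b" for b
    using poly_map_poly_hom[OF \<beta>, of "\<phi> (\<gamma> b)" 0] exp_mapD(2)[OF \<phi>]
    by (simp add: ring_hom_funD[OF \<beta>] \<beta>\<gamma>)
  show "map_poly ?\<phi> (?\<phi> b) = pcompose (map_poly (\<lambda>c. [:c:]) (?\<phi> b)) [:[:0, 1:], 1:]" for b
  proof -
    let ?p = "\<phi> (\<gamma> b)"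
    have "map_poly ?\<phi> (map_poly \<beta> ?p) = map_poly (map_poly \<beta>) (map_poly \<phi> ?p)"
      by (rule poly_eqI) (simp add: coeff_map_poly ring_hom_funD[OF \<beta>] ring_hom_funD[OF hom]
          ring_hom_funD[OF \<gamma>] \<gamma>\<beta>)
    also have "\<dots> = pcompose (map_poly (map_poly \<beta>) (map_poly (\<lambda>c. [:c:]) ?p))
        (map_poly (map_poly \<beta>) [:[:0, 1:], 1:])"
      unfolding exp_mapD(4)[OF \<phi>] by (rule map_poly_hom_pcompose[OF B])
    also have "map_poly (map_poly \<beta>) [:[:0, 1:], 1:] = [:[:0, 1:], 1:]"
      by (simp add: map_poly_hom_pCons[OF B] map_poly_hom_pCons[OF \<beta>] ring_hom_funD[OF \<beta>])
    also have "map_poly (map_poly \<beta>) (map_poly (\<lambda>c. [:c:]) ?p) = map_poly (\<lambda>c. [:c:]) (map_poly \<beta> ?p)"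
      by (rule poly_eqI) (simp add: coeff_map_poly ring_hom_funD[OF \<beta>] map_poly_hom_pCons[OF \<beta>])
    finally show ?thesis .
  qed
qed simp

context
  fixes \<phi> :: "(('v::finite \<Rightarrow>\<^sub>0 nat) \<Rightarrow>\<^sub>0 'r::idom) \<Rightarrow> (('v \<Rightarrow>\<^sub>0 nat) \<Rightarrow>\<^sub>0 'r) poly" and C
  assumes \<phi>: "exp_map C \<phi>"
begin

definition mpol_exp :: "('v, 'r) mpol \<Rightarrow> ('v, 'r) mpol poly" where
  "mpol_exp b = map_poly of_pm (\<phi> (to_pm b))"

lemma exp_map_mpol_exp: "exp_map {} mpol_exp"
  using exp_map_transfer[OF \<phi> ring_hom_fun_of_pm ring_hom_fun_to_pm] by (simp add: mpol_exp_def[abs_def])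

lemma degree_mpol_exp: "degree (mpol_exp b) = degree (\<phi> (to_pm b))"
proof -
  have "of_pm a \<noteq> (0 :: ('v, 'r) mpol)" if "a \<noteq> 0" for a
    using that by (metis of_pm_eq_iff ring_hom_funD(4)[OF ring_hom_fun_of_pm])
  then show ?thesis by (simp add: mpol_exp_def degree_map_poly)
qed

lemma pm_degree_exp_map_mult:
  assumes "a \<noteq> 0" "b \<noteq> 0"
  shows "degree (\<phi> (a * b)) = degree (\<phi> a) + degree (\<phi> b)"
proof -
  note h = ring_hom_funD[OF ring_hom_fun_of_pm[where ?'v = 'v and ?'r = 'r]]
  have "of_pm a \<noteq> (0 :: ('v, 'r) mpol)" "of_pm b \<noteq> (0 :: ('v, 'r) mpol)"
    using assms by (metis of_pm_eq_iff h(4))+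
  from degree_exp_map_mult[OF exp_map_mpol_exp this]
  show ?thesis by (simp add: degree_mpol_exp flip: h(2))
qed

lemma pm_retract_kernel_generator:
  assumes nontriv: "\<phi> \<noteq> (\<lambda>b. [:b:])" and const: "\<And>r. pm_const r \<in> invariants \<phi>"
    and \<pi>: "ring_hom_fun \<pi>" "\<pi> \<circ> \<pi> = \<pi>" "range \<pi> = invariants \<phi>"
  obtains f where "\<pi> f = 0" "f \<noteq> 0"
    "\<And>p. \<pi> p = 0 \<Longrightarrow> \<exists>r g. r \<noteq> 0 \<and> pm_const r * p = f * g"
proof -
  note h = ring_hom_funD[OF ring_hom_fun_of_pm[where ?'v = 'v and ?'r = 'r]]
  have inv: "b \<in> invariants mpol_exp \<longleftrightarrow> to_pm b \<in> invariants \<phi>" for b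
    by (simp add: invariants_iff_degree[OF exp_map_mpol_exp] invariants_iff_degree[OF \<phi>] degree_mpol_exp)
  define \<pi>' where "\<pi>' b = of_pm (\<pi> (to_pm b))" for b :: "('v, 'r) mpol"
  have \<pi>'0: "\<pi>' b = 0 \<longleftrightarrow> \<pi> (to_pm b) = 0" for b
    unfolding \<pi>'_def by (metis of_pm_eq_iff h(4))
  obtain b where "b \<notin> invariants \<phi>" using nontriv by (auto simp: invariants_def)
  then have "of_pm b \<notin> invariants mpol_exp" by (simp add: inv)
  then have nontriv': "mpol_exp \<noteq> (\<lambda>b. [:b:])" by (auto simp: invariants_def)
  have "\<exists>f. \<pi>' f = 0 \<and> f \<noteq> 0 \<and> (\<forall>p. \<pi>' p = 0 \<longrightarrow> dvd_upto mpol_scalars f p)"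
  proof (rule retract_kernel_generator[OF scalar_set_mpol_scalars has_shifts_mpol _ exp_map_mpol_exp nontriv'])
    show "mpol_scalars \<subseteq> invariants mpol_exp" using const by (auto simp: mpol_scalars_def inv)
    show "ring_hom_fun \<pi>'"
      unfolding \<pi>'_def
      by (intro ring_hom_fun_comp[OF ring_hom_fun_of_pm] ring_hom_fun_comp[OF \<pi>(1)] ring_hom_fun_to_pm)
    show "\<pi>' \<circ> \<pi>' = \<pi>'" using \<pi>(2) by (simp add: fun_eq_iff \<pi>'_def)
    show "range \<pi>' = invariants mpol_exp"
    proof (intro set_eqI iffI)
      fix b assume "b \<in> range \<pi>'"
      then show "b \<in> invariants mpol_exp" using \<pi>(3) by (auto simp: inv \<pi>'_def)
    next
      fix b assume "b \<in> invariants mpol_exp"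
      then obtain a where "to_pm b = \<pi> a" using \<pi>(3) by (auto simp: inv)
      then have "b = \<pi>' (of_pm a)" by (simp add: \<pi>'_def flip: \<open>to_pm b = \<pi> a\<close>)
      then show "b \<in> range \<pi>'" by blast
    qed
  qed
  then obtain f where f: "\<pi>' f = 0" "f \<noteq> 0" "\<And>p. \<pi>' p = 0 \<Longrightarrow> dvd_upto mpol_scalars f p" by blast
  show ?thesis
  proof (rule that[of "to_pm f"])
    show "\<pi> (to_pm f) = 0" using f(1) \<pi>'0 by simp
    show "to_pm f \<noteq> 0" using f(2) by (metis of_pm_to_pm h(4))
    fix p assume "\<pi> p = 0"
    then have "dvd_upto mpol_scalars f (of_pm p)" by (intro f(3)) (simp add: \<pi>'0)
    then obtain k z where "k \<in> mpol_scalars" "k * of_pm p = f * z" by (rule dvd_uptoE)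
    then obtain r where r: "r \<noteq> 0" "of_pm (pm_const r) * of_pm p = f * z" by (auto simp: mpol_scalars_def)
    have "of_pm (pm_const r * p) = of_pm (to_pm f * to_pm z)" using r(2) by (simp add: h(2))
    then have "pm_const r * p = to_pm f * to_pm z" by simp
    with r(1) show "\<exists>r g. r \<noteq> 0 \<and> pm_const r * p = to_pm f * g" by blast
  qed
qed

end

subsection \<open>Symmetric algebras\<close>

definition subring :: "'b::comm_ring_1 set \<Rightarrow> bool" where
  "subring A \<longleftrightarrow> 1 \<in> A \<and> (\<forall>x\<in>A. \<forall>y\<in>A. x + y \<in> A \<and> x * y \<in> A \<and> - x \<in> A)"

definition ideal_of :: "'b::comm_ring_1 set \<Rightarrow> 'b set \<Rightarrow> bool" where
  "ideal_of A M \<longleftrightarrow> (\<forall>m\<in>M. \<forall>m'\<in>M. m + m' \<in> M) \<and> (\<forall>a\<in>A. \<forall>m\<in>M. a * m \<in> M) \<and> M \<subseteq> A"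

lemma ideal_ofD:
  assumes "ideal_of A M"
  shows "m \<in> M \<Longrightarrow> m' \<in> M \<Longrightarrow> m + m' \<in> M" "a \<in> A \<Longrightarrow> m \<in> M \<Longrightarrow> a * m \<in> M" "M \<subseteq> A"
  using assms by (simp_all add: ideal_of_def)

text \<open>The condition on \<psi> inside \<open>iso_sym_alg\<close>, named so that a witness can
  be fixed.\<close>

definition sym_presentation :: "'b::comm_ring_1 set \<Rightarrow> 'b set \<Rightarrow> ((('b \<Rightarrow>\<^sub>0 nat) \<Rightarrow>\<^sub>0 'b) \<Rightarrow> 'b) \<Rightarrow> bool" where
  "sym_presentation A M \<psi> \<longleftrightarrow>
     (\<forall>p\<in>sym_pre A M. \<forall>q\<in>sym_pre A M. \<psi> (p + q) = \<psi> p + \<psi> q \<and> \<psi> (p * q) = \<psi> p * \<psi> q)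
   \<and> (\<forall>a\<in>A. \<psi> (Poly_Mapping.single 0 a) = a)
   \<and> \<psi> ` sym_pre A M = UNIV
   \<and> {p \<in> sym_pre A M. \<psi> p = 0} = fin_comb (sym_pre A M) (sym_rel A M)"

lemma subringD:
  assumes "subring A"
  shows "1 \<in> A" "0 \<in> A" "x \<in> A \<Longrightarrow> y \<in> A \<Longrightarrow> x + y \<in> A" "x \<in> A \<Longrightarrow> y \<in> A \<Longrightarrow> x * y \<in> A"
    "x \<in> A \<Longrightarrow> - x \<in> A" "x \<in> A \<Longrightarrow> x ^ n \<in> A" "(\<And>i. i \<in> F \<Longrightarrow> g i \<in> A) \<Longrightarrow> sum g F \<in> A"
proof -
  show 1: "1 \<in> A" using assms by (simp add: subring_def)
  show add: "x + y \<in> A" if "x \<in> A" "y \<in> A" for x y using assms that by (simp add: subring_def)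
  show mult: "x * y \<in> A" if "x \<in> A" "y \<in> A" for x y using assms that by (simp add: subring_def)
  show uminus: "- x \<in> A" if "x \<in> A" for x using assms that 1 by (auto simp: subring_def)
  show 0: "0 \<in> A" using add[OF 1 uminus[OF 1]] by simp
  show "x ^ n \<in> A" if "x \<in> A" for x using that by (induction n) (auto intro: 1 mult)
  show "(\<And>i. i \<in> F \<Longrightarrow> g i \<in> A) \<Longrightarrow> sum g F \<in> A"
    by (induction F rule: infinite_finite_induct) (auto intro: 0 add)
qed

context
  fixes A M :: "'b::comm_ring_1 set"
  assumes A: "subring A"
begin

lemma sym_pre_single: "a \<in> A \<Longrightarrow> Poly_Mapping.keys \<mu> \<subseteq> M \<Longrightarrow> Poly_Mapping.single \<mu> a \<in> sym_pre A M"
  using subringD(2)[OF A] by (auto simp: sym_pre_def lookup_single when_def)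

lemma sym_pre_const: "a \<in> A \<Longrightarrow> pm_const a \<in> sym_pre A M"
  by (rule sym_pre_single) simp_all

lemma sym_pre_var: "m \<in> M \<Longrightarrow> sym_var m \<in> sym_pre A M"
  unfolding sym_var_def using subringD(1)[OF A] by (intro sym_pre_single) auto

lemma sym_pre_add: "p \<in> sym_pre A M \<Longrightarrow> q \<in> sym_pre A M \<Longrightarrow> p + q \<in> sym_pre A M"
  unfolding sym_pre_def lookup_add mem_Collect_eq using subringD(3)[OF A] by (metis add.right_neutral)

lemma sym_pre_uminus: "p \<in> sym_pre A M \<Longrightarrow> - p \<in> sym_pre A M"
  unfolding sym_pre_def using subringD(5)[OF A] by simp

lemma sym_pre_diff: "p \<in> sym_pre A M \<Longrightarrow> q \<in> sym_pre A M \<Longrightarrow> p - q \<in> sym_pre A M"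
  using sym_pre_add[OF _ sym_pre_uminus] by fastforce

lemma sym_pre_sum: "(\<And>i. i \<in> F \<Longrightarrow> g i \<in> sym_pre A M) \<Longrightarrow> sum g F \<in> sym_pre A M"
proof (induction F rule: infinite_finite_induct)
  case empty
  then show ?case using sym_pre_const[OF subringD(2)[OF A]] by simp
next
  case (infinite F)
  then show ?case using sym_pre_const[OF subringD(2)[OF A]] by simp
qed (auto intro: sym_pre_add)

lemma sym_pre_mult:
  assumes p: "p \<in> sym_pre A M" and q: "q \<in> sym_pre A M"
  shows "p * q \<in> sym_pre A M"
proof -
  have "p * q = (\<Sum>\<mu>\<in>Poly_Mapping.keys p. \<Sum>\<nu>\<in>Poly_Mapping.keys q.
      Poly_Mapping.single (\<mu> + \<nu>) (Poly_Mapping.lookup p \<mu> * Poly_Mapping.lookup q \<nu>))"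
    by (subst (1 2) pm_sum_single[symmetric]) (simp add: sum_product mult_single)
  also have "\<dots> \<in> sym_pre A M"
  proof (intro sym_pre_sum sym_pre_single)
    fix \<mu> \<nu> assume \<mu>: "\<mu> \<in> Poly_Mapping.keys p" and \<nu>: "\<nu> \<in> Poly_Mapping.keys q"
    then show "Poly_Mapping.lookup p \<mu> * Poly_Mapping.lookup q \<nu> \<in> A"
      using p q subringD(4)[OF A] by (simp add: sym_pre_def)
    have "Poly_Mapping.keys \<mu> \<subseteq> M" "Poly_Mapping.keys \<nu> \<subseteq> M"
      using p q \<mu> \<nu> by (simp_all add: sym_pre_def in_keys_iff)
    then show "Poly_Mapping.keys (\<mu> + \<nu>) \<subseteq> M" using Poly_Mapping.keys_add[of \<mu> \<nu>] by auto
  qed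
  finally show ?thesis .
qed

lemma sym_pre_induct [consumes 1, case_names const add var_mult]:
  assumes q: "q \<in> sym_pre A M"
    and const: "\<And>a. a \<in> A \<Longrightarrow> P (pm_const a)"
    and add: "\<And>p q. p \<in> sym_pre A M \<Longrightarrow> q \<in> sym_pre A M \<Longrightarrow> P p \<Longrightarrow> P q \<Longrightarrow> P (p + q)"
    and var_mult: "\<And>m q. m \<in> M \<Longrightarrow> q \<in> sym_pre A M \<Longrightarrow> P q \<Longrightarrow> P (sym_var m * q)"
  shows "P q"
proof -
  define Q where "Q p \<longleftrightarrow> p \<in> sym_pre A M \<and> P p" for p
  have Q_var: "Q (sym_var m * p)" if "m \<in> M" "Q p" for m p
    using that var_mult sym_pre_mult[OF sym_pre_var] by (simp add: Q_def)
  have Q_single: "Q (Poly_Mapping.single \<mu> a)" if a: "a \<in> A" and \<mu>: "Poly_Mapping.keys \<mu> \<subseteq> M" for \<mu> a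
  proof -
    have "Q (pm_const a * (\<Prod>m\<in>F. sym_var m ^ f m))" if "finite F" "F \<subseteq> M" for F f
      using that
    proof (induction F rule: finite_induct)
      case empty
      then show ?case using a const sym_pre_const by (simp add: Q_def)
    next
      case (insert m F)
      have "Q (sym_var m ^ k * (pm_const a * (\<Prod>m\<in>F. sym_var m ^ f m)))" for k
        using insert by (induction k) (auto simp: mult.assoc intro: Q_var)
      from this[of "f m"] insert.hyps show ?case by (simp add: mult.left_commute)
    qed
    from this[OF finite_keys \<mu>] show ?thesis
      by (simp add: pm_single_eq[of \<mu> a] pm_monom_def sym_var_eq_pm_var)
  qed
  have Q_sum: "Q (\<Sum>\<mu>\<in>F. Poly_Mapping.single \<mu> (Poly_Mapping.lookup q \<mu>))"
    if "finite F" "F \<subseteq> Poly_Mapping.keys q" for F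
    using that
  proof (induction F rule: finite_induct)
    case empty
    then show ?case using const[OF subringD(2)[OF A]] sym_pre_const[OF subringD(2)[OF A]] by (simp add: Q_def)
  next
    case (insert \<mu> F)
    then have "Q (Poly_Mapping.single \<mu> (Poly_Mapping.lookup q \<mu>))"
      using q by (intro Q_single) (auto simp: sym_pre_def in_keys_iff)
    with insert show ?case using add sym_pre_add by (auto simp: Q_def)
  qed
  from Q_sum[OF finite_keys subset_refl] show ?thesis by (simp add: pm_sum_single Q_def)
qed

context
  fixes \<psi> :: "(('b \<Rightarrow>\<^sub>0 nat) \<Rightarrow>\<^sub>0 'b) \<Rightarrow> 'b"
  assumes M: "ideal_of A M" and pres: "sym_presentation A M \<psi>"
begin

lemma sym_pres_hom:
  "p \<in> sym_pre A M \<Longrightarrow> q \<in> sym_pre A M \<Longrightarrow> \<psi> (p + q) = \<psi> p + \<psi> q"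
  "p \<in> sym_pre A M \<Longrightarrow> q \<in> sym_pre A M \<Longrightarrow> \<psi> (p * q) = \<psi> p * \<psi> q"
  "a \<in> A \<Longrightarrow> \<psi> (pm_const a) = a"
  "\<psi> ` sym_pre A M = UNIV"
  "{p \<in> sym_pre A M. \<psi> p = 0} = fin_comb (sym_pre A M) (sym_rel A M)"
  using pres by (simp_all add: sym_presentation_def)

lemma sym_pres_diff: "p \<in> sym_pre A M \<Longrightarrow> q \<in> sym_pre A M \<Longrightarrow> \<psi> (p - q) = \<psi> p - \<psi> q"
  using sym_pres_hom(1)[OF sym_pre_diff, of p q q] by (simp add: eq_diff_eq)

lemma sym_pres_surj: obtains q where "q \<in> sym_pre A M" "\<psi> q = b"
  using sym_pres_hom(4) by (metis UNIV_I imageE)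

lemma sym_pres_rel:
  assumes "r \<in> sym_rel A M"
  shows "\<psi> r = 0"
proof -
  have "pm_const 1 \<in> sym_pre A M" by (rule sym_pre_const[OF subringD(1)[OF A]])
  from fin_comb_mem[OF this assms] have "r \<in> {p \<in> sym_pre A M. \<psi> p = 0}" unfolding sym_pres_hom(5) by simp
  then show ?thesis by simp
qed

lemma sym_pres_var_add:
  assumes "m \<in> M" "m' \<in> M"
  shows "\<psi> (sym_var (m + m')) = \<psi> (sym_var m) + \<psi> (sym_var m')"
proof -
  have "sym_var (m + m') - sym_var m - sym_var m' \<in> sym_rel A M" using assms by (auto simp: sym_rel_def)
  from sym_pres_rel[OF this] have "\<psi> (sym_var (m + m')) - \<psi> (sym_var m) - \<psi> (sym_var m') = 0"
    using assms ideal_ofD(1)[OF M] by (simp add: sym_pres_diff sym_pre_diff sym_pre_var)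
  then show ?thesis by (simp add: algebra_simps)
qed

lemma sym_pres_var_mult:
  assumes "a \<in> A" "m \<in> M"
  shows "\<psi> (sym_var (a * m)) = a * \<psi> (sym_var m)"
proof -
  have "sym_var (a * m) - pm_const a * sym_var m \<in> sym_rel A M" using assms by (auto simp: sym_rel_def)
  from sym_pres_rel[OF this] show ?thesis
    using assms ideal_ofD(2)[OF M] by (simp add: sym_pres_diff sym_pre_var sym_pre_mult sym_pre_const sym_pres_hom(2,3))
qed

lemma sym_pres_induct [case_names scalar add var_mult]:
  assumes "\<And>a. a \<in> A \<Longrightarrow> P a" "\<And>x y. P x \<Longrightarrow> P y \<Longrightarrow> P (x + y)"
    and "\<And>m x. m \<in> M \<Longrightarrow> P x \<Longrightarrow> P (\<psi> (sym_var m) * x)"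
  shows "P b"
proof -
  obtain q where q: "q \<in> sym_pre A M" "\<psi> q = b" by (rule sym_pres_surj)
  from q(1) have "P (\<psi> q)"
    by (induction rule: sym_pre_induct) (auto simp: sym_pres_hom(1,2,3) sym_pre_var intro: assms)
  with q(2) show ?thesis by simp
qed

text \<open>The universal property of the symmetric algebra. Two preimages of an element differ by
  an element of the kernel of \<psi>, a combination of the relations, which \<Phi> kills; so the
  value at any preimage may be taken.\<close>

lemma sym_pres_lift:
  fixes \<Phi> :: "(('b \<Rightarrow>\<^sub>0 nat) \<Rightarrow>\<^sub>0 'b) \<Rightarrow> 'c::comm_ring_1"
  assumes \<Phi>: "ring_hom_fun \<Phi>" and rel: "\<And>r. r \<in> sym_rel A M \<Longrightarrow> \<Phi> r = 0"
  obtains g where "ring_hom_fun g" "\<And>q. q \<in> sym_pre A M \<Longrightarrow> g (\<psi> q) = \<Phi> q"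
proof -
  note h = ring_hom_funD[OF \<Phi>]
  have wd: "\<Phi> p = \<Phi> q" if "p \<in> sym_pre A M" "q \<in> sym_pre A M" "\<psi> p = \<psi> q" for p q
  proof -
    have "p - q \<in> {p \<in> sym_pre A M. \<psi> p = 0}" using that by (simp add: sym_pres_diff sym_pre_diff)
    then have "p - q \<in> fin_comb (sym_pre A M) (sym_rel A M)" by (simp only: sym_pres_hom(5))
    then have "\<Phi> (p - q) = 0" by (induction rule: fin_comb_induct) (simp_all add: h rel)
    then show ?thesis by (simp add: h)
  qed
  define g where "g b = \<Phi> (SOME q. q \<in> sym_pre A M \<and> \<psi> q = b)" for b
  have g: "g (\<psi> q) = \<Phi> q" if q: "q \<in> sym_pre A M" for q
  proof -
    have "(SOME q'. q' \<in> sym_pre A M \<and> \<psi> q' = \<psi> q) \<in> sym_pre A M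
        \<and> \<psi> (SOME q'. q' \<in> sym_pre A M \<and> \<psi> q' = \<psi> q) = \<psi> q"
      by (rule someI[of _ q]) (simp add: q)
    then show ?thesis unfolding g_def by (intro wd q) auto
  qed
  have "ring_hom_fun g"
  proof (rule ring_hom_funI)
    fix x y
    obtain p where p: "p \<in> sym_pre A M" "\<psi> p = x" by (rule sym_pres_surj)
    obtain q where q: "q \<in> sym_pre A M" "\<psi> q = y" by (rule sym_pres_surj)
    show "g (x + y) = g x + g y"
      using g[OF sym_pre_add[OF p(1) q(1)]] g[OF p(1)] g[OF q(1)] p q by (simp add: sym_pres_hom(1) h)
    show "g (x * y) = g x * g y"
      using g[OF sym_pre_mult[OF p(1) q(1)]] g[OF p(1)] g[OF q(1)] p q by (simp add: sym_pres_hom(2) h)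
  next
    show "g 1 = 1"
      using g[OF sym_pre_const[OF subringD(1)[OF A]]] sym_pres_hom(3)[OF subringD(1)[OF A]] by (simp add: h)
  qed
  with g show ?thesis using that by blast
qed

lemma sym_pres_hom_eqI:
  assumes g: "ring_hom_fun g" and g': "ring_hom_fun g'"
    and "\<And>a. a \<in> A \<Longrightarrow> g a = g' a" "\<And>m. m \<in> M \<Longrightarrow> g (\<psi> (sym_var m)) = g' (\<psi> (sym_var m))"
  shows "g b = g' b"
  by (induction b rule: sym_pres_induct) (simp_all add: assms ring_hom_funD[OF g] ring_hom_funD[OF g'])

section \<open>A retraction and an exponential map on a symmetric algebra\<close>

lemma sym_pres_retraction:
  obtains \<pi> where "ring_hom_fun \<pi>" "\<And>a. a \<in> A \<Longrightarrow> \<pi> a = a" "range \<pi> = A"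
proof -
  let ?\<Phi> = "pm_eval (\<lambda>a. a) (\<lambda>_. 0) :: (('b \<Rightarrow>\<^sub>0 nat) \<Rightarrow>\<^sub>0 'b) \<Rightarrow> 'b"
  note \<Phi> = ring_hom_fun_pm_eval[OF ring_hom_fun_id, of "\<lambda>_. 0"]
  have var: "?\<Phi> (sym_var m) = 0" for m
    by (simp add: sym_var_eq_pm_var pm_eval_var[OF ring_hom_fun_id])
  have rel: "?\<Phi> r = 0" if "r \<in> sym_rel A M" for r
    using that by (auto simp: sym_rel_def var ring_hom_funD[OF \<Phi>])
  obtain \<pi> where \<pi>: "ring_hom_fun \<pi>" "\<And>q. q \<in> sym_pre A M \<Longrightarrow> \<pi> (\<psi> q) = ?\<Phi> q"
    using sym_pres_lift[OF \<Phi> rel] by blast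
  have fix_A: "\<pi> a = a" if a: "a \<in> A" for a
    using \<pi>(2)[OF sym_pre_const[OF a]] a by (simp add: sym_pres_hom(3) pm_eval_const[OF ring_hom_fun_id])
  have "\<pi> b \<in> A" for b
  proof (induction b rule: sym_pres_induct)
    case (var_mult m x)
    then show ?case
      using \<pi>(2)[OF sym_pre_var[of m]] subringD(2)[OF A] by (simp add: var ring_hom_funD[OF \<pi>(1)])
  qed (simp_all add: fix_A ring_hom_funD[OF \<pi>(1)] subringD(3)[OF A])
  then have "range \<pi> = A" using fix_A by (metis (no_types, opaque_lifting) image_subset_iff rangeI subsetI subset_antisym)
  with \<pi>(1) fix_A show ?thesis using that by blast
qed

lemma sym_pres_exp_map:
  obtains \<phi> where "exp_map A \<phi>" "\<And>m. m \<in> M \<Longrightarrow> \<phi> (\<psi> (sym_var m)) = [:\<psi> (sym_var m), m:]"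
proof -
  let ?\<Phi> = "pm_eval (\<lambda>a. [:a:]) (\<lambda>m. [:\<psi> (sym_var m), m:])"
  note \<Phi> = ring_hom_fun_pm_eval[OF ring_hom_fun_const_poly, of "\<lambda>m. [:\<psi> (sym_var m), m:]"]
  have var: "?\<Phi> (sym_var m) = [:\<psi> (sym_var m), m:]" for m
    by (simp add: sym_var_eq_pm_var pm_eval_var[OF ring_hom_fun_const_poly])
  have rel: "?\<Phi> r = 0" if "r \<in> sym_rel A M" for r
    using that by (auto simp: sym_rel_def var ring_hom_funD[OF \<Phi>] sym_pres_var_add sym_pres_var_mult
        pm_eval_const[OF ring_hom_fun_const_poly])
  obtain \<phi> where \<phi>: "ring_hom_fun \<phi>" "\<And>q. q \<in> sym_pre A M \<Longrightarrow> \<phi> (\<psi> q) = ?\<Phi> q"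
    using sym_pres_lift[OF \<Phi> rel] by blast
  have \<phi>A: "\<phi> a = [:a:]" if a: "a \<in> A" for a
    using \<phi>(2)[OF sym_pre_const[OF a]] a by (simp add: sym_pres_hom(3) pm_eval_const[OF ring_hom_fun_const_poly])
  have \<phi>var: "\<phi> (\<psi> (sym_var m)) = [:\<psi> (sym_var m), m:]" if m: "m \<in> M" for m
    using \<phi>(2)[OF sym_pre_var[OF m]] by (simp add: var)
  note hp = map_poly_hom_pCons[OF \<phi>(1)] map_poly_hom_pCons[OF ring_hom_fun_const_poly] ring_hom_funD(4)[OF \<phi>(1)]
  have "exp_map A \<phi>"
    unfolding exp_map_def
  proof (intro conjI ballI allI)
    show "poly (\<phi> b) 0 = b" for b
      by (rule sym_pres_hom_eqI[where b = b, OF ring_hom_fun_comp[OF ring_hom_fun_poly \<phi>(1)] ring_hom_fun_id])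
        (simp_all add: \<phi>A \<phi>var)
    show "map_poly \<phi> (\<phi> b) = pcompose (map_poly (\<lambda>c. [:c:]) (\<phi> b)) [:[:0, 1:], 1:]" for b
    proof (rule sym_pres_hom_eqI[where b = b])
      show "ring_hom_fun (\<lambda>b. map_poly \<phi> (\<phi> b))"
        by (intro ring_hom_fun_comp[OF ring_hom_fun_map_poly] \<phi>(1))
      show "ring_hom_fun (\<lambda>b. pcompose (map_poly (\<lambda>c. [:c:]) (\<phi> b)) [:[:0, 1:], 1:])"
        by (intro ring_hom_fun_comp[OF ring_hom_fun_pcompose] ring_hom_fun_comp[OF ring_hom_fun_map_poly]
            ring_hom_fun_const_poly \<phi>(1))
    next
      fix m assume m: "m \<in> M"
      \<comment> \<open>Since \<phi> fixes the slope m, both sides are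
        \<open>T\<^sub>m + m V + m U\<close>.\<close>
      then have "m \<in> A" using ideal_ofD(3)[OF M] by auto
      with m show "map_poly \<phi> (\<phi> (\<psi> (sym_var m)))
          = pcompose (map_poly (\<lambda>c. [:c:]) (\<phi> (\<psi> (sym_var m)))) [:[:0, 1:], 1:]"
        by (simp add: \<phi>var \<phi>A hp pcompose_pCons)
    qed (simp add: \<phi>A hp)
  qed (simp_all add: \<phi>(1) \<phi>A)
  with \<phi>var show ?thesis using that by blast
qed

end

end

text \<open>The coefficient is taken at \<open>degree p\<close> and not at the degree of the
  composite, which may be smaller if \<open>lead_coeff p * s ^ degree p\<close> vanishes.\<close>

lemma pcompose_linear_coeff:
  fixes p :: "'b::comm_ring_1 poly"
  shows "degree (pcompose p [:x, s:]) \<le> degree p \<and> coeff (pcompose p [:x, s:]) (degree p) = lead_coeff p * s ^ degree p"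
proof (induction p)
  case (pCons a p)
  show ?case
  proof (cases "p = 0")
    case False
    have "coeff (pcompose p [:x, s:]) (Suc (degree p)) = 0" using pCons.IH by (intro coeff_eq_0) auto
    moreover have "degree (pcompose (pCons a p) [:x, s:]) \<le> degree (pCons a p)"
      using degree_pcompose_le[of "pCons a p" "[:x, s:]"] by (auto intro: order_trans split: if_splits)
    ultimately show ?thesis using pCons.IH False by (simp add: pcompose_pCons mult_ac)
  qed simp
qed simp

theorem iso_sym_alg_imp_retract_exp_map:
  fixes A M :: "'b::comm_ring_1 set"
  assumes A: "subring A"
    and M: "ideal_of A M"
    and dom: "\<And>x y :: 'b. x * y = 0 \<Longrightarrow> x = 0 \<or> y = 0"
    and s: "s \<in> M" "s \<noteq> 0"
    and iso: "iso_sym_alg A M"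
  shows "retract A \<and> (\<exists>\<phi>. exp_map A \<phi> \<and> A = invariants \<phi> \<and> \<phi> \<noteq> (\<lambda>b. [:b:]))"
proof -
  obtain \<psi> where \<psi>: "sym_presentation A M \<psi>"
    using iso unfolding iso_sym_alg_def sym_presentation_def by blast
  obtain \<pi> where \<pi>: "ring_hom_fun \<pi>" "\<And>a. a \<in> A \<Longrightarrow> \<pi> a = a" "range \<pi> = A"
    using sym_pres_retraction[OF A M \<psi>] by blast
  have retract: "retract A"
  proof -
    have "\<pi> (\<pi> b) = \<pi> b" for b by (rule \<pi>(2)) (use \<pi>(3) in blast)
    then show ?thesis unfolding retract_def using \<pi>(1,3) by (intro exI[of _ \<pi>]) (simp add: fun_eq_iff)
  qed
  obtain \<phi> where \<phi>: "exp_map A \<phi>" "\<And>m. m \<in> M \<Longrightarrow> \<phi> (\<psi> (sym_var m)) = [:\<psi> (sym_var m), m:]"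
    using sym_pres_exp_map[OF A M \<psi>] by blast
  note h = ring_hom_funD[OF exp_mapD(1)[OF \<phi>(1)]]
  note \<pi>h = ring_hom_funD[OF \<pi>(1)]
  define x where "x = \<psi> (sym_var s)"
  have sA: "s \<in> A" using s(1) M by (auto simp: ideal_of_def)
  have pow_nz: "s ^ n * y = 0 \<Longrightarrow> y = 0" for n y
    by (induction n) (use dom s(2) in \<open>auto simp: mult.assoc\<close>)
  have poly_form: "\<exists>N p. (\<forall>i. coeff p i \<in> A) \<and> s ^ N * b = poly p x" for b
  proof (induction b rule: sym_pres_induct[OF A M \<psi>, case_names scalar add var_mult])
    case (scalar a)
    then show ?case
      using subringD(2)[OF A] by (intro exI[of _ 0] exI[of _ "[:a:]"]) (simp add: coeff_pCons split: nat.split)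
  next
    case (add b c)
    then obtain N p L q where "\<forall>i. coeff p i \<in> A" "s ^ N * b = poly p x"
      "\<forall>i. coeff q i \<in> A" "s ^ L * c = poly q x" by blast
    note NL = this
    have "s ^ (N + L) * (b + c) = s ^ L * (s ^ N * b) + s ^ N * (s ^ L * c)"
      by (simp add: power_add algebra_simps)
    also have "\<dots> = poly (smult (s ^ L) p + smult (s ^ N) q) x" by (simp add: NL(2,4))
    finally have "s ^ (N + L) * (b + c) = poly (smult (s ^ L) p + smult (s ^ N) q) x" .
    moreover have "\<forall>i. coeff (smult (s ^ L) p + smult (s ^ N) q) i \<in> A"
      using NL(1,3) subringD(3,4,6)[OF A] sA by simp
    ultimately show ?case by blast
  next
    case (var_mult m b)
    then obtain N p where p: "\<forall>i. coeff p i \<in> A" "s ^ N * b = poly p x" by blast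
    have mA: "m \<in> A" using var_mult(1) M by (auto simp: ideal_of_def)
    \<comment> \<open>Both sides are the image of the variable indexed by \<open>s * m\<close>, with
      either factor moved out of the index. Thus every generator becomes a multiple of x after
      multiplication by s.\<close>
    have sm: "s * \<psi> (sym_var m) = m * x"
      using sym_pres_var_mult[OF A M \<psi> sA var_mult(1)] sym_pres_var_mult[OF A M \<psi> mA s(1)]
      by (simp add: x_def mult.commute)
    have "s ^ Suc N * (\<psi> (sym_var m) * b) = s * \<psi> (sym_var m) * (s ^ N * b)"
      by (simp add: mult_ac)
    also have "\<dots> = m * x * (s ^ N * b)" by (simp only: sm)
    finally have "s ^ Suc N * (\<psi> (sym_var m) * b) = m * x * (s ^ N * b)" .
    then show ?case
      using p mA subringD(2,4)[OF A]
      by (intro exI[of _ "Suc N"] exI[of _ "smult m (pCons 0 p)"])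
        (simp add: coeff_pCons mult.assoc split: nat.split)
  qed
  have "b \<in> A" if b: "\<phi> b = [:b:]" for b
  proof -
    obtain N p where p: "\<And>i. coeff p i \<in> A" "s ^ N * b = poly p x" using poly_form[of b] by blast
    have "pcompose p [:x, s:] = poly (map_poly \<phi> p) (\<phi> x)"
    proof -
      have "map_poly \<phi> p = map_poly (\<lambda>a. [:a:]) p"
        using p(1) exp_mapD(3)[OF \<phi>(1)] by (intro poly_eqI) (simp add: coeff_map_poly h)
      then show ?thesis using \<phi>(2)[OF s(1)] by (simp add: pcompose_altdef x_def)
    qed
    also have "\<dots> = \<phi> (s ^ N * b)"
      by (simp only: p(2) poly_map_poly_hom[OF exp_mapD(1)[OF \<phi>(1)]])
    also have "\<dots> = [:s ^ N * b:]"
      using exp_mapD(3)[OF \<phi>(1) sA] b by (simp add: h poly_const_pow)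
    finally have eq: "pcompose p [:x, s:] = [:s ^ N * b:]" .
    \<comment> \<open>The coefficient of \<open>p(x + s U)\<close> at \<open>degree p\<close> is the
      leading coefficient of p times a power of s, nonzero in a domain, whereas this polynomial is
      constant.\<close>
    have "degree p = 0"
    proof (rule ccontr)
      assume "degree p \<noteq> 0"
      then have "s ^ degree p * lead_coeff p = 0"
        using pcompose_linear_coeff[of p x s] unfolding eq by (simp add: coeff_pCons mult.commute split: nat.splits)
      then have "p = 0" using pow_nz by fastforce
      with \<open>degree p \<noteq> 0\<close> show False by simp
    qed
    then obtain a where "p = [:a:]" by (rule degree_eq_zeroE)
    with p have a: "s ^ N * b = a" "a \<in> A" using p(1)[of 0] by simp_all
    \<comment> \<open>Membership of \<open>s ^ N * b\<close> in A does not by itself put b into A.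
      The retraction fixes both s and \<open>s ^ N * b\<close>, and cancelling the power of s gives
      \<open>b = \<pi> b\<close>.\<close>
    have "s ^ N * (b - \<pi> b) = s ^ N * b - \<pi> (s ^ N * b)"
      using \<pi>(2)[OF sA] by (simp add: \<pi>h right_diff_distrib)
    also have "\<dots> = 0" using a \<pi>(2) by simp
    finally have "b = \<pi> b" using pow_nz by fastforce
    then show "b \<in> A" using \<pi>(3) by blast
  qed
  then have "A = invariants \<phi>" using exp_mapD(3)[OF \<phi>(1)] by (auto simp: invariants_def)
  moreover have "\<phi> \<noteq> (\<lambda>b. [:b:])"
  proof
    assume "\<phi> = (\<lambda>b. [:b:])"
    then have "[:x, s:] = [:x:]" using \<phi>(2)[OF s(1)] by (simp add: x_def)
    with s(2) show False by simp
  qed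
  ultimately show ?thesis using retract \<phi>(1) by blast
qed

subsection \<open>Retracts that are rings of invariants\<close>

lemma pm_mult_left_cancel:
  fixes a x y :: "('v::finite \<Rightarrow>\<^sub>0 nat) \<Rightarrow>\<^sub>0 'r::idom"
  assumes "a * x = a * y" "a \<noteq> 0"
  shows "x = y"
proof -
  have "a * (x - y) = 0" using assms(1) by (simp add: right_diff_distrib)
  with pm_no_zero_divisors assms(2) have "x - y = 0" by blast
  then show ?thesis by simp
qed

lemma pm_const_dvd:
  assumes "\<And>\<nu>. r dvd Poly_Mapping.lookup q \<nu>"
  shows "\<exists>G. q = pm_const r * G"
proof -
  obtain k where k: "\<And>\<nu>. Poly_Mapping.lookup q \<nu> = r * k \<nu>" using assms unfolding dvd_def by metis
  have "q = (\<Sum>\<nu>\<in>Poly_Mapping.keys q. Poly_Mapping.single \<nu> (r * k \<nu>))"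
    using pm_sum_single[of q] by (simp add: k)
  also have "\<dots> = pm_const r * (\<Sum>\<nu>\<in>Poly_Mapping.keys q. Poly_Mapping.single \<nu> (k \<nu>))"
    by (simp add: sum_distrib_left mult_single)
  finally show ?thesis by blast
qed

lemma sym_rel_multI: "a \<in> A \<Longrightarrow> m \<in> M \<Longrightarrow> sym_var (a * m) - pm_const a * sym_var m \<in> sym_rel A M"
  unfolding sym_rel_def by blast

lemma sym_rel_addI: "m \<in> M \<Longrightarrow> m' \<in> M \<Longrightarrow> sym_var (m + m') - sym_var m - sym_var m' \<in> sym_rel A M"
  unfolding sym_rel_def by blast

text \<open>The relations express linearity for one multiple or one sum at a time; induction extends
  it to finite sums. It starts from a single summand because \<open>ideal_of\<close> does not state
  that 0 lies in M.\<close>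

lemma sym_rel_sum:
  assumes A: "subring A" and M: "ideal_of A M" and F: "finite F" "F \<noteq> {}"
    and a: "\<And>i. i \<in> F \<Longrightarrow> a i \<in> A" and m: "\<And>i. i \<in> F \<Longrightarrow> m i \<in> M"
  shows "(\<Sum>i\<in>F. a i * m i) \<in> M \<and> sym_var (\<Sum>i\<in>F. a i * m i) - (\<Sum>i\<in>F. pm_const (a i) * sym_var (m i))
    \<in> fin_comb (sym_pre A M) (sym_rel A M)"
  using F a m
proof (induction F rule: finite_ne_induct)
  case (singleton i)
  have 1: "pm_const 1 \<in> sym_pre A M" by (rule sym_pre_const[OF A subringD(1)[OF A]])
  have "sym_var (a i * m i) - pm_const (a i) * sym_var (m i) \<in> sym_rel A M"
    using singleton by (intro sym_rel_multI) auto
  from fin_comb_mem[OF 1 this] show ?case using singleton M by (simp add: ideal_of_def)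
next
  case (insert i F)
  let ?R = "fin_comb (sym_pre A M) (sym_rel A M)"
  let ?s = "\<Sum>j\<in>F. a j * m j"
  have 1: "pm_const 1 \<in> sym_pre A M" by (rule sym_pre_const[OF A subringD(1)[OF A]])
  have IH: "?s \<in> M" "sym_var ?s - (\<Sum>j\<in>F. pm_const (a j) * sym_var (m j)) \<in> ?R"
    using insert.IH insert.prems by auto
  have am: "a i * m i \<in> M" using insert.prems M by (simp add: ideal_of_def)
  have "sym_var (a i * m i + ?s) - sym_var (a i * m i) - sym_var ?s \<in> sym_rel A M"
    using am IH(1) by (rule sym_rel_addI)
  from fin_comb_mem[OF 1 this]
  have r1: "sym_var (a i * m i + ?s) - sym_var (a i * m i) - sym_var ?s \<in> ?R" by simp
  have "sym_var (a i * m i) - pm_const (a i) * sym_var (m i) \<in> sym_rel A M"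
    using insert.prems by (intro sym_rel_multI) auto
  from fin_comb_mem[OF 1 this] have r2: "sym_var (a i * m i) - pm_const (a i) * sym_var (m i) \<in> ?R" by simp
  have "a i * m i + ?s \<in> M" using am IH(1) M by (simp add: ideal_of_def)
  moreover have "sym_var (a i * m i + ?s) - (pm_const (a i) * sym_var (m i) + (\<Sum>j\<in>F. pm_const (a j) * sym_var (m j))) \<in> ?R"
    using fin_comb_add[OF fin_comb_add[OF r1 r2] IH(2)] by (simp add: algebra_simps)
  ultimately show ?case using insert.hyps by simp
qed

text \<open>The kernel P of the retraction satisfies \<open>P = \<Sum>\<^sub>z (z f / d) B\<close>, z ranging over
  \<open>I = (d R : content f)\<close> for a fixed coefficient \<open>d \<noteq> 0\<close> of f. Writing \<open>d (X\<^sup>\<mu> - \<pi>(X\<^sup>\<mu>)) = f G\<^sub>\<mu>\<close>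
  and summing with the coefficients of f gives \<open>d = \<Sum>\<^sub>\<mu> f\<^sub>\<mu> G\<^sub>\<mu>\<close>, which makes I invertible and
  supplies the \<open>z\<^sub>\<mu>\<close> below as constant terms of the \<open>G\<^sub>\<mu>\<close>.\<close>
context
  fixes A :: "(('v::finite \<Rightarrow>\<^sub>0 nat) \<Rightarrow>\<^sub>0 'r::idom) set" and \<phi> \<pi> f
  assumes cic: "compl_int_closed {1::'r}" and A: "subring A" and const_A: "\<And>r. pm_const r \<in> A"
    and \<phi>: "exp_map A \<phi>" and inv: "invariants \<phi> = A"
    and \<pi>: "ring_hom_fun \<pi>" "\<pi> \<circ> \<pi> = \<pi>" "range \<pi> = A"
    and f: "\<pi> f = 0" "f \<noteq> 0"
    and gen: "\<forall>p. \<pi> p = 0 \<longrightarrow> (\<exists>r g. r \<noteq> 0 \<and> pm_const r * p = f * g)"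
begin

lemma retraction_fixes: "a \<in> A \<Longrightarrow> \<pi> a = a"
  using \<pi>(2,3) by (metis comp_apply imageE)

lemma retraction_in: "\<pi> b \<in> A"
  using \<pi>(3) by blast

lemma A_iff_degree: "a \<in> A \<longleftrightarrow> degree (\<phi> a) = 0"
  unfolding inv[symmetric] by (rule invariants_iff_degree[OF \<phi>])

definition some_coeff :: 'r where "some_coeff = Poly_Mapping.lookup f (SOME \<mu>. \<mu> \<in> Poly_Mapping.keys f)"

private abbreviation (input) d where "d \<equiv> some_coeff"
private abbreviation (input) fc where "fc \<equiv> Poly_Mapping.lookup f"
private abbreviation (input) D where "D \<equiv> pm_const d :: ('v \<Rightarrow>\<^sub>0 nat) \<Rightarrow>\<^sub>0 'r"

text \<open>The module \<open>(R : content f)\<close> multiplied by d, which brings it into R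
  because d is itself a coefficient of f.\<close>

definition content_ideal :: "'r set" where
  "content_ideal = {z. \<forall>\<mu>. d dvd z * fc \<mu>}"

lemma some_coeff_nonzero: "d \<noteq> 0"
proof -
  have "(SOME \<mu>. \<mu> \<in> Poly_Mapping.keys f) \<in> Poly_Mapping.keys f"
    using f(2) by (simp add: some_in_eq)
  then show ?thesis by (simp add: some_coeff_def in_keys_iff)
qed

lemma const_some_coeff_nonzero: "D \<noteq> 0"
  using some_coeff_nonzero by (metis lookup_single_eq lookup_zero)

lemma const_some_coeff_power_nonzero: "D ^ n \<noteq> 0"
proof (induction n)
  case (Suc n)
  then show ?case using const_some_coeff_nonzero pm_no_zero_divisors[of D "D ^ n"] by auto
qed simp

text \<open>In \<open>r p = f g\<close> Gauss's lemma makes r divide every product of a coefficient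
  of f and one of g. For the coefficient d of f this allows r to be cancelled, giving
  \<open>d p = f G\<close>; for the others it says that d divides
  \<open>G\<^sub>\<nu> f\<^sub>\<mu>\<close>.\<close>

lemma kernel_divides:
  assumes p: "\<pi> p = 0"
  obtains G where "D * p = f * G" "\<And>\<nu>. Poly_Mapping.lookup G \<nu> \<in> content_ideal"
proof -
  obtain r g where r: "r \<noteq> 0" and g: "pm_const r * p = f * g" using gen p by blast
  have dvd: "r dvd fc \<mu> * Poly_Mapping.lookup g \<nu>" for \<mu> \<nu>
    by (rule pm_gauss[OF cic r g[symmetric]])
  have "r dvd Poly_Mapping.lookup (D * g) \<nu>" for \<nu>
    using dvd by (simp add: lookup_const_mult some_coeff_def)
  then obtain G where G: "D * g = pm_const r * G" using pm_const_dvd by blast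
  have rc: "pm_const r \<noteq> (0 :: ('v \<Rightarrow>\<^sub>0 nat) \<Rightarrow>\<^sub>0 'r)" using r by (metis lookup_single_eq lookup_zero)
  have "pm_const r * (D * p) = D * (f * g)" by (simp add: g[symmetric] mult_ac)
  also have "\<dots> = pm_const r * (f * G)" using G by (simp add: mult_ac)
  finally have 1: "D * p = f * G" using rc by (rule pm_mult_left_cancel)
  have "d dvd Poly_Mapping.lookup G \<nu> * fc \<mu>" for \<mu> \<nu>
  proof -
    obtain k where k: "fc \<mu> * Poly_Mapping.lookup g \<nu> = r * k" using dvd[of \<mu> \<nu>] by (auto simp: dvd_def)
    have "d * Poly_Mapping.lookup g \<nu> = r * Poly_Mapping.lookup G \<nu>"
      using arg_cong[OF G, of "\<lambda>p. Poly_Mapping.lookup p \<nu>"] by (simp add: lookup_const_mult)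
    then have "r * (Poly_Mapping.lookup G \<nu> * fc \<mu>) = d * Poly_Mapping.lookup g \<nu> * fc \<mu>"
      by (simp only: mult.assoc[symmetric])
    also have "\<dots> = d * (fc \<mu> * Poly_Mapping.lookup g \<nu>)" by (simp only: mult_ac)
    also have "\<dots> = r * (d * k)" unfolding k by (rule mult.left_commute)
    finally show ?thesis using r by simp
  qed
  with 1 that show ?thesis by (simp add: content_ideal_def)
qed

lemma exists_inverse_coeffs:
  "\<exists>z. (\<forall>\<mu>. z \<mu> \<in> content_ideal) \<and> d = (\<Sum>\<mu>\<in>Poly_Mapping.keys f. fc \<mu> * z \<mu>)"
proof -
  note h = ring_hom_funD[OF \<pi>(1)]
  let ?X = "\<lambda>\<mu>. Poly_Mapping.single \<mu> (1::'r)"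
  have "\<exists>G. D * (?X \<mu> - \<pi> (?X \<mu>)) = f * G \<and> (\<forall>\<nu>. Poly_Mapping.lookup G \<nu> \<in> content_ideal)" for \<mu>
  proof -
    have "\<pi> (?X \<mu> - \<pi> (?X \<mu>)) = 0" by (simp add: h retraction_fixes[OF retraction_in])
    then show ?thesis using kernel_divides by metis
  qed
  then obtain G where G: "\<And>\<mu>. D * (?X \<mu> - \<pi> (?X \<mu>)) = f * G \<mu>"
    "\<And>\<mu> \<nu>. Poly_Mapping.lookup (G \<mu>) \<nu> \<in> content_ideal" by metis
  let ?c = "\<lambda>\<mu>. pm_const (fc \<mu>) :: ('v \<Rightarrow>\<^sub>0 nat) \<Rightarrow>\<^sub>0 'r"
  have f_sum: "f = (\<Sum>\<mu>\<in>Poly_Mapping.keys f. ?c \<mu> * ?X \<mu>)"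
    using pm_sum_single[of f] by (simp add: mult_single)
  have "\<pi> f = (\<Sum>\<mu>\<in>Poly_Mapping.keys f. ?c \<mu> * \<pi> (?X \<mu>))"
    by (subst f_sum) (simp add: h retraction_fixes[OF const_A])
  \<comment> \<open>The retraction kills f and fixes constants, so the images of the monomials,
    weighted by the coefficients of f, sum to zero and may be subtracted.\<close>
  then have "f = (\<Sum>\<mu>\<in>Poly_Mapping.keys f. ?c \<mu> * (?X \<mu> - \<pi> (?X \<mu>)))"
    using f(1) f_sum by (simp add: right_diff_distrib sum_subtractf)
  then have "f * D = D * (\<Sum>\<mu>\<in>Poly_Mapping.keys f. ?c \<mu> * (?X \<mu> - \<pi> (?X \<mu>)))"
    by (metis mult.commute)
  also have "\<dots> = (\<Sum>\<mu>\<in>Poly_Mapping.keys f. ?c \<mu> * (D * (?X \<mu> - \<pi> (?X \<mu>))))"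
    unfolding sum_distrib_left by (intro sum.cong refl mult.left_commute)
  also have "\<dots> = f * (\<Sum>\<mu>\<in>Poly_Mapping.keys f. ?c \<mu> * G \<mu>)"
    unfolding G(1) sum_distrib_left by (intro sum.cong refl mult.left_commute)
  finally have "D = (\<Sum>\<mu>\<in>Poly_Mapping.keys f. ?c \<mu> * G \<mu>)" using f(2) by (rule pm_mult_left_cancel)
  from arg_cong[OF this, of "\<lambda>p. Poly_Mapping.lookup p 0"]
  have "d = (\<Sum>\<mu>\<in>Poly_Mapping.keys f. fc \<mu> * Poly_Mapping.lookup (G \<mu>) 0)"
    by (simp add: lookup_sum lookup_const_mult)
  with G(2) show ?thesis by (intro exI[of _ "\<lambda>\<mu>. Poly_Mapping.lookup (G \<mu>) 0"] conjI allI)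
qed

lemma is_ideal_content_ideal: "is_ideal content_ideal"
  unfolding is_ideal_def content_ideal_def by (auto simp: distrib_right mult.assoc)

lemma invertible_content_ideal: "invertible_ideal content_ideal"
  unfolding invertible_ideal_def
proof (intro conjI is_ideal_content_ideal)
  obtain z where z: "\<And>\<mu>. z \<mu> \<in> content_ideal" "d = (\<Sum>\<mu>\<in>Poly_Mapping.keys f. fc \<mu> * z \<mu>)"
    using exists_inverse_coeffs by blast
  let ?F = "Poly_Mapping.keys f" and ?\<iota> = "\<lambda>r. Fract r (1::'r)"
  note h = ring_hom_funD[OF ring_hom_fun_Fract]
  \<comment> \<open>This J is the content of f divided by d, the inverse of the content ideal:
    products of the two lie in R by the definition of \<open>content_ideal\<close>, and the
    coefficients z show that 1 is among their sums.\<close>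
  define J where "J = {Fract (\<Sum>\<mu>\<in>?F. fc \<mu> * y \<mu>) d | y. True}"
  have J_0: "0 \<in> J"
    unfolding J_def by (intro CollectI exI[of _ "\<lambda>_. 0"]) (use some_coeff_nonzero in \<open>simp add: Zero_fract_def eq_fract\<close>)
  have J_add: "u + v \<in> J" if "u \<in> J" "v \<in> J" for u v
  proof -
    from that obtain x y where "u = Fract (\<Sum>\<mu>\<in>?F. fc \<mu> * x \<mu>) d" "v = Fract (\<Sum>\<mu>\<in>?F. fc \<mu> * y \<mu>) d"
      by (auto simp: J_def)
    then have "u + v = Fract (\<Sum>\<mu>\<in>?F. fc \<mu> * (x \<mu> + y \<mu>)) d"
      using some_coeff_nonzero by (simp add: eq_fract distrib_left sum.distrib distrib_right)
    then show ?thesis unfolding J_def by (intro CollectI exI[of _ "\<lambda>\<mu>. x \<mu> + y \<mu>"]) simp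
  qed
  have J_mult: "?\<iota> r * u \<in> J" if "u \<in> J" for r u
  proof -
    from that obtain y where "u = Fract (\<Sum>\<mu>\<in>?F. fc \<mu> * y \<mu>) d" by (auto simp: J_def)
    then have "?\<iota> r * u = Fract (\<Sum>\<mu>\<in>?F. fc \<mu> * (r * y \<mu>)) d"
      by (simp add: sum_distrib_left mult.left_commute)
    then show ?thesis unfolding J_def by (intro CollectI exI[of _ "\<lambda>\<mu>. r * y \<mu>"]) simp
  qed
  have J_inverse: "fin_comb (?\<iota> ` content_ideal) J = range ?\<iota>"
  proof (intro set_eqI iffI)
    fix u assume "u \<in> fin_comb (?\<iota> ` content_ideal) J"
    then show "u \<in> range ?\<iota>"
    proof (induction rule: fin_comb_induct)
      case zero
      show ?case by (metis h(4) rangeI)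
    next
      case (step p s x)
      then obtain t y k where t: "t \<in> content_ideal" "p = ?\<iota> t" "s = Fract (\<Sum>\<mu>\<in>?F. fc \<mu> * y \<mu>) d" "x = ?\<iota> k"
        by (auto simp: J_def)
      have "d dvd t * (\<Sum>\<mu>\<in>?F. fc \<mu> * y \<mu>)"
        using t(1) unfolding sum_distrib_left content_ideal_def
        by (intro dvd_sum) (simp flip: mult.assoc)
      then obtain l where "t * (\<Sum>\<mu>\<in>?F. fc \<mu> * y \<mu>) = d * l" by (auto simp: dvd_def)
      then have "p * s + x = ?\<iota> (l + k)" using some_coeff_nonzero t by (simp add: eq_fract algebra_simps)
      then show ?case by blast
    qed
  next
    fix u assume "u \<in> range ?\<iota>"
    then obtain r where r: "u = ?\<iota> r" by blast
    have "(\<Sum>\<mu>\<in>?F. ?\<iota> (z \<mu>) * Fract (\<Sum>\<nu>\<in>?F. fc \<nu> * (if \<nu> = \<mu> then r else 0)) d) \<in> fin_comb (?\<iota> ` content_ideal) J"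
    proof (intro fin_comb_sum fin_comb_mem)
      show "?\<iota> (z \<mu>) \<in> ?\<iota> ` content_ideal" for \<mu> using z(1) by blast
      show "Fract (\<Sum>\<nu>\<in>?F. fc \<nu> * (if \<nu> = \<mu> then r else 0)) d \<in> J" for \<mu>
        unfolding J_def by (intro CollectI exI[of _ "\<lambda>\<nu>. if \<nu> = \<mu> then r else 0"]) simp
    qed
    also have "(\<Sum>\<mu>\<in>?F. ?\<iota> (z \<mu>) * Fract (\<Sum>\<nu>\<in>?F. fc \<nu> * (if \<nu> = \<mu> then r else 0)) d)
        = (\<Sum>\<mu>\<in>?F. Fract 1 d * ?\<iota> (r * (fc \<mu> * z \<mu>)))"
    proof (intro sum.cong refl)
      fix \<mu> assume "\<mu> \<in> ?F"
      then have "(\<Sum>\<nu>\<in>?F. fc \<nu> * (if \<nu> = \<mu> then r else 0)) = fc \<mu> * r" 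
        by (simp add: if_distrib[of "(*) _"] cong: if_cong)
      then show "?\<iota> (z \<mu>) * Fract (\<Sum>\<nu>\<in>?F. fc \<nu> * (if \<nu> = \<mu> then r else 0)) d
          = Fract 1 d * ?\<iota> (r * (fc \<mu> * z \<mu>))"
        by (simp add: mult_ac)
    qed
    also have "\<dots> = Fract 1 d * ?\<iota> (r * d)"
      unfolding z(2) by (simp only: h(8) sum_distrib_left)
    also have "\<dots> = u" using some_coeff_nonzero by (simp add: r eq_fract)
    finally show "u \<in> fin_comb (?\<iota> ` content_ideal) J" .
  qed
  show "\<exists>J. 0 \<in> J \<and> (\<forall>x\<in>J. \<forall>y\<in>J. x + y \<in> J) \<and> (\<forall>r. \<forall>x\<in>J. ?\<iota> r * x \<in> J)
      \<and> fin_comb (?\<iota> ` content_ideal) J = range ?\<iota>"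
  proof (rule exI[of _ J], intro conjI ballI allI)
    show "0 \<in> J" by (rule J_0)
    show "x + y \<in> J" if "x \<in> J" "y \<in> J" for x y using that by (rule J_add)
    show "?\<iota> r * x \<in> J" if "x \<in> J" for r x using that by (rule J_mult)
    show "fin_comb (?\<iota> ` content_ideal) J = range ?\<iota>" by (rule J_inverse)
  qed
qed

definition extended_ideal :: "(('v \<Rightarrow>\<^sub>0 nat) \<Rightarrow>\<^sub>0 'r) set" where
  "extended_ideal = fin_comb A (rconst ` content_ideal)"

private abbreviation (input) M where "M \<equiv> extended_ideal"

lemma ideal_of_extended_ideal: "ideal_of A M"
  unfolding ideal_of_def
proof (intro conjI ballI subsetI)
  show "m + m' \<in> M" if "m \<in> M" "m' \<in> M" for m m'
    using that unfolding extended_ideal_def by (rule fin_comb_add)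
  show "a * m \<in> M" if "a \<in> A" "m \<in> M" for a m
    using that subringD(4)[OF A] unfolding extended_ideal_def by (intro fin_comb_mult) auto
  show "m \<in> A" if "m \<in> M" for m
    using that unfolding extended_ideal_def
    by (induction rule: fin_comb_induct) (auto simp: rconst_def intro!: subringD[OF A] const_A)
qed

lemma scalar_in_extended_ideal: "z \<in> content_ideal \<Longrightarrow> pm_const z \<in> M"
  using fin_comb_mem[OF subringD(1)[OF A], of "rconst z" "rconst ` content_ideal"]
  by (simp add: extended_ideal_def rconst_def)

text \<open>The element y is \<open>m f / d\<close>, the intended image of \<open>T\<^sub>m\<close>;
  that it is a polynomial is the defining property of the content ideal, extended linearly over
  A.\<close>

lemma extended_ideal_times_f: "m \<in> M \<Longrightarrow> \<exists>y. D * y = m * f"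
  unfolding extended_ideal_def
proof (induction rule: fin_comb_induct)
  case zero
  show ?case by (intro exI[of _ 0]) simp
next
  case (step a s x)
  then obtain z y where z: "z \<in> content_ideal" "s = pm_const z" "D * y = x * f" by (auto simp: rconst_def)
  have "\<exists>G. pm_const z * f = D * G"
    using z(1) by (intro pm_const_dvd) (simp add: lookup_const_mult content_ideal_def)
  then obtain G where "pm_const z * f = D * G" by blast
  then have "D * (a * G + y) = (a * s + x) * f"
    using z by (simp add: distrib_left distrib_right mult.assoc mult.left_commute)
  then show ?case by blast
qed

text \<open>The quotients \<open>f\<^sub>\<mu> m / d\<close>, which lie in A itself, are the
  coefficients of m in terms of the \<open>z\<^sub>\<mu>\<close>, because
  \<open>d = \<Sum> f\<^sub>\<mu> z\<^sub>\<mu>\<close>.\<close>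

lemma extended_ideal_times_coeff: "m \<in> M \<Longrightarrow> \<exists>a\<in>A. D * a = pm_const (fc \<mu>) * m"
  unfolding extended_ideal_def
proof (induction rule: fin_comb_induct)
  case zero
  show ?case using subringD(2)[OF A] by (intro bexI[of _ 0]) simp_all
next
  case (step a s x)
  then obtain z y where z: "z \<in> content_ideal" "s = pm_const z" "y \<in> A" "D * y = pm_const (fc \<mu>) * x"
    by (auto simp: rconst_def)
  obtain k where "z * fc \<mu> = d * k" using z(1) by (auto simp: content_ideal_def dvd_def)
  then have k: "pm_const (fc \<mu>) * pm_const z = D * (pm_const k :: ('v \<Rightarrow>\<^sub>0 nat) \<Rightarrow>\<^sub>0 'r)"
    by (simp add: mult_single mult.commute)
  have "pm_const (fc \<mu>) * (a * s + x) = a * (pm_const (fc \<mu>) * pm_const z) + pm_const (fc \<mu>) * x"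
    by (simp add: z(2) distrib_left mult.left_commute)
  also have "\<dots> = D * (a * pm_const k + y)" by (simp add: k z(4) distrib_left mult.left_commute)
  finally have "D * (a * pm_const k + y) = pm_const (fc \<mu>) * (a * s + x)" ..
  moreover have "a * pm_const k + y \<in> A" using step(1) z(3) const_A by (intro subringD[OF A])
  ultimately show ?case by blast
qed

text \<open>Applying \<pi>, which kills f and fixes A, isolates the constant coefficient; once it is
  zero, f can be cancelled from the rest.\<close>

lemma f_transcendental:
  assumes "\<And>k. k < N \<Longrightarrow> c k \<in> A" "(\<Sum>k<N. c k * f ^ k) = 0" "k < N"
  shows "c k = 0"
  using assms
proof (induction N arbitrary: c k)
  case (Suc N)
  note h = ring_hom_funD[OF \<pi>(1)]
  have eq: "(\<Sum>k<Suc N. c k * f ^ k) = c 0 + f * (\<Sum>k<N. c (Suc k) * f ^ k)"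
    unfolding sum.lessThan_Suc_shift by (simp add: sum_distrib_left mult.left_commute)
  have "c 0 + f * (\<Sum>k<N. c (Suc k) * f ^ k) = 0" using Suc.prems(2) unfolding eq .
  from arg_cong[OF this, of \<pi>] have "\<pi> (c 0) = 0" by (simp add: h f(1))
  then have c0: "c 0 = 0" using Suc.prems(1)[of 0] by (simp add: retraction_fixes)
  with eq Suc.prems(2) have "f * (\<Sum>k<N. c (Suc k) * f ^ k) = f * 0" by simp
  then have "(\<Sum>k<N. c (Suc k) * f ^ k) = 0" using f(2) by (rule pm_mult_left_cancel)
  with Suc.IH[of "\<lambda>k. c (Suc k)"] Suc.prems c0 show ?case by (cases k) auto
qed simp

text \<open>The isomorphism is induced by \<open>T\<^sub>m \<mapsto> m f / d\<close>. Division by d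
  is available only as cancellation of the constant D, so identities are checked after
  multiplication by powers of D.\<close>

lemma iso_sym_alg_extended_ideal: "iso_sym_alg A M"
proof -
  let ?F = "Poly_Mapping.keys f" and ?S = "sym_pre A M"
  let ?R = "fin_comb (sym_pre A M) (sym_rel A M)"
  obtain z where z: "\<And>\<mu>. z \<mu> \<in> content_ideal" "d = (\<Sum>\<mu>\<in>?F. fc \<mu> * z \<mu>)"
    using exists_inverse_coeffs by blast
  let ?z = "\<lambda>\<mu>. pm_const (z \<mu>) :: ('v \<Rightarrow>\<^sub>0 nat) \<Rightarrow>\<^sub>0 'r"
  let ?c = "\<lambda>\<mu>. pm_const (fc \<mu>) :: ('v \<Rightarrow>\<^sub>0 nat) \<Rightarrow>\<^sub>0 'r"
  have zM: "?z \<mu> \<in> M" for \<mu> using z(1) by (rule scalar_in_extended_ideal)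
  have D_sum: "D = (\<Sum>\<mu>\<in>?F. ?c \<mu> * ?z \<mu>)"
    using arg_cong[OF z(2), of "pm_const :: 'r \<Rightarrow> ('v \<Rightarrow>\<^sub>0 nat) \<Rightarrow>\<^sub>0 'r"]
    by (simp only: ring_hom_funD(2,8)[OF ring_hom_fun_pm_const])
  have F: "finite ?F" "?F \<noteq> {}" using f(2) by simp_all
  obtain T where T: "\<And>m. m \<in> M \<Longrightarrow> D * T m = m * f" using extended_ideal_times_f by metis
  define \<beta> where "\<beta> \<mu> m = (SOME a. a \<in> A \<and> D * a = ?c \<mu> * m)" for \<mu> m
  have \<beta>: "\<beta> \<mu> m \<in> A" "D * \<beta> \<mu> m = ?c \<mu> * m" if "m \<in> M" for \<mu> m
    using someI_ex[of "\<lambda>a. a \<in> A \<and> D * a = ?c \<mu> * m"] extended_ideal_times_coeff[OF that, of \<mu>]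
    unfolding \<beta>_def by blast+
  have M: "m + m' \<in> M" "a * m \<in> M" "m \<in> A" if "m \<in> M" "m' \<in> M" "a \<in> A" for m m' a
    using ideal_of_extended_ideal that by (auto simp: ideal_of_def)
  have D_cancel: "x = y" if "D * x = D * y" for x y
    using that const_some_coeff_nonzero by (rule pm_mult_left_cancel)
  define \<psi> where "\<psi> = pm_eval (\<lambda>a. a) T"
  have \<psi>_hom: "ring_hom_fun \<psi>" unfolding \<psi>_def by (intro ring_hom_fun_pm_eval ring_hom_fun_id)
  note h = ring_hom_funD[OF \<psi>_hom]
  have \<psi>_const: "\<psi> (pm_const a) = a" for a by (simp add: \<psi>_def pm_eval_const[OF ring_hom_fun_id])
  have \<psi>_var: "\<psi> (sym_var m) = T m" for m
    by (simp add: \<psi>_def sym_var_eq_pm_var pm_eval_var[OF ring_hom_fun_id])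
  have \<psi>_rel: "\<psi> r = 0" if "r \<in> ?R" for r
    using that
  proof (induction rule: fin_comb_induct)
    case (step p s x)
    have "\<psi> s = 0"
    proof -
      from step(2) consider m m' where "m \<in> M" "m' \<in> M" "s = sym_var (m + m') - sym_var m - sym_var m'"
        | a m where "a \<in> A" "m \<in> M" "s = sym_var (a * m) - pm_const a * sym_var m"
        by (auto simp: sym_rel_def)
      then show ?thesis
      proof cases
        case 1
        have "D * T (m + m') = D * (T m + T m')"
          using 1 M(1)[OF 1(1,2) subringD(1)[OF A]] by (simp add: T distrib_left distrib_right)
        from D_cancel[OF this] show ?thesis using 1(3) by (simp add: h \<psi>_var)
      next
        case 2
        have "D * T (a * m) = D * (a * T m)"
          using 2 M(2)[OF 2(2,2,1)] by (simp add: T mult.assoc mult.left_commute[of D])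
        from D_cancel[OF this] show ?thesis using 2(3) by (simp add: h \<psi>_var \<psi>_const)
      qed
    qed
    with step show ?case by (simp add: h)
  qed (simp add: h)
  have "f \<notin> A" using f retraction_fixes[of f] by auto
  then have f_notin: "degree (\<phi> f) > 0" using A_iff_degree[of f] by simp
  \<comment> \<open>Descent on the degree under \<phi>. The kernel part p of b satisfies
    \<open>d p = f G\<close>, and each \<open>f\<^sub>\<mu> G / d\<close> is a polynomial of smaller
    degree than b, as f has positive degree. Then
    \<open>p = \<Sum> (z\<^sub>\<mu> f / d) (f\<^sub>\<mu> G / d)\<close> because
    \<open>\<Sum> f\<^sub>\<mu> z\<^sub>\<mu> = d\<close>.\<close>
  have surj: "\<exists>q\<in>?S. \<psi> q = b" for b
  proof (induction "degree (\<phi> b)" arbitrary: b rule: less_induct)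
    case less
    show ?case
    proof (cases "b \<in> A")
      case True
      then show ?thesis using sym_pre_const[OF A] \<psi>_const by blast
    next
      case False
      define p where "p = b - \<pi> b"
      have p0: "p \<noteq> 0" using False retraction_in[of b] by (auto simp: p_def)
      have "\<pi> p = 0"
        by (simp add: p_def ring_hom_funD[OF \<pi>(1)] retraction_fixes[OF retraction_in])
      then obtain G where G: "D * p = f * G" "\<And>\<nu>. Poly_Mapping.lookup G \<nu> \<in> content_ideal"
        using kernel_divides by blast
      have "\<phi> p = \<phi> b + [:- \<pi> b:]"
        using retraction_in[of b] inv by (auto simp: p_def ring_hom_funD[OF exp_mapD(1)[OF \<phi>]] invariants_def)
      then have deg_p: "degree (\<phi> p) = degree (\<phi> b)"
        using False A_iff_degree by (simp add: degree_add_eq_left)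
      have G0: "G \<noteq> 0" using G(1) p0 const_some_coeff_nonzero pm_no_zero_divisors[of D p] by auto
      have deg_const: "degree (\<phi> (pm_const r)) = 0" for r using A_iff_degree const_A by blast
      have "degree (\<phi> (D * p)) = degree (\<phi> (f * G))" using G(1) by simp
      then have deg_G: "degree (\<phi> G) < degree (\<phi> b)"
        using pm_degree_exp_map_mult[OF \<phi> const_some_coeff_nonzero p0] pm_degree_exp_map_mult[OF \<phi> f(2) G0]
          f_notin deg_p deg_const by simp
      have "\<exists>q\<in>?S. D * \<psi> q = ?c \<mu> * G" if \<mu>: "\<mu> \<in> ?F" for \<mu>
      proof -
        have "\<exists>H. ?c \<mu> * G = D * H"
          using G(2) by (intro pm_const_dvd) (simp add: lookup_const_mult content_ideal_def mult.commute[of "fc \<mu>"])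
        then obtain H where H: "?c \<mu> * G = D * H" by blast
        have c0: "?c \<mu> \<noteq> 0" using \<mu> by (metis in_keys_iff lookup_single_eq lookup_zero)
        have H0: "H \<noteq> 0" using H c0 G0 pm_no_zero_divisors[of "?c \<mu>" G] by auto
        have "degree (\<phi> (?c \<mu> * G)) = degree (\<phi> (D * H))" using H by simp
        then have "degree (\<phi> H) = degree (\<phi> G)"
          using pm_degree_exp_map_mult[OF \<phi> const_some_coeff_nonzero H0] pm_degree_exp_map_mult[OF \<phi> c0 G0] deg_const
          by simp
        with deg_G less.hyps[of H] H show ?thesis by auto
      qed
      then have "\<forall>\<mu>\<in>?F. \<exists>q. q \<in> ?S \<and> D * \<psi> q = ?c \<mu> * G" by blast
      then obtain q where "\<forall>\<mu>\<in>?F. q \<mu> \<in> ?S \<and> D * \<psi> (q \<mu>) = ?c \<mu> * G"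
        using bchoice[of ?F "\<lambda>\<mu> q. q \<in> ?S \<and> D * \<psi> q = ?c \<mu> * G"] by blast
      then have q: "\<And>\<mu>. \<mu> \<in> ?F \<Longrightarrow> q \<mu> \<in> ?S" "\<And>\<mu>. \<mu> \<in> ?F \<Longrightarrow> D * \<psi> (q \<mu>) = ?c \<mu> * G"
        by blast+
      define Q where "Q = pm_const (\<pi> b) + (\<Sum>\<mu>\<in>?F. sym_var (?z \<mu>) * q \<mu>)"
      have "Q \<in> ?S"
        unfolding Q_def
        by (intro sym_pre_add[OF A] sym_pre_sum[OF A] sym_pre_mult[OF A] sym_pre_const[OF A]
            sym_pre_var[OF A] retraction_in zM q(1))
      moreover have "\<psi> Q = b"
      proof -
        have "D * (D * (\<Sum>\<mu>\<in>?F. T (?z \<mu>) * \<psi> (q \<mu>))) = (\<Sum>\<mu>\<in>?F. (D * T (?z \<mu>)) * (D * \<psi> (q \<mu>)))"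
          by (simp only: sum_distrib_left mult_ac)
        also have "\<dots> = (\<Sum>\<mu>\<in>?F. (?c \<mu> * ?z \<mu>) * (f * G))"
          using q(2) T[OF zM] by (intro sum.cong refl) (simp add: mult_ac)
        also have "\<dots> = D * (D * p)" by (simp only: D_sum[symmetric] sum_distrib_right[symmetric] G(1))
        finally have "(\<Sum>\<mu>\<in>?F. T (?z \<mu>) * \<psi> (q \<mu>)) = p" using D_cancel by blast
        then show ?thesis by (simp add: Q_def h \<psi>_const \<psi>_var p_def)
      qed
      ultimately show ?thesis by blast
    qed
  qed
  text \<open>Modulo the relations every element is a sum of homogeneous \<open>W\<^sub>k = Y\<^sub>k (Z / d)\<^sup>k\<close>, where
    \<open>\<psi>(W\<^sub>k) = Y\<^sub>k (f / d)\<^sup>k\<close> determines \<open>Y\<^sub>k\<close> and hence \<open>W\<^sub>k\<close>.\<close>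
  define Z where "Z = (\<Sum>\<mu>\<in>?F. pm_const (?c \<mu>) * sym_var (?z \<mu>))"
  have \<psi>_Z: "\<psi> Z = f"
  proof (rule D_cancel)
    have "D * \<psi> Z = (\<Sum>\<mu>\<in>?F. ?c \<mu> * (D * T (?z \<mu>)))"
      by (simp add: Z_def h \<psi>_const \<psi>_var sum_distrib_left mult.left_commute)
    also have "\<dots> = (\<Sum>\<mu>\<in>?F. (?c \<mu> * ?z \<mu>) * f)" by (simp only: T[OF zM] mult.assoc)
    also have "\<dots> = D * f" by (simp only: D_sum[symmetric] sum_distrib_right[symmetric])
    finally show "D * \<psi> Z = D * f" .
  qed
  have R_mult: "p * r \<in> ?R" if "p \<in> ?S" "r \<in> ?R" for p r
    using that sym_pre_mult[OF A] by (intro fin_comb_mult) auto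
  define NF where "NF q N W Y \<longleftrightarrow> (\<forall>k. W k \<in> ?S) \<and> (\<forall>k. Y k \<in> A) \<and> (\<forall>k\<ge>N. W k = 0)
      \<and> q - (\<Sum>k<N. W k) \<in> ?R \<and> (\<forall>k. pm_const (D ^ k) * W k = pm_const (Y k) * Z ^ k)" for q N W Y
  have NF_D: "W k \<in> ?S" "Y k \<in> A" "k \<ge> N \<Longrightarrow> W k = 0" "q - (\<Sum>k<N. W k) \<in> ?R"
    "pm_const (D ^ k) * W k = pm_const (Y k) * Z ^ k" if "NF q N W Y" for q N W Y k
    using that by (simp_all add: NF_def)
  have normal_form: "\<exists>N W Y. NF q N W Y" if "q \<in> ?S" for q
    using that
  proof (induction rule: sym_pre_induct[OF A, consumes 1, case_names const add var_mult])
    case (const a)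
    have "pm_const a \<in> ?S" "0 \<in> ?S" "0 \<in> A"
      using const sym_pre_const[OF A, of _ M] subringD(2)[OF A] single_zero by metis+
    then have "NF (pm_const a) 1 (\<lambda>k. if k = 0 then pm_const a else 0) (\<lambda>k. if k = 0 then a else 0)"
      using const fin_comb_0 by (simp add: NF_def)
    then show ?case by blast
  next
    case (add p q)
    then obtain N W Y N' W' Y' where 1: "NF p N W Y" and 2: "NF q N' W' Y'" by blast
    note 1 = NF_D[OF 1] and 2 = NF_D[OF 2]
    have "(\<Sum>k<N + N'. W k) = (\<Sum>k<N. W k)" "(\<Sum>k<N + N'. W' k) = (\<Sum>k<N'. W' k)"
      by (intro sum.mono_neutral_right; use 1(3) 2(3) in simp)+
    then have "p + q - (\<Sum>k<N + N'. W k + W' k) \<in> ?R"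
      using fin_comb_add[OF 1(4) 2(4)] by (simp add: sum.distrib algebra_simps)
    then have "NF (p + q) (N + N') (\<lambda>k. W k + W' k) (\<lambda>k. Y k + Y' k)"
      unfolding NF_def
      using 1(1,2,3,5) 2(1,2,3,5) sym_pre_add[OF A] subringD(3)[OF A]
      by (simp add: distrib_left distrib_right single_add)
    then show ?case by blast
  next
    case (var_mult m q)
    then obtain N W Y where "NF q N W Y" by blast
    note 1 = NF_D[OF this]
    have m: "m \<in> M" by (rule var_mult(1))
    \<comment> \<open>The variable \<open>T\<^sub>m\<close> rewritten by
      \<open>m = \<Sum> (f\<^sub>\<mu> m / d) z\<^sub>\<mu>\<close>. It is congruent to
      \<open>T\<^sub>m\<close> modulo the relations, but \<open>d \<tau> = m Z\<close> holds exactly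
      in the polynomial ring, which keeps the last condition of \<open>NF\<close> an
      equation.\<close>
    define \<tau> where "\<tau> = (\<Sum>\<mu>\<in>?F. pm_const (\<beta> \<mu> m) * sym_var (?z \<mu>))"
    have \<tau>_S: "\<tau> \<in> ?S"
      unfolding \<tau>_def
      by (intro sym_pre_sum[OF A] sym_pre_mult[OF A] sym_pre_const[OF A] sym_pre_var[OF A] zM \<beta>(1) m)
    have "m = (\<Sum>\<mu>\<in>?F. \<beta> \<mu> m * ?z \<mu>)"
    proof (rule D_cancel)
      have "D * (\<Sum>\<mu>\<in>?F. \<beta> \<mu> m * ?z \<mu>) = (\<Sum>\<mu>\<in>?F. D * \<beta> \<mu> m * ?z \<mu>)"
        by (simp add: sum_distrib_left mult.assoc)
      also have "\<dots> = (\<Sum>\<mu>\<in>?F. (?c \<mu> * ?z \<mu>) * m)" unfolding \<beta>(2)[OF m] by (simp only: mult_ac)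
      also have "\<dots> = D * m" by (simp only: D_sum[symmetric] sum_distrib_right[symmetric])
      finally show "D * m = D * (\<Sum>\<mu>\<in>?F. \<beta> \<mu> m * ?z \<mu>)" ..
    qed
    then have \<tau>_rel: "sym_var m - \<tau> \<in> ?R"
      using sym_rel_sum[OF A ideal_of_extended_ideal F, of "\<lambda>\<mu>. \<beta> \<mu> m" ?z] \<beta>(1)[OF m] zM
      unfolding \<tau>_def by simp
    note cm = ring_hom_funD(2)[OF ring_hom_fun_pm_const]
    have D\<tau>: "pm_const D * \<tau> = pm_const m * Z"
    proof -
      have "pm_const D * \<tau> = (\<Sum>\<mu>\<in>?F. pm_const (D * \<beta> \<mu> m) * sym_var (?z \<mu>))"
        unfolding \<tau>_def sum_distrib_left cm by (simp only: mult.assoc)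
      also have "\<dots> = (\<Sum>\<mu>\<in>?F. pm_const m * (pm_const (?c \<mu>) * sym_var (?z \<mu>)))"
        unfolding \<beta>(2)[OF m] cm by (simp only: mult_ac)
      finally show ?thesis by (simp add: Z_def sum_distrib_left)
    qed
    \<comment> \<open>Multiplication by \<tau> raises the degree by one, so the components move up
      one index and the zeroth becomes 0.\<close>
    define W' where "W' k = (case k of 0 \<Rightarrow> 0 | Suc j \<Rightarrow> \<tau> * W j)" for k
    define Y' where "Y' k = (case k of 0 \<Rightarrow> 0 | Suc j \<Rightarrow> m * Y j)" for k
    have mA: "m \<in> A" using M(3)[OF m m subringD(1)[OF A]] .
    have zero_S: "0 \<in> ?S" using sym_pre_const[OF A subringD(2)[OF A], of M] by simp
    have "W' k \<in> ?S" for k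
      using zero_S sym_pre_mult[OF A \<tau>_S 1(1)] by (simp add: W'_def split: nat.split)
    moreover have "Y' k \<in> A" for k
      using subringD(2)[OF A] subringD(4)[OF A mA 1(2)] by (simp add: Y'_def split: nat.split)
    moreover have "W' k = 0" if "k \<ge> Suc N" for k
      using that 1(3) by (simp add: W'_def split: nat.split)
    moreover have "sym_var m * q - (\<Sum>k<Suc N. W' k) \<in> ?R"
    proof -
      have "(\<Sum>k<Suc N. W' k) = \<tau> * (\<Sum>k<N. W k)"
        unfolding sum.lessThan_Suc_shift by (simp add: W'_def sum_distrib_left)
      then have "sym_var m * q - (\<Sum>k<Suc N. W' k)
          = sym_var m * (q - (\<Sum>k<N. W k)) + (\<Sum>k<N. W k) * (sym_var m - \<tau>)"
        by (simp add: algebra_simps)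
      also have "\<dots> \<in> ?R"
        by (intro fin_comb_add R_mult 1(4) \<tau>_rel sym_pre_var[OF A] m sym_pre_sum[OF A] 1(1))
      finally show ?thesis .
    qed
    moreover have "pm_const (D ^ k) * W' k = pm_const (Y' k) * Z ^ k" for k
    proof (cases k)
      case (Suc j)
      have "pm_const (D ^ k) * W' k = (pm_const D * \<tau>) * (pm_const (D ^ j) * W j)"
        by (simp only: Suc W'_def nat.case power_Suc cm mult_ac)
      also have "\<dots> = pm_const (Y' k) * Z ^ k"
        unfolding D\<tau> 1(5) by (simp only: Suc Y'_def nat.case power_Suc cm mult_ac)
      finally show ?thesis .
    qed (simp add: W'_def Y'_def)
    ultimately have "NF (sym_var m * q) (Suc N) W' Y'" unfolding NF_def by blast
    then show ?case by blast
  qed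
  \<comment> \<open>The variables here are not indexed by a finite type, so the constant is
    cancelled coefficient by coefficient.\<close>
  have const_cancel: "W = 0" if "pm_const (D ^ k) * W = 0" for k and W :: "_ \<Rightarrow>\<^sub>0 (('v \<Rightarrow>\<^sub>0 nat) \<Rightarrow>\<^sub>0 'r)"
  proof (rule poly_mapping_eqI)
    fix \<mu>
    have "D ^ k * Poly_Mapping.lookup W \<mu> = 0"
      using arg_cong[OF that, of "\<lambda>p. Poly_Mapping.lookup p \<mu>"] by (simp add: lookup_const_mult)
    with const_some_coeff_power_nonzero[of k] pm_no_zero_divisors show "Poly_Mapping.lookup W \<mu> = Poly_Mapping.lookup 0 \<mu>"
      by fastforce
  qed
  have kernel: "q \<in> ?R" if q: "q \<in> ?S" "\<psi> q = 0" for q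
  proof -
    obtain N W Y where "NF q N W Y" using normal_form[OF q(1)] by blast
    note W = NF_D(1,2,4,5)[OF this]
    have \<psi>W: "D ^ k * \<psi> (W k) = Y k * f ^ k" for k
      using arg_cong[OF W(4)[of k], of \<psi>] by (simp add: h \<psi>_const \<psi>_Z)
    have "(\<Sum>k<N. \<psi> (W k)) = 0" using \<psi>_rel[OF W(3)] q(2) by (simp add: h)
    \<comment> \<open>The k-th summand has denominator \<open>d\<^sup>k\<close>; the factor
      \<open>D ^ N\<close> clears all of them and leaves a polynomial relation for f over A.\<close>
    then have "(\<Sum>k<N. D ^ N * \<psi> (W k)) = 0" by (simp flip: sum_distrib_left)
    moreover have "D ^ N * \<psi> (W k) = (D ^ (N - k) * Y k) * f ^ k" if "k < N" for k
    proof -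
      have "D ^ N = D ^ (N - k) * D ^ k" using that by (simp flip: power_add)
      then show ?thesis using \<psi>W[of k] by (simp add: mult.assoc)
    qed
    ultimately have "(\<Sum>k<N. (D ^ (N - k) * Y k) * f ^ k) = 0" by simp
    moreover have "D ^ (N - k) * Y k \<in> A" for k
      by (intro subringD[OF A] const_A W(2))
    ultimately have DY: "D ^ (N - k) * Y k = 0" if "k < N" for k
      using that by (intro f_transcendental[of N "\<lambda>k. D ^ (N - k) * Y k"]) auto
    have "W k = 0" if "k < N" for k
    proof -
      have Y0: "Y k = 0" using DY[OF that] const_some_coeff_power_nonzero pm_no_zero_divisors by blast
      show ?thesis by (rule const_cancel[of k]) (simp add: W(4) Y0)
    qed
    with W(3) show ?thesis by simp
  qed
  have rel_S: "sym_rel A M \<subseteq> ?S"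
  proof
    fix s assume "s \<in> sym_rel A M"
    then show "s \<in> ?S"
      using M subringD(1)[OF A]
      by (auto simp: sym_rel_def intro!: sym_pre_diff[OF A] sym_pre_var[OF A] sym_pre_mult[OF A] sym_pre_const[OF A])
  qed
  have "r \<in> ?S" if "r \<in> ?R" for r
    using that
  proof (induction rule: fin_comb_induct)
    case zero
    show ?case using sym_pre_const[OF A subringD(2)[OF A], of M] by simp
  next
    case (step p s x)
    then show ?case using rel_S by (intro sym_pre_add[OF A] sym_pre_mult[OF A]) auto
  qed
  then have "{p \<in> ?S. \<psi> p = 0} = ?R" using kernel \<psi>_rel by blast
  moreover have "b \<in> \<psi> ` ?S" for b using surj[of b] by (auto intro: rev_image_eqI)
  then have "\<psi> ` ?S = UNIV" by (intro UNIV_eq_I[symmetric])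
  ultimately show ?thesis
    unfolding iso_sym_alg_def by (intro exI[of _ \<psi>]) (simp add: h \<psi>_const)
qed

end

theorem theorem4p5:
  fixes A :: "(('v::finite \<Rightarrow>\<^sub>0 nat) \<Rightarrow>\<^sub>0 'r::idom) set"
  assumes "noetherian_ring TYPE('r)"
    and "normal_domain TYPE('r)"
    and "R_subalgebra A"
  shows "(retract A \<and>
           (\<exists>\<phi>. exp_map A \<phi> \<and> A = invariants \<phi> \<and> \<phi> \<noteq> (\<lambda>b. [:b:])))
     \<longleftrightarrow> (\<exists>I::'r set. invertible_ideal I \<and> iso_sym_alg A (fin_comb A (rconst ` I)))"
proof -
  have const: "pm_const r \<in> A" for r using assms(3) by (auto simp: R_subalgebra_def rconst_def)
  have "1 \<in> A" using const[of 1] by simp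
  then have A: "subring A" using assms(3) by (simp add: subring_def R_subalgebra_def)
  show ?thesis
  proof
    assume "retract A \<and> (\<exists>\<phi>. exp_map A \<phi> \<and> A = invariants \<phi> \<and> \<phi> \<noteq> (\<lambda>b. [:b:]))"
    then obtain \<pi> \<phi> where \<pi>: "ring_hom_fun \<pi>" "\<pi> \<circ> \<pi> = \<pi>" "range \<pi> = A"
      and \<phi>: "exp_map A \<phi>" "invariants \<phi> = A" "\<phi> \<noteq> (\<lambda>b. [:b:])"
      unfolding retract_def by blast
    obtain f where f: "\<pi> f = 0" "f \<noteq> 0"
      "\<forall>p. \<pi> p = 0 \<longrightarrow> (\<exists>r g. r \<noteq> 0 \<and> pm_const r * p = f * g)"
      using pm_retract_kernel_generator[OF \<phi>(1,3) _ \<pi>(1,2)] \<pi>(3) \<phi>(2) const by metis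
    note facts = noetherian_normal_compl_int_closed[OF assms(1,2)] A const \<phi>(1,2) \<pi> f
    show "\<exists>I. invertible_ideal I \<and> iso_sym_alg A (fin_comb A (rconst ` I))"
      using invertible_content_ideal[OF facts] iso_sym_alg_extended_ideal[OF facts]
      unfolding extended_ideal_def[OF facts] by blast
  next
    assume "\<exists>I::'r set. invertible_ideal I \<and> iso_sym_alg A (fin_comb A (rconst ` I))"
    then obtain I :: "'r set" where I: "invertible_ideal I" "iso_sym_alg A (fin_comb A (rconst ` I))"
      by blast
    \<comment> \<open>The zero ideal is not invertible: its product with any J is 0 and does not
      contain 1.\<close>
    obtain s where s: "s \<in> I" "s \<noteq> 0"
    proof (rule ccontr)
      assume "\<not> thesis"
      then have I0: "I \<subseteq> {0}" using that by blast
      obtain J :: "'r fract set" where J: "fin_comb ((\<lambda>r. Fract r 1) ` I) J = range (\<lambda>r. Fract r 1)"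
        using I(1) by (auto simp: invertible_ideal_def)
      have "x = 0" if "x \<in> fin_comb ((\<lambda>r. Fract r 1) ` I) J" for x
        using that I0 by (induction rule: fin_comb_induct) (auto simp: Zero_fract_def)
      moreover have "(1 :: 'r fract) \<in> fin_comb ((\<lambda>r. Fract r 1) ` I) J"
        unfolding J One_fract_def by blast
      ultimately show False by fastforce
    qed
    let ?M = "fin_comb A (rconst ` I)"
    have M: "ideal_of A ?M"
      unfolding ideal_of_def
    proof (intro conjI ballI subsetI)
      show "a * m \<in> ?M" if "a \<in> A" "m \<in> ?M" for a m
        using that subringD(4)[OF A] by (intro fin_comb_mult) auto
      show "m \<in> A" if "m \<in> ?M" for m
        using that by (induction rule: fin_comb_induct) (auto simp: rconst_def intro!: subringD[OF A] const)
    qed (rule fin_comb_add)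
    have "rconst s \<in> ?M" using fin_comb_mem[OF subringD(1)[OF A], of "rconst s" "rconst ` I"] s(1) by simp
    moreover have "rconst s \<noteq> (0 :: ('v \<Rightarrow>\<^sub>0 nat) \<Rightarrow>\<^sub>0 'r)"
      using s(2) unfolding rconst_def by (metis lookup_single_eq lookup_zero)
    ultimately show "retract A \<and> (\<exists>\<phi>. exp_map A \<phi> \<and> A = invariants \<phi> \<and> \<phi> \<noteq> (\<lambda>b. [:b:]))"
      using iso_sym_alg_imp_retract_exp_map[OF A M pm_no_zero_divisors _ _ I(2)] by blast
  qed
qed

end
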